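(* Let $\mathcal C$ be a regular complete generalized cluster structure on $V=\mathbb A^s\setminus\bigcup_{i\in I}D_i$, $D_i=\{g_i=0\}$. Assume that there exists a seed $\Sigma=(Q,F\cup G)$ of $\mathcal C$, $G=\{g_i\}_{i\in I}$, such that for every $i\in I$ each coordinate function $y_m$, $m\in[1,s]$, can be written as a rational expression in $(\widehat F\cup G)\setminus\{g_i\}$ at a generic point of $D_i$. Then (i) there exists a coherent pullback $\widehat{\mathcal C}$ of $\mathcal C$ to $\mathbb A^s$; (ii) the rational expressions for $y_m$ are Laurent polynomials that do not contain frozen variables in $\widehat F$ in the denominator; (iii) if additionally these rational expressions do not contain variables in $G$ in the denominator, then $\widehat{\mathcal C}$ is complete.
   Context: All varieties are over $\mathbb C$. Generalized cluster structure. A seed $\Sigma=(Q,\{f_l\}_{l=1}^s,\mathcal P)$ (the strings $\mathcal P$ are sometimes suppressed) consists of: a quiver with multiplicities $Q=(Q,d_1,\dots,d_n)$ on vertices $1,\dots,s$ without loops and 2-cycles, vertices $1,\dots,n$ mutable with multiplicities $d_m\ge1$, vertices $n+1,\dots,s$ frozen; a cluster $f_1,\dots,f_s$ (algebraically independent generators of the field of rational functions; $f_{n+1},\dots,f_s$ frozen variables); strings $(p_{mr})_{0\le r\le d_m}$ of exchange coefficients depending only on frozen variables, $p_{m0}=p_{md_m}=1$. Let $b_{ml}$ be the number of arrows from $m$ to $l$. The adjacent seed in direction $m\in[1,n]$ replaces $f_m$ by $f_m'$ given by $f_mf_m'=P_m=\sum_{r=0}^{d_m}T_r$, $$T_r=p_{mr}\prod_{l\le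 n}f_l^{rb_{ml}}\prod_{l>n}f_l^{\lfloor rb_{ml}/d_m\rfloor}\prod_{l\le n}f_l^{(d_m-r)b_{lm}}\prod_{l>n}f_l^{\lfloor(d_m-r)b_{lm}/d_m\rfloor}.$$ Coefficients mutate by $p'_{mr}=p_{m,d_m-r}$, the others unchanged. Quiver mutation at $m$: each path $i\to m\to j$ contributes $d_m$ arrows $i\to j$ if $i,j$ are both mutable, and $d_a$ arrows $i\to j$ if exactly one of $i,j$ is mutable, $a$ being the mutable one; then arrows at $m$ are reversed and 2-cycles deleted; multiplicities do not change. Setting. $G=\{g_i\}_{i\in I}$ is a finite collection of distinct irreducible polynomials on $\mathbb A^s$ (coordinates $y_1,\dots,y_s$). Every cluster of $\mathcal C$ contains $G$ among its frozen variables and is written $F\cup G=\{f_l\}_{l=1}^s$ ($F$ may contain other frozen variables); the right-hand sides $P_m$ lie in $\mathbb C[\{f_l\}_{l\ne m},\{g_i^{\pm1}\}_{i\in I}]$. $\mathcal C$ is regular if all variables in all clusters are regular functions on $V$. The upper cluster algebra $\overline{\mathcal A}$ of $\mathcal C$ is the intersection over all clusters of the rings of Laurent polynomials in the mutable cluster variables over the ground ring $\mathbb C[\{\text{frozen variables in }F\},\{g_i^{\pm1}\}_{i\in I}]$; $\mathcal C$ is complete if $\overline{\mathcal A}=\mathbb C[V]$. Any regular function $f$ on $V$ is uniquely $f=\hat f\prod_{i\in I}g_i^{-\lambda_i(f)}$ with $\hat f\in\mathbb C[y_1,\dots,y_s]$ not divisible by any $g_i$, $\lambda_i(f)\in\mathbb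 Z$. For a seed with cluster $F\cup G$, $\widehat F=\{\hat f: f\in F\}$; $\hat f$ is called frozen if $f$ is frozen. For an exchange relation $f_mf_m'=P_m$ in any seed, substitute $f_l=\hat f_l\prod_ig_i^{-\lambda_i(f_l)}$ and write $P_m=\tilde P_m/\prod_{i}g_i^{\Lambda_i(P_m)}$, with $\tilde P_m$ a polynomial in the (formal) variables $\hat f_l$ ($l\ne m$, $f_l\in F$) and $g_i$, not divisible by any of the variables $g_i$. A coherent pullback $\widehat{\mathcal C}$ of $\mathcal C$ to $\mathbb A^s$ exists if for every seed and every mutable $m$ one has $\prod_ig_i^{\lambda_i(f_m)+\lambda_i(f_m')-\Lambda_i(P_m)}=1$, and for every seed the family $\widehat F\cup G$ is algebraically independent on $\mathbb A^s$. Then $\widehat{\mathcal C}$ is the almost-cluster structure on $\mathbb A^s$ whose almost-clusters are the families $\widehat F\cup G$ over all seeds of $\mathcal C$, with exchange relations $\hat f_m\hat f_m'=\tilde P_m$. Its algebra $\widehat{\mathcal A}$ is the intersection over all almost-clusters of the rings of Laurent polynomials in (mutable) almost-cluster variables over the ground ring of polynomials in the frozen variables (the frozen variables in $\widehat F$ and all $g_i$). $\widehat{\mathcal C}$ is complete if $\widehat{\mathcal A}=\mathbb C[\mathbb A^s]=\mathbb C[y_1,\dots,y_s]$. *)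

theory Defs
  imports
    Complex_Main
    "HOL-Library.Poly_Mapping"
    "HOL-Computational_Algebra.Polynomial_Factorial"
begin

section \<open>Polynomials and rational functions over the complex numbers\<close>

text \<open>
  Polynomials in variables indexed by the natural numbers (exponent vectors are finitely
  supported), and the fraction field of that ring. For affine $s$-space only the variables with
  index in \<open>{1..s}\<close> are used. A factor of a nonzero polynomial in these variables, and a
  quotient of two of them that is a polynomial, involves no other variable, so \<open>irreducible\<close>
  and \<open>dvd\<close> in the type \<open>mpoly\<close> agree with the same notions in
  $\mathbf{C}[y_1,\dots,y_s]$. The same types also serve for formal expressions, variable
  number $l$ standing for the $l$-th member of a cluster.
\<close>

type_synonym mpoly = "(nat \<Rightarrow>\<^sub>0 nat) \<Rightarrow>\<^sub>0 complex"
type_synonym ratfun = "mpoly fract"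

definition Const :: "complex \<Rightarrow> mpoly" where
  "Const c = Poly_Mapping.single 0 c"

definition Var :: "nat \<Rightarrow> mpoly" where
  "Var l = Poly_Mapping.single (Poly_Mapping.single l 1) 1"

definition polys :: "nat set \<Rightarrow> mpoly set" where
  "polys J = {p. \<forall>e \<in> Poly_Mapping.keys p. Poly_Mapping.keys e \<subseteq> J}"

definition mp_eval :: "(complex \<Rightarrow> 'a) \<Rightarrow> (nat \<Rightarrow> 'a) \<Rightarrow> mpoly \<Rightarrow> 'a::comm_semiring_1" where
  "mp_eval c x p = (\<Sum>e \<in> Poly_Mapping.keys p.
     c (Poly_Mapping.lookup p e) * (\<Prod>l \<in> Poly_Mapping.keys e. x l ^ Poly_Mapping.lookup e l))"

text \<open>A point of affine $s$-space is given by the values \<open>x 1, \<dots>, x s\<close>; the other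
  values of \<open>x\<close> have no influence on polynomials in \<open>polys {1..s}\<close>.\<close>

definition value_at :: "(nat \<Rightarrow> complex) \<Rightarrow> mpoly \<Rightarrow> complex" where
  "value_at = mp_eval (\<lambda>c. c)"

definition subst_at :: "(nat \<Rightarrow> ratfun) \<Rightarrow> mpoly \<Rightarrow> ratfun" where
  "subst_at = mp_eval (\<lambda>c. to_fract (Const c))"

inductive_set alg_gen :: "ratfun set \<Rightarrow> ratfun set" for A :: "ratfun set" where
  const: "to_fract (Const c) \<in> alg_gen A"
| base: "a \<in> A \<Longrightarrow> a \<in> alg_gen A"
| add: "a \<in> alg_gen A \<Longrightarrow> b \<in> alg_gen A \<Longrightarrow> a + b \<in> alg_gen A"
| mult: "a \<in> alg_gen A \<Longrightarrow> b \<in> alg_gen A \<Longrightarrow> a * b \<in> alg_gen A"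

inductive_set field_gen :: "ratfun set \<Rightarrow> ratfun set" for A :: "ratfun set" where
  const: "to_fract (Const c) \<in> field_gen A"
| base: "a \<in> A \<Longrightarrow> a \<in> field_gen A"
| add: "a \<in> field_gen A \<Longrightarrow> b \<in> field_gen A \<Longrightarrow> a + b \<in> field_gen A"
| mult: "a \<in> field_gen A \<Longrightarrow> b \<in> field_gen A \<Longrightarrow> a * b \<in> field_gen A"
| inverse: "a \<in> field_gen A \<Longrightarrow> inverse a \<in> field_gen A"

definition alg_indep :: "nat set \<Rightarrow> (nat \<Rightarrow> ratfun) \<Rightarrow> bool" where
  "alg_indep J f \<longleftrightarrow> (\<forall>p \<in> polys J. subst_at f p = 0 \<longrightarrow> p = 0)"

definition coord :: "nat \<Rightarrow> ratfun" where
  "coord m = to_fract (Var m)"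

definition coordinate_ring :: "nat \<Rightarrow> ratfun set" where
  "coordinate_ring s = to_fract ` polys {1..s}"

text \<open>Regular functions on the complement $V$ of the hypersurfaces \<open>h = 0\<close>, \<open>h \<in> G\<close>:
  rational functions that are defined at every point of $V$.\<close>

definition regular_functions :: "nat \<Rightarrow> mpoly set \<Rightarrow> ratfun set" where
  "regular_functions s G = {f. \<forall>x. (\<forall>h \<in> G. value_at x h \<noteq> 0) \<longrightarrow>
     (\<exists>p \<in> polys {1..s}. \<exists>q \<in> polys {1..s}. value_at x q \<noteq> 0 \<and> f = to_fract p / to_fract q)}"


section \<open>Generalized cluster structures\<close>

text \<open>
  The vertices are \<open>{1..s}\<close>, the mutable ones \<open>{1..n}\<close>; \<open>arr S i j\<close> is the number of
  arrows from \<open>i\<close> to \<open>j\<close>. Only the data at these vertices (and \<open>coef S m r\<close> for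
  \<open>r \<le> mlt S m\<close>) is meaningful.
\<close>

record seed =
  arr :: "nat \<Rightarrow> nat \<Rightarrow> nat"
  mlt :: "nat \<Rightarrow> nat"
  clus :: "nat \<Rightarrow> ratfun"
  coef :: "nat \<Rightarrow> nat \<Rightarrow> ratfun"

definition is_seed :: "nat \<Rightarrow> nat \<Rightarrow> seed \<Rightarrow> bool" where
  "is_seed n s S \<longleftrightarrow>
     (\<forall>l \<in> {1..s}. arr S l l = 0) \<and>
     (\<forall>k \<in> {1..s}. \<forall>l \<in> {1..s}. arr S k l = 0 \<or> arr S l k = 0) \<and>
     (\<forall>m \<in> {1..n}. 1 \<le> mlt S m) \<and>
     alg_indep {1..s} (clus S) \<and>
     field_gen (clus S ` {1..s}) = field_gen (coord ` {1..s}) \<and>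
     (\<forall>m \<in> {1..n}. coef S m 0 = 1 \<and> coef S m (mlt S m) = 1 \<and>
        (\<forall>r \<le> mlt S m. coef S m r \<in> field_gen (clus S ` {n+1..s})))"

definition exchange_rhs :: "nat \<Rightarrow> nat \<Rightarrow> seed \<Rightarrow> nat \<Rightarrow> ratfun" where
  "exchange_rhs n s S m = (let d = mlt S m; b = arr S; f = clus S in
     \<Sum>r = 0..d. coef S m r
       * (\<Prod>l \<in> {1..n}. f l ^ (r * b m l))
       * (\<Prod>l \<in> {n+1..s}. f l ^ (r * b m l div d))
       * (\<Prod>l \<in> {1..n}. f l ^ ((d - r) * b l m))
       * (\<Prod>l \<in> {n+1..s}. f l ^ ((d - r) * b l m div d)))"

definition path_weight :: "nat \<Rightarrow> (nat \<Rightarrow> nat) \<Rightarrow> nat \<Rightarrow> nat \<Rightarrow> nat \<Rightarrow> nat" where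
  "path_weight n d m i j =
     (if i \<in> {1..n} then (if j \<in> {1..n} then d m else d i)
      else (if j \<in> {1..n} then d j else 0))"

text \<open>The truncated subtraction on natural numbers deletes the 2-cycles.\<close>

definition mutate_arr ::
  "nat \<Rightarrow> (nat \<Rightarrow> nat) \<Rightarrow> nat \<Rightarrow> (nat \<Rightarrow> nat \<Rightarrow> nat) \<Rightarrow> nat \<Rightarrow> nat \<Rightarrow> nat" where
  "mutate_arr n d m b = (let
     b' = (\<lambda>i j. if i = m \<or> j = m then b j i
                 else b i j + path_weight n d m i j * (b i m * b m j))
     in (\<lambda>i j. b' i j - b' j i))"

definition mutate :: "nat \<Rightarrow> nat \<Rightarrow> nat \<Rightarrow> seed \<Rightarrow> seed" where
  "mutate n s m S =
     \<lparr> arr = mutate_arr n (mlt S) m (arr S),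
       mlt = mlt S,
       clus = (clus S)(m := exchange_rhs n s S m / clus S m),
       coef = (coef S)(m := (\<lambda>r. coef S m (mlt S m - r))) \<rparr>"

inductive_set mutation_class :: "nat \<Rightarrow> nat \<Rightarrow> seed \<Rightarrow> seed set"
  for n s :: nat and S0 :: seed where
  init: "S0 \<in> mutation_class n s S0"
| step: "S \<in> mutation_class n s S0 \<Longrightarrow> m \<in> {1..n} \<Longrightarrow> mutate n s m S \<in> mutation_class n s S0"

text \<open>A structure is identified with the set of its seeds. The second conjunct makes every
  mutation lead to a seed again, i.e. no exchange polynomial vanishes.\<close>

definition gen_cluster_structure :: "nat \<Rightarrow> nat \<Rightarrow> mpoly set \<Rightarrow> seed set \<Rightarrow> bool" where
  "gen_cluster_structure n s G C \<longleftrightarrow>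
     (\<exists>S0. C = mutation_class n s S0) \<and>
     (\<forall>S \<in> C. is_seed n s S) \<and>
     (\<forall>S \<in> C. to_fract ` G \<subseteq> clus S ` {n+1..s}) \<and>
     (\<forall>S \<in> C. \<forall>m \<in> {1..n}. exchange_rhs n s S m \<in>
        alg_gen (clus S ` ({1..s} - {m}) \<union> inverse ` to_fract ` G))"

definition regular_structure :: "nat \<Rightarrow> mpoly set \<Rightarrow> seed set \<Rightarrow> bool" where
  "regular_structure s G C \<longleftrightarrow> (\<forall>S \<in> C. clus S ` {1..s} \<subseteq> regular_functions s G)"

definition upper_cluster_algebra :: "nat \<Rightarrow> nat \<Rightarrow> mpoly set \<Rightarrow> seed set \<Rightarrow> ratfun set" where
  "upper_cluster_algebra n s G C = (\<Inter>S \<in> C.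
     alg_gen (clus S ` {1..s} \<union> inverse ` clus S ` {1..n} \<union> inverse ` to_fract ` G))"

definition complete_structure :: "nat \<Rightarrow> nat \<Rightarrow> mpoly set \<Rightarrow> seed set \<Rightarrow> bool" where
  "complete_structure n s G C \<longleftrightarrow> upper_cluster_algebra n s G C = regular_functions s G"


section \<open>Coherent pullbacks\<close>

text \<open>The decomposition of a nonzero regular function as a polynomial not divisible by any
  \<open>h \<in> G\<close> times the product of the \<open>h\<close> to the powers \<open>- k h\<close>.\<close>

definition pole_decomp :: "nat \<Rightarrow> mpoly set \<Rightarrow> ratfun \<Rightarrow> mpoly \<Rightarrow> (mpoly \<Rightarrow> int) \<Rightarrow> bool" where
  "pole_decomp s G f p k \<longleftrightarrow>
     p \<in> polys {1..s} \<and> (\<forall>h \<in> G. \<not> h dvd p) \<and>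
     f = to_fract p * (\<Prod>h \<in> G. to_fract h powi (- k h))"

definition hat :: "nat \<Rightarrow> mpoly set \<Rightarrow> ratfun \<Rightarrow> mpoly" where
  "hat s G f = (THE p. \<exists>k. pole_decomp s G f p k)"

definition pole_order :: "nat \<Rightarrow> mpoly set \<Rightarrow> ratfun \<Rightarrow> mpoly \<Rightarrow> int" where
  "pole_order s G f h = (THE a. \<exists>p k. pole_decomp s G f p k \<and> k h = a)"

definition G_vertices :: "nat \<Rightarrow> mpoly set \<Rightarrow> seed \<Rightarrow> nat set" where
  "G_vertices s G S = {l \<in> {1..s}. clus S l \<in> to_fract ` G}"

definition almost_cluster :: "nat \<Rightarrow> mpoly set \<Rightarrow> seed \<Rightarrow> nat \<Rightarrow> mpoly" where
  "almost_cluster s G S l =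
     (if l \<in> G_vertices s G S then (THE h. to_fract h = clus S l) else hat s G (clus S l))"

text \<open>\<open>reduced_rhs n s G S m P L\<close>: the right-hand side of the exchange relation is the
  polynomial \<open>P\<close> in the formal almost-cluster variables, divided by the product of the
  \<open>h \<in> G\<close> to the powers \<open>L h\<close>. The identity is stated in the field of rational functions; for
  algebraically independent almost-cluster variables this is the same as a formal identity.\<close>

definition reduced_rhs ::
  "nat \<Rightarrow> nat \<Rightarrow> mpoly set \<Rightarrow> seed \<Rightarrow> nat \<Rightarrow> mpoly \<Rightarrow> (mpoly \<Rightarrow> int) \<Rightarrow> bool" where
  "reduced_rhs n s G S m P L \<longleftrightarrow>
     P \<in> polys ({1..s} - {m}) \<and> (\<forall>l \<in> G_vertices s G S. \<not> Var l dvd P) \<and>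
     exchange_rhs n s S m =
       subst_at (\<lambda>l. to_fract (almost_cluster s G S l)) P / (\<Prod>h \<in> G. to_fract h powi L h)"

definition coherent_pullback_exists :: "nat \<Rightarrow> nat \<Rightarrow> mpoly set \<Rightarrow> seed set \<Rightarrow> bool" where
  "coherent_pullback_exists n s G C \<longleftrightarrow>
     (\<forall>S \<in> C. \<forall>m \<in> {1..n}. \<exists>P L. reduced_rhs n s G S m P L \<and>
        (\<Prod>h \<in> G. to_fract h powi
           (pole_order s G (clus S m) h + pole_order s G (clus (mutate n s m S) m) h - L h)) = 1) \<and>
     (\<forall>S \<in> C. alg_indep {1..s} (\<lambda>l. to_fract (almost_cluster s G S l)))"

definition pullback :: "nat \<Rightarrow> mpoly set \<Rightarrow> seed set \<Rightarrow> (nat \<Rightarrow> mpoly) set" where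
  "pullback s G C = almost_cluster s G ` C"

definition almost_cluster_algebra :: "nat \<Rightarrow> nat \<Rightarrow> (nat \<Rightarrow> mpoly) set \<Rightarrow> ratfun set" where
  "almost_cluster_algebra n s A = (\<Inter>\<phi> \<in> A.
     alg_gen (to_fract ` \<phi> ` {1..s} \<union> inverse ` to_fract ` \<phi> ` {1..n}))"

definition pullback_complete :: "nat \<Rightarrow> nat \<Rightarrow> mpoly set \<Rightarrow> seed set \<Rightarrow> bool" where
  "pullback_complete n s G C \<longleftrightarrow>
     almost_cluster_algebra n s (pullback s G C) = coordinate_ring s"


section \<open>Rational expressions on a divisor\<close>

text \<open>
  \<open>generic_expression s h J \<phi> y R\<close>: the formal rational function \<open>R\<close> in the variables with
  index in \<open>J\<close>, evaluated at the polynomials \<open>\<phi> l\<close>, agrees with the polynomial \<open>y\<close> at a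
  generic point of \<open>h = 0\<close>, i.e. on a nonempty Zariski open subset of that hypersurface, which
  may be taken to be cut out by a single \<open>q \<noteq> 0\<close>.
\<close>

definition generic_expression ::
  "nat \<Rightarrow> mpoly \<Rightarrow> nat set \<Rightarrow> (nat \<Rightarrow> mpoly) \<Rightarrow> mpoly \<Rightarrow> ratfun \<Rightarrow> bool" where
  "generic_expression s h J \<phi> y R \<longleftrightarrow>
     (\<exists>A \<in> polys J. \<exists>B \<in> polys J. B \<noteq> 0 \<and> R = to_fract A / to_fract B \<and>
       (\<exists>q \<in> polys {1..s}.
          (\<exists>x. value_at x h = 0 \<and> value_at x q \<noteq> 0) \<and>
          (\<forall>x. value_at x h = 0 \<and> value_at x q \<noteq> 0 \<longrightarrow>
             (let v = (\<lambda>l. value_at x (\<phi> l)) in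
                value_at v B \<noteq> 0 \<and> value_at x y = value_at v A / value_at v B))))"

text \<open>Formal Laurent polynomials in the variables with index in \<open>J\<close>, only those with index
  in \<open>D\<close> being allowed in the denominator.\<close>

definition laurent_polys :: "nat set \<Rightarrow> nat set \<Rightarrow> ratfun set" where
  "laurent_polys J D = alg_gen ((\<lambda>l. to_fract (Var l)) ` J \<union> (\<lambda>l. inverse (to_fract (Var l))) ` D)"

definition vertices_off :: "nat \<Rightarrow> seed \<Rightarrow> mpoly \<Rightarrow> nat set" where
  "vertices_off s S h = {l \<in> {1..s}. clus S l \<noteq> to_fract h}"

end

theory Submission
  imports Defs "HOL-Computational_Algebra.Fundamental_Theorem_Algebra" "HOL-Library.FuncSet"
begin

text \<open>
  Modulo an irreducible \<open>h \<in> G\<close> the \<open>s\<close> coordinates are rational in the \<open>s - 1\<close> almost-cluster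
  variables other than \<open>h\<close>; by a count of dimensions these are algebraically independent modulo
  \<open>h\<close>. Hence a polynomial in the almost-cluster variables that is not formally divisible by the
  variable \<open>h\<close> is not divisible by the polynomial \<open>h\<close>, so both sides of an exchange relation have
  the same order along every divisor. This gives the coherence of the pullback at that seed, and the
  pulled back exchange relation transports the independence to the neighbouring seeds and so
  to all of them. By completeness each coordinate is a Laurent polynomial in every cluster;
  comparing orders along the divisors cancels the denominators from \<open>G\<close>, and reduction modulo
  \<open>h\<close> identifies the given rational expressions with these Laurent polynomials.
\<close>

section \<open>Evaluation of polynomials\<close>

text \<open>Three languages have to be matched: values at points (regular functions, generic
  expressions), divisibility, and formal polynomials in the vertex variables. Values lead to
  divisibility by a Nullstellensatz for one irreducible polynomial together with primality of
  irreducibles; both rest on an element of least degree in one variable of a suitable ideal, with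
  pseudo-division in place of division. Divisibility leads to formal identities by independence
  modulo \<open>h\<close>. No quotient ring is formed: fractions modulo \<open>h\<close> are treated
  as cross-multiplied congruences. The hypothesis speaks of one seed, an arbitrary member of its
  mutation class, so independence must travel along mutations in both directions. It does, because
  the right-hand side of an exchange relation omits the exchanged variable: it is the same
  polynomial for both neighbours, and independence at either one makes the relation usable. In the
  dimension count all monomials must carry the same factor; only then is a relation between their
  reduced forms a relation between the monomials themselves.\<close>

locale coeff_hom =
  fixes c :: "complex \<Rightarrow> 'a::comm_ring_1"
  assumes c_0: "c 0 = 0" and c_1: "c 1 = 1"
    and c_add: "c (a + b) = c a + c b" and c_mult: "c (a * b) = c a * c b"
begin

definition monom_eval :: "(nat \<Rightarrow> 'a) \<Rightarrow> (nat \<Rightarrow>\<^sub>0 nat) \<Rightarrow> 'a" where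
  "monom_eval x e = (\<Prod>l \<in> Poly_Mapping.keys e. x l ^ Poly_Mapping.lookup e l)"

lemma monom_eval_superset:
  assumes "finite K" "Poly_Mapping.keys e \<subseteq> K"
  shows "monom_eval x e = (\<Prod>l \<in> K. x l ^ Poly_Mapping.lookup e l)"
  unfolding monom_eval_def
  by (rule prod.mono_neutral_left) (use assms in \<open>auto simp: in_keys_iff\<close>)

lemma monom_eval_add: "monom_eval x (e + e') = monom_eval x e * monom_eval x e'"
proof -
  let ?K = "Poly_Mapping.keys e \<union> Poly_Mapping.keys e'"
  have "Poly_Mapping.keys (e + e') \<subseteq> ?K" by (rule Poly_Mapping.keys_add)
  then show ?thesis
    by (simp add: monom_eval_superset[of ?K] lookup_add power_add prod.distrib)
qed

lemma eval_superset:
  assumes "finite E" "Poly_Mapping.keys p \<subseteq> E"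
  shows "mp_eval c x p = (\<Sum>e \<in> E. c (Poly_Mapping.lookup p e) * monom_eval x e)"
  unfolding mp_eval_def monom_eval_def
  by (rule sum.mono_neutral_left) (use assms in \<open>auto simp: in_keys_iff c_0\<close>)

lemma eval_single: "mp_eval c x (Poly_Mapping.single e a) = c a * monom_eval x e"
  by (subst eval_superset[of "{e}"]) auto

lemma zero [simp]: "mp_eval c x 0 = 0"
  by (simp add: mp_eval_def)

lemma add [simp]: "mp_eval c x (p + q) = mp_eval c x p + mp_eval c x q"
proof -
  let ?E = "Poly_Mapping.keys p \<union> Poly_Mapping.keys q"
  have "Poly_Mapping.keys (p + q) \<subseteq> ?E" by (rule Poly_Mapping.keys_add)
  then show ?thesis
    by (simp add: eval_superset[of ?E] lookup_add c_add algebra_simps sum.distrib)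
qed

lemma Const [simp]: "mp_eval c x (Const a) = c a"
  by (simp add: Const_def eval_single monom_eval_def)

lemma Var [simp]: "mp_eval c x (Var l) = x l"
  by (simp add: Var_def eval_single monom_eval_def c_1)

lemma one [simp]: "mp_eval c x 1 = 1"
  using Const[of x 1] by (simp add: Const_def c_1)

lemma eval_sum [simp]: "mp_eval c x (\<Sum>i\<in>I. p i) = (\<Sum>i\<in>I. mp_eval c x (p i))"
  by (induction I rule: infinite_finite_induct) auto

end

lemma mpoly_sum_singles:
  fixes p :: mpoly
  shows "p = (\<Sum>e \<in> Poly_Mapping.keys p. Poly_Mapping.single e (Poly_Mapping.lookup p e))"
proof (rule poly_mapping_eqI)
  fix k
  have "(\<Sum>e\<in>Poly_Mapping.keys p. Poly_Mapping.lookup (Poly_Mapping.single e (Poly_Mapping.lookup p e)) k)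
      = (\<Sum>e\<in>Poly_Mapping.keys p. if e = k then Poly_Mapping.lookup p k else 0)"
    by (rule sum.cong) (auto simp: lookup_single)
  also have "\<dots> = Poly_Mapping.lookup p k"
    by (simp add: in_keys_iff)
  finally show "Poly_Mapping.lookup p k = Poly_Mapping.lookup
      (\<Sum>e \<in> Poly_Mapping.keys p. Poly_Mapping.single e (Poly_Mapping.lookup p e)) k"
    by (simp add: lookup_sum)
qed

context coeff_hom begin

lemma mult [simp]: "mp_eval c x (p * q) = mp_eval c x p * mp_eval c x q"
proof -
  have "p * q = (\<Sum>e \<in> Poly_Mapping.keys p. \<Sum>e' \<in> Poly_Mapping.keys q.
      Poly_Mapping.single (e + e') (Poly_Mapping.lookup p e * Poly_Mapping.lookup q e'))"
    by (subst (1) mpoly_sum_singles[of p], subst (1) mpoly_sum_singles[of q])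
       (simp add: sum_product mult_single)
  also have "mp_eval c x \<dots> = (\<Sum>e \<in> Poly_Mapping.keys p. \<Sum>e' \<in> Poly_Mapping.keys q.
      (c (Poly_Mapping.lookup p e) * monom_eval x e) * (c (Poly_Mapping.lookup q e') * monom_eval x e'))"
    by (simp add: eval_single monom_eval_add c_mult mult_ac)
  also have "\<dots> = mp_eval c x p * mp_eval c x q"
    by (simp add: eval_superset[of "Poly_Mapping.keys p"] eval_superset[of "Poly_Mapping.keys q"]
        sum_product)
  finally show ?thesis .
qed

lemma uminus [simp]: "mp_eval c x (- p) = - mp_eval c x p"
  using add[of x p "- p"] by (simp add: eq_neg_iff_add_eq_0 add.commute del: add)

lemma diff [simp]: "mp_eval c x (p - q) = mp_eval c x p - mp_eval c x q"
  using add[of x p "- q"] by simp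

lemma power [simp]: "mp_eval c x (p ^ k) = mp_eval c x p ^ k"
  by (induction k) auto

lemma prod [simp]: "mp_eval c x (\<Prod>i\<in>I. p i) = (\<Prod>i\<in>I. mp_eval c x (p i))"
  by (induction I rule: infinite_finite_induct) auto

end

lemma Const_0 [simp]: "Const 0 = 0" and Const_1 [simp]: "Const 1 = 1"
  and Const_add: "Const (a + b) = Const a + Const b"
  and Const_mult: "Const (a * b) = Const a * Const b"
  by (simp_all add: Const_def single_add mult_single)

lemma Const_eq_0_iff [simp]: "Const a = 0 \<longleftrightarrow> a = 0"
  unfolding Const_def by (metis lookup_single_eq lookup_zero single_zero)

text \<open>Composition of polynomials: \<open>subst_at\<close> kept inside the polynomial ring,
  where divisibility by members of \<open>G\<close> has a meaning.\<close>

definition psub :: "(nat \<Rightarrow> mpoly) \<Rightarrow> mpoly \<Rightarrow> mpoly" where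
  "psub = mp_eval Const"

text \<open>Regards a polynomial as univariate in \<open>Var k\<close>, with coefficients free of
  that variable; this gives access to degrees, leading coefficients and division.\<close>

definition upoly :: "nat \<Rightarrow> mpoly \<Rightarrow> mpoly poly" where
  "upoly k = mp_eval (\<lambda>a. [:Const a:]) (\<lambda>l. if l = k then [:0, 1:] else [:Var l:])"

interpretation value_at: coeff_hom "\<lambda>a. a" rewrites "mp_eval (\<lambda>a. a) = value_at"
  by unfold_locales (simp_all add: value_at_def)

interpretation subst_at: coeff_hom "\<lambda>a. to_fract (Const a)"
  rewrites "mp_eval (\<lambda>a. to_fract (Const a)) = subst_at"
  by unfold_locales (simp_all add: subst_at_def Const_add Const_mult)

interpretation psub: coeff_hom Const rewrites "mp_eval Const = psub"
  by unfold_locales (simp_all add: psub_def Const_add Const_mult)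

interpretation upoly: coeff_hom "\<lambda>a. [:Const a:]"
  by unfold_locales (simp_all add: Const_add Const_mult one_pCons)

lemma upoly_simps [simp]:
  "upoly k 0 = 0" "upoly k 1 = 1" "upoly k (p + q) = upoly k p + upoly k q"
  "upoly k (p * q) = upoly k p * upoly k q" "upoly k (p - q) = upoly k p - upoly k q"
  "upoly k (- p) = - upoly k p" "upoly k (p ^ i) = upoly k p ^ i" "upoly k (Const a) = [:Const a:]"
  "upoly k (Var l) = (if l = k then [:0, 1:] else [:Var l:])"
  "upoly k (\<Sum>i\<in>I. f i) = (\<Sum>i\<in>I. upoly k (f i))" "upoly k (\<Prod>i\<in>I. f i) = (\<Prod>i\<in>I. upoly k (f i))"
  by (simp_all add: upoly_def)


section \<open>Polynomials in a given set of variables\<close>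

lemma polys_add [intro]: "p \<in> polys J \<Longrightarrow> q \<in> polys J \<Longrightarrow> p + q \<in> polys J"
  unfolding polys_def using Poly_Mapping.keys_add[of p q] by blast

lemma polys_mult [intro]:
  assumes "p \<in> polys J" "q \<in> polys J" shows "p * q \<in> polys J"
  unfolding polys_def
proof safe
  fix e l assume e: "e \<in> Poly_Mapping.keys (p * q)" and l: "l \<in> Poly_Mapping.keys e"
  then obtain a b where "e = a + b" "a \<in> Poly_Mapping.keys p" "b \<in> Poly_Mapping.keys q"
    using keys_mult[of p q] by blast
  moreover have "Poly_Mapping.keys (a + b) \<subseteq> Poly_Mapping.keys a \<union> Poly_Mapping.keys b"
    by (rule Poly_Mapping.keys_add)
  ultimately show "l \<in> J" using assms l unfolding polys_def by blast
qed

lemma polys_Const [intro, simp]: "Const a \<in> polys J"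
  by (auto simp: polys_def Const_def)

lemma polys_Var [intro]: "l \<in> J \<Longrightarrow> Var l \<in> polys J"
  by (auto simp: polys_def Var_def)

lemma polys_0 [intro, simp]: "0 \<in> polys J" and polys_1 [intro, simp]: "1 \<in> polys J"
  using polys_Const[of 0 J] polys_Const[of 1 J] by simp_all

lemma polys_uminus [intro]: "p \<in> polys J \<Longrightarrow> - p \<in> polys J"
  using polys_mult[OF polys_Const, of p J "-1"] by (simp add: Const_def single_uminus)

lemma polys_diff [intro]: "p \<in> polys J \<Longrightarrow> q \<in> polys J \<Longrightarrow> p - q \<in> polys J"
  using polys_add[of p J "- q"] by auto

lemma polys_power [intro]: "p \<in> polys J \<Longrightarrow> p ^ i \<in> polys J"
  by (induction i) auto

lemma polys_sum [intro]: "(\<And>i. i \<in> I \<Longrightarrow> f i \<in> polys J) \<Longrightarrow> (\<Sum>i\<in>I. f i) \<in> polys J"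
  by (induction I rule: infinite_finite_induct) auto

lemma polys_prod [intro]: "(\<And>i. i \<in> I \<Longrightarrow> f i \<in> polys J) \<Longrightarrow> (\<Prod>i\<in>I. f i) \<in> polys J"
  by (induction I rule: infinite_finite_induct) auto

lemma polys_mono: "J \<subseteq> K \<Longrightarrow> p \<in> polys J \<Longrightarrow> p \<in> polys K"
  unfolding polys_def by blast

lemma Var_power: "Var l ^ i = Poly_Mapping.single (Poly_Mapping.single l i) 1"
  by (induction i) (auto simp: Var_def mult_single single_add[symmetric])

lemma single_Const_prod:
  "Poly_Mapping.single e a = Const a * (\<Prod>l \<in> Poly_Mapping.keys e. Var l ^ Poly_Mapping.lookup e l)"
proof -
  have "(\<Prod>l \<in> K. Var l ^ Poly_Mapping.lookup e l)
      = Poly_Mapping.single (\<Sum>l \<in> K. Poly_Mapping.single l (Poly_Mapping.lookup e l)) 1"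
    if "finite K" for K using that
    by induction (auto simp: Var_power mult_single)
  moreover have "(\<Sum>l \<in> Poly_Mapping.keys e. Poly_Mapping.single l (Poly_Mapping.lookup e l)) = e"
  proof (rule poly_mapping_eqI)
    fix k
    have "(\<Sum>l\<in>Poly_Mapping.keys e. Poly_Mapping.lookup (Poly_Mapping.single l (Poly_Mapping.lookup e l)) k)
      = (\<Sum>l\<in>Poly_Mapping.keys e. if l = k then Poly_Mapping.lookup e k else 0)"
      by (rule sum.cong) (auto simp: lookup_single)
    then show "Poly_Mapping.lookup (\<Sum>l \<in> Poly_Mapping.keys e. Poly_Mapping.single l (Poly_Mapping.lookup e l)) k
      = Poly_Mapping.lookup e k"
      by (simp add: lookup_sum in_keys_iff)
  qed
  ultimately show ?thesis by (simp add: Const_def mult_single)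
qed

text \<open>Every polynomial is a sum of products of constants and variables, so identities between
  ring homomorphisms need only be checked on generators.\<close>

lemma polys_induct [consumes 1, case_names Const Var add mult]:
  assumes "p \<in> polys J"
    and C: "\<And>a. P (Const a)" and V: "\<And>l. l \<in> J \<Longrightarrow> P (Var l)"
    and A: "\<And>p q. p \<in> polys J \<Longrightarrow> q \<in> polys J \<Longrightarrow> P p \<Longrightarrow> P q \<Longrightarrow> P (p + q)"
    and M: "\<And>p q. p \<in> polys J \<Longrightarrow> q \<in> polys J \<Longrightarrow> P p \<Longrightarrow> P q \<Longrightarrow> P (p * q)"
  shows "P p"
proof -
  \<comment> \<open>Membership is carried along, since \<open>A\<close> and \<open>M\<close> apply
    only to members of \<open>polys J\<close>.\<close>
  define Q where "Q p \<longleftrightarrow> p \<in> polys J \<and> P p" for p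
  have QM: "Q (p * q)" if "Q p" "Q q" for p q using that M unfolding Q_def by blast
  have QA: "Q (p + q)" if "Q p" "Q q" for p q using that A unfolding Q_def by blast
  have QC: "Q (Const a)" for a using C unfolding Q_def by auto
  have Q1: "Q 1" "Q 0" using QC[of 1] QC[of 0] by simp_all
  have QV: "Q (Var l ^ i)" if "l \<in> J" for l i
  proof (induction i)
    case (Suc i)
    have "Q (Var l)" using that V unfolding Q_def by auto
    then show ?case using QM Suc by simp
  qed (use Q1 in simp)
  have QP: "Q (\<Prod>l \<in> K. Var l ^ f l)" if "K \<subseteq> J" for K f
    using that by (induction K rule: infinite_finite_induct) (auto simp: Q1 intro: QM QV)
  have QS: "Q (\<Sum>e \<in> K. f e)" if "\<And>e. e \<in> K \<Longrightarrow> Q (f e)" for K and f :: "(nat \<Rightarrow>\<^sub>0 nat) \<Rightarrow> mpoly"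
    using that by (induction K rule: infinite_finite_induct) (auto simp: Q1 intro: QA)
  have "Q (\<Sum>e \<in> Poly_Mapping.keys p. Poly_Mapping.single e (Poly_Mapping.lookup p e))"
    using assms(1) by (intro QS) (auto simp: single_Const_prod polys_def intro!: QM QC QP)
  then show ?thesis using mpoly_sum_singles[of p] unfolding Q_def by simp
qed

lemma polys_UNIV [simp]: "p \<in> polys UNIV"
  by (simp add: polys_def)

lemma polys_finite_support: obtains J where "finite J" "p \<in> polys J"
proof
  show "finite (\<Union>e \<in> Poly_Mapping.keys p. Poly_Mapping.keys e)" by simp
  show "p \<in> polys (\<Union>e \<in> Poly_Mapping.keys p. Poly_Mapping.keys e)"
    by (auto simp: polys_def)
qed

lemma value_at_cong:
  assumes "p \<in> polys J" "\<And>l. l \<in> J \<Longrightarrow> x l = y l" shows "value_at x p = value_at y p"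
  using assms(1) by (induction rule: polys_induct) (auto simp: assms(2))

lemma psub_cong:
  assumes "p \<in> polys J" "\<And>l. l \<in> J \<Longrightarrow> \<phi> l = \<psi> l" shows "psub \<phi> p = psub \<psi> p"
  using assms(1) by (induction rule: polys_induct) (auto simp: assms(2))

lemma subst_at_cong:
  assumes "p \<in> polys J" "\<And>l. l \<in> J \<Longrightarrow> f l = g l" shows "subst_at f p = subst_at g p"
  using assms(1) by (induction rule: polys_induct) (auto simp: assms(2))

lemma subst_at_to_fract: "subst_at (\<lambda>l. to_fract (\<phi> l)) p = to_fract (psub \<phi> p)"
  using polys_UNIV[of p] by (induction rule: polys_induct) auto

lemma value_at_psub: "value_at x (psub \<phi> p) = value_at (\<lambda>l. value_at x (\<phi> l)) p"
  using polys_UNIV[of p] by (induction rule: polys_induct) auto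

lemma psub_Var [simp]: "psub Var p = p"
  using polys_UNIV[of p] by (induction rule: polys_induct) auto

lemma poly_upoly [simp]: "poly (upoly k p) (Var k) = p"
  using polys_UNIV[of p] by (induction rule: polys_induct) auto

lemma upoly_eq_iff [simp]: "upoly k p = upoly k q \<longleftrightarrow> p = q"
  by (metis poly_upoly)

lemma upoly_eq_0_iff [simp]: "upoly k p = 0 \<longleftrightarrow> p = 0"
  using upoly_eq_iff[of k p 0] by simp

lemma upoly_free: "p \<in> polys (J - {k}) \<Longrightarrow> upoly k p = [:p:]"
  by (induction rule: polys_induct) auto

lemma coeff_upoly_polys:
  assumes "p \<in> polys J" shows "coeff (upoly k p) i \<in> polys (J - {k})"
  using assms
  by (induction arbitrary: i rule: polys_induct)
     (auto simp: coeff_pCons coeff_mult split: nat.splits if_splits intro!: polys_sum)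

lemma mpoly_decomp: "p = (\<Sum>i\<le>degree (upoly k p). coeff (upoly k p) i * Var k ^ i)"
  using poly_upoly[of k p] by (simp add: poly_altdef)

section \<open>Degree and leading coefficient in one variable\<close>

definition deg :: "nat \<Rightarrow> mpoly \<Rightarrow> nat" where
  "deg k p = degree (upoly k p)"

definition lc :: "nat \<Rightarrow> mpoly \<Rightarrow> mpoly" where
  "lc k p = lead_coeff (upoly k p)"

lemma lc_polys: "p \<in> polys J \<Longrightarrow> lc k p \<in> polys (J - {k})"
  by (simp add: lc_def coeff_upoly_polys)

lemma lc_eq_0_iff [simp]: "lc k p = 0 \<longleftrightarrow> p = 0"
  by (simp add: lc_def)

lemma deg_mult: "p \<noteq> 0 \<Longrightarrow> q \<noteq> 0 \<Longrightarrow> deg k (p * q) = deg k p + deg k q"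
  by (simp add: deg_def degree_mult_eq)

lemma lc_mult: "lc k (p * q) = lc k p * lc k q"
  by (simp add: lc_def lead_coeff_mult)

lemma deg_free: "p \<in> polys (J - {k}) \<Longrightarrow> deg k p = 0"
  by (simp add: deg_def upoly_free)

lemma free_deg:
  assumes "p \<in> polys J" "deg k p = 0" shows "p \<in> polys (J - {k})"
  using mpoly_decomp[of p k] coeff_upoly_polys[OF assms(1), of k 0] assms(2)
  by (simp add: deg_def)

lemma deg_Var [simp]: "deg k (Var l) = (if l = k then 1 else 0)"
  by (simp add: deg_def)

lemma Var_neq_0 [simp]: "Var l \<noteq> 0"
  by (simp add: Var_def) (metis lookup_single_eq lookup_zero zero_neq_one)

lemma deg_diff_le: "deg k (p - q) \<le> max (deg k p) (deg k q)"
  by (simp add: deg_def degree_diff_le_max)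

lemma deg_mult_le: "deg k (p * q) \<le> deg k p + deg k q"
  by (simp add: deg_def degree_mult_le)

lemma polys_empty: assumes "p \<in> polys {}" obtains a where "p = Const a"
proof -
  have "\<exists>a. p = Const a" using assms
    by (induction rule: polys_induct) (auto simp: Const_add[symmetric] Const_mult[symmetric])
  then show ?thesis using that by blast
qed

lemma free_deg_set:
  assumes "p \<in> polys K" "finite L" "\<And>k. k \<in> L \<Longrightarrow> deg k p = 0"
  shows "p \<in> polys (K - L)"
  using assms(2,3)
proof induction
  case (insert k L)
  then have "p \<in> polys (K - L - {k})" by (intro free_deg) auto
  then show ?case by (subst Diff_insert)
qed (use assms(1) in simp)

text \<open>Degrees in each variable add up in a product, so a factor has degree 0 in every variable
  outside \<open>J\<close>. Factors of polynomials on affine space thus stay on affine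
  space.\<close>

lemma dvd_free_imp_free:
  assumes "p * q \<in> polys J" "p * q \<noteq> 0" shows "p \<in> polys J"
proof -
  obtain K where K: "finite K" "p \<in> polys K" by (rule polys_finite_support)
  have "deg k p = 0" if "k \<in> K - J" for k
  proof -
    have "p * q \<in> polys (UNIV - {k})"
      by (rule polys_mono[OF _ assms(1)]) (use that in blast)
    then have "deg k (p * q) = 0" by (rule deg_free)
    then show ?thesis using assms(2) by (simp add: deg_mult)
  qed
  with K have "p \<in> polys (K - (K - J))" by (intro free_deg_set) auto
  moreover have "K - (K - J) \<subseteq> J" by blast
  ultimately show ?thesis by (rule polys_mono[rotated])
qed

section \<open>Irreducible polynomials are prime\<close>

abbreviation punit :: "mpoly \<Rightarrow> bool" where
  "punit p \<equiv> p dvd 1"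

lemma Const_unit: "a \<noteq> 0 \<Longrightarrow> punit (Const a)"
  by (rule dvdI[of _ _ "Const (1 / a)"]) (simp add: Const_mult[symmetric])

lemma punit_iff: "punit p \<longleftrightarrow> p \<noteq> 0 \<and> p \<in> polys {}" for p :: mpoly
proof
  assume "punit p"
  then obtain q where q: "1 = p * q" by (elim dvdE)
  then have "p * q \<in> polys {}" "p * q \<noteq> 0" by (auto simp flip: q)
  then show "p \<noteq> 0 \<and> p \<in> polys {}" using dvd_free_imp_free by auto
next
  assume "p \<noteq> 0 \<and> p \<in> polys {}"
  then show "punit p" using Const_unit polys_empty by (metis Const_0)
qed

lemma dvd_polys:
  fixes p q :: mpoly
  assumes "p dvd q" "q \<in> polys J" "q \<noteq> 0" shows "p \<in> polys J"
  using assms dvd_free_imp_free by (elim dvdE) auto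

text \<open>Cross-multiplication by the leading coefficients makes the top terms cancel without
  dividing by \<open>lc k b\<close>, which need not be invertible.\<close>

lemma cancel_lead:
  assumes "b \<noteq> 0" "deg k b \<le> deg k a"
  defines "a' \<equiv> lc k b * a - lc k a * Var k ^ (deg k a - deg k b) * b"
  shows "a' = 0 \<or> deg k a' < deg k a"
proof -
  have f: "upoly k (lc k p) = [:lc k p:]" for p
    by (rule upoly_free[of _ UNIV]) (rule lc_polys, simp)
  have u: "upoly k a' = smult (lc k b) (upoly k a)
      - smult (lc k a) (monom 1 (deg k a - deg k b) * upoly k b)"
    by (simp add: a'_def f monom_altdef mult.assoc)
  have le: "degree (upoly k a') \<le> deg k a" unfolding u
  proof (rule degree_diff_le)
    show "degree (smult (lc k b) (upoly k a)) \<le> deg k a"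
      by (simp add: deg_def)
    have "degree (monom 1 (deg k a - deg k b) * upoly k b) \<le> (deg k a - deg k b) + deg k b"
      by (rule order_trans[OF degree_mult_le]) (simp add: deg_def degree_monom_eq)
    then show "degree (smult (lc k a) (monom 1 (deg k a - deg k b) * upoly k b)) \<le> deg k a"
      using assms(2) by (intro order_trans[OF degree_smult_le]) simp
  qed
  have c0: "coeff (upoly k a') (deg k a) = 0"
    unfolding u using assms(2) by (simp add: coeff_monom_mult lc_def deg_def)
  show ?thesis
  proof (cases "deg k a' < deg k a")
    case False
    then have "lead_coeff (upoly k a') = 0" using c0 le by (simp add: deg_def)
    then show ?thesis by simp
  qed simp
qed

lemma lead_decomp:
  assumes "a \<noteq> 0" shows "a - lc k a * Var k ^ deg k a = 0 \<or> deg k (a - lc k a * Var k ^ deg k a) < deg k a"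
  using cancel_lead[of 1 k a] by (simp add: lc_def deg_def)

text \<open>Division with remainder over the fraction field of the coefficients, with denominators
  cleared: \<open>c\<close> arises as a power of \<open>lc k b\<close> and is therefore free of
  \<open>Var k\<close>.\<close>

lemma pseudo_div:
  assumes "a \<in> polys J" "b \<in> polys J" "b \<noteq> 0" "k \<in> J"
  shows "\<exists>c q r. c \<in> polys (J - {k}) \<and> c \<noteq> 0 \<and> q \<in> polys J \<and> r \<in> polys J \<and>
    c * a = q * b + r \<and> (r = 0 \<or> deg k r < deg k b)"
  using assms(1)
proof (induction "deg k a" arbitrary: a rule: less_induct)
  case less
  show ?case
  proof (cases "a = 0 \<or> deg k a < deg k b")
    case True
    then show ?thesis using less.prems by (intro exI[of _ 1] exI[of _ 0] exI[of _ a]) auto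
  next
    case False
    define v where "v = lc k a * Var k ^ (deg k a - deg k b)"
    define a' where "a' = lc k b * a - v * b"
    have lcJ: "lc k a \<in> polys J" "lc k b \<in> polys J" "lc k b \<in> polys (J - {k})"
      using lc_polys[OF less.prems, of k] lc_polys[OF assms(2), of k] polys_mono[of "J - {k}" J] by auto
    have vJ: "v \<in> polys J" unfolding v_def using lcJ assms(4) by auto
    have a'J: "a' \<in> polys J" unfolding a'_def using vJ lcJ assms less.prems by auto
    have "a' = 0 \<or> deg k a' < deg k a"
      unfolding a'_def v_def by (rule cancel_lead) (use assms False in auto)
    then have "\<exists>c q r. c \<in> polys (J - {k}) \<and> c \<noteq> 0 \<and> q \<in> polys J \<and> r \<in> polys J \<and>
      c * a' = q * b + r \<and> (r = 0 \<or> deg k r < deg k b)"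
    proof
      assume "a' = 0"
      then show ?thesis by (intro exI[of _ 1] exI[of _ 0]) auto
    next
      assume "deg k a' < deg k a"
      then show ?thesis using less.hyps a'J by blast
    qed
    then obtain c q r where *: "c \<in> polys (J - {k})" "c \<noteq> 0" "q \<in> polys J" "r \<in> polys J"
      "c * a' = q * b + r" "r = 0 \<or> deg k r < deg k b" by blast
    have cJ: "c \<in> polys J" by (rule polys_mono[OF _ *(1)]) auto
    show ?thesis
    proof (intro exI conjI)
      show "c * lc k b \<in> polys (J - {k})" using * lcJ by auto
      show "c * lc k b \<noteq> 0" using * assms by simp
      show "q + c * v \<in> polys J" using * vJ cJ by auto
      show "r \<in> polys J" by fact
      show "c * lc k b * a = (q + c * v) * b + r"
        using *(5) unfolding a'_def by (simp add: algebra_simps)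
      show "r = 0 \<or> deg k r < deg k b" by fact
    qed
  qed
qed

lemma irreducible_deg:
  assumes "irreducible p" "p \<in> polys J" "finite J" obtains k where "k \<in> J" "deg k p > 0"
proof (rule ccontr)
  assume "\<not> thesis"
  then have "p \<in> polys (J - J)" using that assms by (intro free_deg_set) auto
  then show False using assms(1) punit_iff[of p] by (auto simp: irreducible_def)
qed

text \<open>Splitting off a non-unit lowers the sum of the partial degrees, because a nonzero
  non-unit involves some variable.\<close>

lemma irreducible_divisor_exists:
  fixes p :: mpoly
  assumes "p \<noteq> 0" "\<not> punit p"
  obtains \<pi> where "irreducible \<pi>" "\<pi> dvd p"
proof -
  obtain J where J: "finite J" "p \<in> polys J" by (rule polys_finite_support)
  have "\<exists>\<pi>. irreducible \<pi> \<and> \<pi> dvd p" using J(2) assms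
  proof (induction "\<Sum>k\<in>J. deg k p" arbitrary: p rule: less_induct)
    case less
    show ?case
    proof (cases "irreducible p")
      case False
      then obtain a b where ab: "p = a * b" "\<not> punit a" "\<not> punit b"
        using less.prems by (auto simp: irreducible_def)
      have nz: "a \<noteq> 0" "b \<noteq> 0" using ab less.prems by auto
      have "a \<in> polys J" "b \<in> polys J" 
        using dvd_polys[of a p J] dvd_polys[of b p J] ab less.prems by auto
      moreover have "(\<Sum>k\<in>J. deg k b) \<noteq> 0"
      proof
        assume "(\<Sum>k\<in>J. deg k b) = 0"
        then have "b \<in> polys (J - J)" using J(1) \<open>b \<in> polys J\<close> by (intro free_deg_set) auto
        then show False using nz ab(3) punit_iff by auto
      qed
      moreover have "(\<Sum>k\<in>J. deg k p) = (\<Sum>k\<in>J. deg k a) + (\<Sum>k\<in>J. deg k b)"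
        using nz by (simp add: ab deg_mult sum.distrib)
      ultimately obtain \<pi> where "irreducible \<pi>" "\<pi> dvd a" using less.hyps[of a] nz ab by auto
      then show ?thesis using ab by auto
    qed auto
  qed
  then show ?thesis using that by blast
qed

text \<open>Existence of a factorization into irreducibles, in the form of an induction
  rule.\<close>

lemma irreducible_induct [consumes 1, case_names unit mult]:
  fixes p :: mpoly
  assumes "p \<noteq> 0"
    and unit: "\<And>u. punit u \<Longrightarrow> P u"
    and mult: "\<And>\<pi> q. irreducible \<pi> \<Longrightarrow> q \<noteq> 0 \<Longrightarrow> P q \<Longrightarrow> P (\<pi> * q)"
  shows "P p"
proof -
  obtain J where J: "finite J" "p \<in> polys J" by (rule polys_finite_support)
  show ?thesis using J(2) assms(1)
  proof (induction "\<Sum>k\<in>J. deg k p" arbitrary: p rule: less_induct)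
    case less
    show ?case
    proof (cases "punit p")
      case True then show ?thesis by (rule unit)
    next
      case False
      then obtain \<pi> where pi: "irreducible \<pi>" "\<pi> dvd p"
        using irreducible_divisor_exists less.prems by metis
      then obtain q where q: "p = \<pi> * q" by (elim dvdE)
      have nz: "\<pi> \<noteq> 0" "q \<noteq> 0" using q less.prems by auto
      have pJ: "\<pi> \<in> polys J" "q \<in> polys J"
        using dvd_polys[of \<pi> p J] dvd_polys[of q p J] q less.prems by auto
      obtain k where "k \<in> J" "deg k \<pi> > 0" using irreducible_deg[OF pi(1) pJ(1) J(1)] .
      then have "(\<Sum>k\<in>J. deg k \<pi>) > 0" using J(1) by (intro sum_pos2[of _ k]) auto
      moreover have "(\<Sum>k\<in>J. deg k p) = (\<Sum>k\<in>J. deg k \<pi>) + (\<Sum>k\<in>J. deg k q)"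
        using nz by (simp add: q deg_mult sum.distrib)
      ultimately have "P q" using less.hyps[of q] pJ nz by auto
      then show ?thesis unfolding q using mult pi nz by blast
    qed
  qed
qed

text \<open>Stated relative to a set of variables, so that primality can be proved by adding one
  variable at a time.\<close>

definition irreducibles_prime :: "nat set \<Rightarrow> bool" where
  "irreducibles_prime J \<longleftrightarrow> (\<forall>\<pi> \<in> polys J. \<forall>a \<in> polys J. \<forall>b \<in> polys J.
     irreducible \<pi> \<longrightarrow> \<pi> dvd a * b \<longrightarrow> \<pi> dvd a \<or> \<pi> dvd b)"

lemma free_irreducible_prime:
  assumes "irreducibles_prime (J - {k})" "\<pi> \<in> polys (J - {k})" "irreducible \<pi>" "k \<in> J"
    and "a \<in> polys J" "b \<in> polys J" "\<pi> dvd a * b"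
  shows "\<pi> dvd a \<or> \<pi> dvd b"
  using assms(5-7)
proof (induction "deg k a + deg k b" arbitrary: a b rule: less_induct)
  case less
  have lcJ: "lc k p * Var k ^ deg k p \<in> polys J" if "p \<in> polys J" for p
  proof (rule polys_mult)
    show "lc k p \<in> polys J" by (rule polys_mono[OF _ lc_polys[OF that, of k]]) auto
  qed (use assms(4) in auto)
  have lcpi: "lc k \<pi> = \<pi>" using assms(2) by (simp add: lc_def upoly_free)
  consider "a = 0" | "b = 0" | "a \<noteq> 0" "b \<noteq> 0" by blast
  then show ?case
  proof cases
    case 3
    obtain w where "a * b = \<pi> * w" using less.prems by (elim dvdE)
    then have "lc k a * lc k b = \<pi> * lc k w" using lc_mult lcpi by metis
    then have "\<pi> dvd lc k a * lc k b" by simp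
    then consider "\<pi> dvd lc k a" | "\<pi> dvd lc k b"
      using assms(1-3) lc_polys[OF less.prems(1), of k] lc_polys[OF less.prems(2), of k]
      unfolding irreducibles_prime_def by blast
    then show ?thesis
    proof cases
      case 1
      define a' where "a' = a - lc k a * Var k ^ deg k a"
      have d: "\<pi> dvd lc k a * Var k ^ deg k a" using 1 by simp
      have a'J: "a' \<in> polys J" unfolding a'_def using lcJ less.prems by blast
      have "\<pi> dvd a' * b" unfolding a'_def left_diff_distrib
        using d less.prems(3) by (intro dvd_diff) auto
      moreover have "a' = 0 \<or> deg k a' < deg k a" unfolding a'_def by (rule lead_decomp) fact
      ultimately have "\<pi> dvd a' \<or> \<pi> dvd b" using less.hyps[of a' b] a'J less.prems by auto
      moreover have "\<pi> dvd a" if "\<pi> dvd a'" using dvd_add[OF that d] by (simp add: a'_def)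
      ultimately show ?thesis by blast
    next
      case 2
      define b' where "b' = b - lc k b * Var k ^ deg k b"
      have d: "\<pi> dvd lc k b * Var k ^ deg k b" using 2 by simp
      have b'J: "b' \<in> polys J" unfolding b'_def using lcJ less.prems by blast
      have "\<pi> dvd a * b'" unfolding b'_def right_diff_distrib
        using d less.prems(3) by (intro dvd_diff) auto
      moreover have "b' = 0 \<or> deg k b' < deg k b" unfolding b'_def by (rule lead_decomp) fact
      ultimately have "\<pi> dvd a \<or> \<pi> dvd b'" using less.hyps[of a b'] b'J less.prems by auto
      moreover have "\<pi> dvd b" if "\<pi> dvd b'" using dvd_add[OF that d] by (simp add: b'_def)
      ultimately show ?thesis by blast
    qed
  qed auto
qed

context
  fixes J :: "nat set" and k :: nat and \<pi> :: mpoly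
  assumes IP: "irreducibles_prime (J - {k})" and kJ: "k \<in> J"
    and piJ: "\<pi> \<in> polys J" and pi: "irreducible \<pi>" and dpi: "deg k \<pi> > 0"
begin

text \<open>The irreducible factors of \<open>u\<close> are free of \<open>Var k\<close> and
  \<open>\<pi>\<close> is not, so none of them divides \<open>\<pi>\<close>. Being prime, each
  divides the cofactor of \<open>\<pi>\<close> and cancels.\<close>

lemma dvd_free_mult_cancel:
  assumes "u \<noteq> 0" "u \<in> polys (J - {k})" "b \<in> polys J" "\<pi> dvd u * b"
  shows "\<pi> dvd b"
  using assms
proof (induction arbitrary: b rule: irreducible_induct)
  case (unit u)
  then obtain u' where "1 = u * u'" by (elim dvdE)
  then have "b = u' * (u * b)" by (metis mult.assoc mult.commute mult_1)
  then show ?case using unit.prems by (metis dvd_mult)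
next
  case (mult \<rho> q)
  have rq: "\<rho> \<in> polys (J - {k})" "q \<in> polys (J - {k})"
    using dvd_polys[OF _ mult.prems(1)] mult.hyps by (auto simp: irreducible_def)
  show ?case
  proof (cases "b = 0")
    case False
    obtain w where w: "\<rho> * q * b = \<pi> * w" using mult.prems by (elim dvdE)
    have q0: "\<rho> * q * b \<in> polys J" "\<rho> * q * b \<noteq> 0"
      using False mult.prems mult.hyps polys_mono[of "J - {k}" J "\<rho> * q"] by (auto simp: irreducible_def)
    then have "w \<in> polys J" using dvd_polys[of w "\<rho> * q * b" J] w by auto
    moreover have "\<rho> dvd \<pi> * w" using w by (metis dvd_triv_left mult.assoc)
    ultimately consider "\<rho> dvd \<pi>" | "\<rho> dvd w"
      using free_irreducible_prime[OF IP rq(1) mult.hyps(1) kJ piJ] by blast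
    then show ?thesis
    proof cases
      case 1
      then obtain v where v: "\<pi> = \<rho> * v" by (elim dvdE)
      then have "punit v" using pi mult.hyps(1) by (auto simp: irreducible_def)
      then have "v \<in> polys (J - {k})" using punit_iff polys_mono[of "{}" "J - {k}" v] by auto
      then have "deg k \<pi> = 0" unfolding v using rq by (intro deg_free[of _ J]) auto
      then show ?thesis using dpi by simp
    next
      case 2
      then obtain w' where "w = \<rho> * w'" by (elim dvdE)
      then have "\<rho> * (q * b) = \<rho> * (\<pi> * w')" using w by (simp add: mult_ac)
      then have "q * b = \<pi> * w'" using mult.hyps by (auto simp: irreducible_def)
      then show ?thesis using mult.IH[OF rq(2) mult.prems(2)] by simp
    qed
  qed simp
qed

text \<open>The irreducible factors of \<open>c\<close> are cancelled one by one against
  \<open>q\<close> or \<open>u\<close>. What remains is \<open>\<pi> = q * u\<close> up to a unit,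
  and \<open>u\<close> is no unit because it still involves \<open>Var k\<close>.\<close>

lemma irreducible_dvd_right:
  assumes "c \<noteq> 0" "c \<in> polys (J - {k})" "q \<in> polys J" "u \<in> polys J" "c * \<pi> = q * u" "deg k u > 0"
  shows "\<pi> dvd u"
  using assms
proof (induction arbitrary: q u rule: irreducible_induct)
  case (unit c)
  then obtain c' where c': "1 = c * c'" by (elim dvdE)
  have "\<pi> = c' * (c * \<pi>)" using c' by (metis mult.commute mult.left_commute mult_1)
  then have e: "\<pi> = (c' * q) * u" unfolding unit.prems by (simp add: mult_ac)
  have "\<not> punit u"
    using unit.prems(5) punit_iff[of u] deg_free[of u "{}" k] by auto
  then have "punit (c' * q)" using pi e by (auto simp: irreducible_def)
  then obtain v where "1 = (c' * q) * v" by (elim dvdE)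
  then have "u = v * \<pi>" unfolding e by (metis mult.assoc mult.commute mult_1)
  then show ?case by simp
next
  case (mult \<rho> c)
  have rq: "\<rho> \<in> polys (J - {k})" "c \<in> polys (J - {k})"
    using dvd_polys[OF _ mult.prems(1)] mult.hyps by (auto simp: irreducible_def)
  have r0: "\<rho> \<noteq> 0" using mult.hyps by (auto simp: irreducible_def)
  have p0: "\<pi> \<noteq> 0" using pi by (auto simp: irreducible_def)
  have qu0: "q \<noteq> 0" "u \<noteq> 0" using mult.prems(4) r0 p0 mult.hyps by auto
  have "\<rho> dvd q * u" using mult.prems(4) by (metis dvd_triv_left mult.assoc)
  then consider "\<rho> dvd q" | "\<rho> dvd u"
    using free_irreducible_prime[OF IP rq(1) mult.hyps(1) kJ mult.prems(2,3)] by blast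
  then show ?case
  proof cases
    case 1
    then obtain q' where q': "q = \<rho> * q'" by (elim dvdE)
    then have "\<rho> * (c * \<pi>) = \<rho> * (q' * u)" using mult.prems(4) by (simp add: mult_ac)
    then have "c * \<pi> = q' * u" using r0 by simp
    moreover have "q' \<in> polys J" using q' qu0 mult.prems(2) by (intro dvd_polys[of q' q]) auto
    ultimately show ?thesis using mult.IH[OF rq(2)] mult.prems by blast
  next
    case 2
    then obtain u' where u': "u = \<rho> * u'" by (elim dvdE)
    then have "\<rho> * (c * \<pi>) = \<rho> * (q * u')" using mult.prems(4) by (simp add: mult_ac)
    then have "c * \<pi> = q * u'" using r0 by simp
    moreover have "u' \<in> polys J" using u' qu0 mult.prems(3) by (intro dvd_polys[of u' u]) auto
    moreover have "deg k u' > 0"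
      using mult.prems(5) qu0 deg_free[OF rq(1)] by (simp add: u' deg_mult)
    ultimately have "\<pi> dvd u'" using mult.IH[OF rq(2)] mult.prems by blast
    then show ?thesis by (simp add: u')
  qed
qed

text \<open>In place of Gauss's lemma: an element of least degree in variable \<open>k\<close> of the ideal of all
  \<open>u\<close> with \<open>\<pi> dvd u * b\<close> divides every other element up to a factor free of that variable.\<close>

lemma irreducible_dvd_mult:
  assumes "a \<in> polys J" "b \<in> polys J" "\<pi> dvd a * b"
  shows "\<pi> dvd a \<or> \<pi> dvd b"
proof (rule ccontr)
  assume neg: "\<not> (\<pi> dvd a \<or> \<pi> dvd b)"
  have p0: "\<pi> \<noteq> 0" using pi by (auto simp: irreducible_def)
  define I where "I u \<longleftrightarrow> u \<in> polys J \<and> u \<noteq> 0 \<and> \<pi> dvd u * b" for u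
  have "I \<pi>" unfolding I_def using piJ p0 by simp
  then obtain u where u: "I u" and min: "\<And>v. I v \<Longrightarrow> deg k u \<le> deg k v"
    using exists_least_iff[of "\<lambda>d. \<exists>u. I u \<and> deg k u = d"] by (metis not_less)
  have uJ: "u \<in> polys J" "u \<noteq> 0" "\<pi> dvd u * b" using u unfolding I_def by auto
  have du: "deg k u > 0"
  proof (rule ccontr)
    assume "\<not> deg k u > 0"
    then have "u \<in> polys (J - {k})" using uJ by (intro free_deg) auto
    then show False using dvd_free_mult_cancel[of u b] uJ assms neg by auto
  qed
  obtain c q r where 1: "c \<in> polys (J - {k})" "c \<noteq> 0" "q \<in> polys J" "r \<in> polys J"
    "c * \<pi> = q * u + r" "r = 0 \<or> deg k r < deg k u"
    using pseudo_div[OF piJ uJ(1,2) kJ] by blast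
  have "r * b = \<pi> * (c * b) - q * (u * b)"
    using arg_cong[OF 1(5), of "\<lambda>x. x * b"] by (simp add: algebra_simps)
  then have "\<pi> dvd r * b" using uJ(3) by auto
  then have "r = 0" using 1 min[of r] unfolding I_def by fastforce
  then have "\<pi> dvd u" using irreducible_dvd_right[of c q u] 1 uJ du by simp
  \<comment> \<open>Thus \<open>\<pi>\<close> has least degree in the ideal as well, and the
    remainder of \<open>a\<close> on pseudo-division by \<open>\<pi>\<close>, which lies in the
    ideal, must vanish.\<close>
  then have le: "deg k \<pi> \<le> deg k u" using uJ(2) by (auto simp: deg_mult elim!: dvdE)
  obtain c q r where 1: "c \<in> polys (J - {k})" "c \<noteq> 0" "q \<in> polys J" "r \<in> polys J"
    "c * a = q * \<pi> + r" "r = 0 \<or> deg k r < deg k \<pi>"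
    using pseudo_div[OF assms(1) piJ p0 kJ] by blast
  have "r * b = c * (a * b) - \<pi> * (q * b)"
    using arg_cong[OF 1(5), of "\<lambda>x. x * b"] by (simp add: algebra_simps)
  then have "\<pi> dvd r * b" using assms(3) by auto
  then have "r = 0" using 1 min[of r] le unfolding I_def by fastforce
  then have "\<pi> dvd c * a" using 1 by simp
  then show False using dvd_free_mult_cancel[of c a] 1 assms neg by auto
qed

end

lemma irreducibles_prime_finite: "finite J \<Longrightarrow> irreducibles_prime J"
proof (induction rule: finite_induct)
  case empty
  show ?case by (auto simp: irreducibles_prime_def irreducible_def punit_iff)
next
  case (insert k J)
  then have IP: "irreducibles_prime (insert k J - {k})" by simp
  show ?case unfolding irreducibles_prime_def
  proof (intro ballI impI)
    fix \<pi> a b assume *: "\<pi> \<in> polys (insert k J)" "a \<in> polys (insert k J)" "b \<in> polys (insert k J)"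
      "irreducible \<pi>" "\<pi> dvd a * b"
    show "\<pi> dvd a \<or> \<pi> dvd b"
    proof (cases "deg k \<pi> = 0")
      case True
      then show ?thesis using free_irreducible_prime[OF IP free_deg[OF *(1)]] * by blast
    next
      case False
      then show ?thesis using irreducible_dvd_mult[OF IP] * by blast
    qed
  qed
qed

theorem irreducible_imp_prime_mpoly:
  fixes \<pi> :: mpoly assumes "irreducible \<pi>" shows "prime_elem \<pi>"
proof (rule prime_elemI)
  fix a b assume d: "\<pi> dvd a * b"
  obtain K1 K2 K3 where K: "finite K1" "\<pi> \<in> polys K1" "finite K2" "a \<in> polys K2"
    "finite K3" "b \<in> polys K3" by (metis polys_finite_support)
  define K where "K = K1 \<union> K2 \<union> K3"
  have "finite K" "\<pi> \<in> polys K" "a \<in> polys K" "b \<in> polys K"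
    unfolding K_def using K by (auto elim: polys_mono[rotated])
  then show "\<pi> dvd a \<or> \<pi> dvd b"
    using irreducibles_prime_finite assms d unfolding irreducibles_prime_def by blast
qed (use assms in \<open>auto simp: irreducible_def\<close>)


section \<open>Polynomials vanishing on an irreducible hypersurface\<close>

text \<open>Restriction to the line through \<open>x\<close> parallel to the \<open>k\<close>-th
  axis.\<close>

definition uval :: "(nat \<Rightarrow> complex) \<Rightarrow> nat \<Rightarrow> mpoly \<Rightarrow> complex poly" where
  "uval x k = mp_eval (\<lambda>a. [:a:]) (\<lambda>l. if l = k then [:0, 1:] else [:x l:])"

interpretation uval: coeff_hom "\<lambda>a. [:a:] :: complex poly"
  by unfold_locales (simp_all add: one_pCons)

lemma poly_uval: "poly (uval x k p) t = value_at (x(k := t)) p"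
  unfolding uval_def using polys_UNIV[of p] by (induction rule: polys_induct) auto

lemma coeff_uval: "coeff (uval x k p) i = value_at x (coeff (upoly k p) i)"
  unfolding uval_def using polys_UNIV[of p]
  by (induction arbitrary: i rule: polys_induct)
     (auto simp: coeff_pCons coeff_mult split: nat.splits)

text \<open>By induction the leading coefficient in one variable is nonzero at some point; on the
  line through it the polynomial is a nonzero univariate one.\<close>

lemma nonvanishing_point:
  assumes "p \<noteq> 0" shows "\<exists>x. value_at x p \<noteq> 0"
proof -
  obtain J where J: "finite J" "p \<in> polys J" by (rule polys_finite_support)
  show ?thesis using J assms
  proof (induction J arbitrary: p rule: finite_induct)
    case empty
    then obtain a where "p = Const a" by (auto elim: polys_empty)
    then show ?case using empty by auto
  next
    case (insert k J)
    have "lc k p \<in> polys J" using lc_polys[OF insert.prems(1), of k] insert.hyps by simp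
    then obtain x where "value_at x (lc k p) \<noteq> 0" using insert.IH insert.prems by force
    then have "uval x k p \<noteq> 0" by (metis coeff_uval coeff_0 lc_def)
    then obtain t where "poly (uval x k p) t \<noteq> 0" using poly_all_0_iff_0 by blast
    then show ?case by (auto simp: poly_uval)
  qed
qed

text \<open>Let \<open>u\<close> have least degree in \<open>k\<close> in the ideal generated by
  \<open>\<pi>\<close> and \<open>Q\<close>. If \<open>u\<close> involves \<open>Var k\<close>, it
  is a common factor up to elements free of \<open>Var k\<close>, against primality. Otherwise, over
  a point where neither \<open>u\<close> nor \<open>lc k \<pi>\<close> vanishes lies a zero of
  \<open>\<pi>\<close>, at which \<open>Q\<close> and hence \<open>u\<close> would vanish.\<close>

theorem irreducible_nullstellensatz:
  assumes irr: "irreducible \<pi>" and van: "\<And>x. value_at x \<pi> = 0 \<Longrightarrow> value_at x Q = 0"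
  shows "\<pi> dvd Q"
proof (rule ccontr)
  assume neg: "\<not> \<pi> dvd Q"
  have prime: "prime_elem \<pi>" by (rule irreducible_imp_prime_mpoly[OF irr])
  have p0: "\<pi> \<noteq> 0" using irr by (auto simp: irreducible_def)
  obtain J where J: "finite J" "\<pi> \<in> polys J" by (rule polys_finite_support)
  obtain k where k: "deg k \<pi> > 0" by (rule irreducible_deg[OF irr J(2,1)])
  define I where "I u \<longleftrightarrow> u \<noteq> 0 \<and> (\<exists>\<alpha> \<beta>. u = \<alpha> * \<pi> + \<beta> * Q)" for u
  have "\<pi> = 1 * \<pi> + 0 * Q" by simp
  then have "I \<pi>" unfolding I_def using p0 by blast
  then obtain u where u: "I u" and min: "\<And>v. I v \<Longrightarrow> deg k u \<le> deg k v"
    using exists_least_iff[of "\<lambda>d. \<exists>u. I u \<and> deg k u = d"] by (metis not_less)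
  obtain \<alpha> \<beta> where ab: "u = \<alpha> * \<pi> + \<beta> * Q" and u0: "u \<noteq> 0" using u unfolding I_def by blast
  \<comment> \<open>The remainder lies in the ideal and has smaller degree than \<open>u\<close>, so
    it is 0.\<close>
  have div: "\<exists>c q. c \<in> polys (UNIV - {k}) \<and> c \<noteq> 0 \<and> c * v = q * u" if v: "v = \<gamma> * \<pi> + \<delta> * Q" for v \<gamma> \<delta>
  proof -
    obtain c q r where 1: "c \<in> polys (UNIV - {k})" "c \<noteq> 0"
      "c * v = q * u + r" "r = 0 \<or> deg k r < deg k u"
      using pseudo_div[of v UNIV u k] u0 by auto
    have "r = (c * \<gamma> - q * \<alpha>) * \<pi> + (c * \<delta> - q * \<beta>) * Q"
      using 1(3) unfolding ab v by (simp add: algebra_simps)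
    then have "r \<noteq> 0 \<Longrightarrow> I r" unfolding I_def by blast
    then have "r = 0" using 1 min[of r] by fastforce
    then show ?thesis using 1 by auto
  qed
  obtain c q where c: "c \<in> polys (UNIV - {k})" "c \<noteq> 0" "c * \<pi> = q * u"
    using div[of \<pi> 1 0] by auto
  obtain c' q' where c': "c' \<in> polys (UNIV - {k})" "c' \<noteq> 0" "c' * Q = q' * u"
    using div[of Q 0 1] by auto
  show False
  proof (cases "deg k u = 0")
    case True
    then have uf: "u \<in> polys (UNIV - {k})" by (intro free_deg) auto
    obtain x where x: "value_at x (u * lc k \<pi>) \<noteq> 0"
      using nonvanishing_point[of "u * lc k \<pi>"] u0 p0 by auto
    \<comment> \<open>The leading coefficient survives at \<open>x\<close>, so \<open>\<pi>\<close>
      keeps its positive degree on the line and has a root there.\<close>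
    have "coeff (uval x k \<pi>) (deg k \<pi>) \<noteq> 0" using x by (simp add: coeff_uval lc_def deg_def)
    then have "degree (uval x k \<pi>) > 0" using k le_degree[of "uval x k \<pi>"] by fastforce
    then obtain t where "poly (uval x k \<pi>) t = 0"
      using fundamental_theorem_of_algebra constant_degree by (metis less_numeral_extra(3))
    then have y: "value_at (x(k := t)) \<pi> = 0" by (simp add: poly_uval)
    then have "value_at (x(k := t)) u = 0" using van unfolding ab by simp
    moreover have "value_at (x(k := t)) u = value_at x u" by (rule value_at_cong[OF uf]) auto
    ultimately show False using x by simp
  next
    case False
    have "\<pi> dvd q * u" using c(3) by (metis dvd_triv_right)
    then consider "\<pi> dvd u" | "\<pi> dvd q" using prime prime_elem_dvd_multD by blast
    then show False
    proof cases
      case 1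
      then have "\<pi> dvd c' * Q" using c' by simp
      then have "\<pi> dvd c'" using prime prime_elem_dvd_multD neg by blast
      then obtain w where "c' = \<pi> * w" by (elim dvdE)
      then show False using k c'(2) deg_free[OF c'(1)] by (auto simp: deg_mult)
    next
      case 2
      then obtain w where "q = \<pi> * w" by (elim dvdE)
      then have "\<pi> * c = \<pi> * (w * u)" using c(3) by (simp add: mult_ac)
      then have "c = w * u" using p0 by simp
      then show False using False c(2) deg_free[OF c(1)] u0 by (auto simp: deg_mult)
    qed
  qed
qed

section \<open>Partial degrees and exponents\<close>

lemma upoly_single:
  "upoly k (Poly_Mapping.single e a) =
     monom (Poly_Mapping.single (Poly_Mapping.update k 0 e) a) (Poly_Mapping.lookup e k)"
proof -
  have e: "e = Poly_Mapping.update k 0 e + Poly_Mapping.single k (Poly_Mapping.lookup e k)"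
    by (rule poly_mapping_eqI) (simp add: lookup_add lookup_update lookup_single)
  have "Poly_Mapping.single (Poly_Mapping.update k 0 e) a \<in> polys (UNIV - {k})"
    by (auto simp: polys_def keys_update)
  note f = upoly_free[OF this]
  have "Poly_Mapping.single e a = Poly_Mapping.single (Poly_Mapping.update k 0 e) a
      * Var k ^ Poly_Mapping.lookup e k"
    by (subst e) (simp add: Var_power mult_single)
  then show ?thesis by (simp add: f) (simp add: monom_altdef)
qed

lemma upoly_keys: "upoly k p = (\<Sum>e \<in> Poly_Mapping.keys p.
    monom (Poly_Mapping.single (Poly_Mapping.update k 0 e) (Poly_Mapping.lookup p e)) (Poly_Mapping.lookup e k))"
  by (subst mpoly_sum_singles[of p]) (simp add: upoly_single)

lemma lookup_le_deg:
  assumes "e \<in> Poly_Mapping.keys p" shows "Poly_Mapping.lookup e k \<le> deg k p"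
proof -
  have "e \<in> Poly_Mapping.keys (\<Sum>i\<le>deg k p. coeff (upoly k p) i * Var k ^ i)"
    using assms mpoly_decomp[of p k] by (simp add: deg_def)
  then obtain i where i: "i \<le> deg k p" "e \<in> Poly_Mapping.keys (coeff (upoly k p) i * Var k ^ i)"
    using Poly_Mapping.keys_sum[of "\<lambda>i. coeff (upoly k p) i * Var k ^ i" "{..deg k p}"] by blast
  obtain e' where e': "e = e' + Poly_Mapping.single k i" "e' \<in> Poly_Mapping.keys (coeff (upoly k p) i)"
    using keys_mult[of "coeff (upoly k p) i" "Var k ^ i"] i(2) by (auto simp: Var_power split: if_splits)
  have "coeff (upoly k p) i \<in> polys (UNIV - {k})" by (rule coeff_upoly_polys) simp
  then have "k \<notin> Poly_Mapping.keys e'" using e'(2) by (auto simp: polys_def)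
  then have "Poly_Mapping.lookup e' k = 0" by (simp add: in_keys_iff)
  then show ?thesis using i e' by (simp add: lookup_add)
qed

lemma deg_leI:
  assumes "\<And>e. e \<in> Poly_Mapping.keys p \<Longrightarrow> Poly_Mapping.lookup e k \<le> b" shows "deg k p \<le> b"
  unfolding deg_def upoly_keys
  by (rule degree_sum_le) (auto intro: order_trans[OF degree_monom_le] assms)

lemma deg_coeff_le: "deg j (coeff (upoly k p) i) \<le> deg j p"
proof (rule deg_leI)
  fix e assume "e \<in> Poly_Mapping.keys (coeff (upoly k p) i)"
  moreover have "coeff (upoly k p) i = (\<Sum>e \<in> Poly_Mapping.keys p. if Poly_Mapping.lookup e k = i
      then Poly_Mapping.single (Poly_Mapping.update k 0 e) (Poly_Mapping.lookup p e) else 0)"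
    by (simp add: upoly_keys coeff_sum)
  ultimately obtain e' where e': "e' \<in> Poly_Mapping.keys p" "e \<in> Poly_Mapping.keys (if Poly_Mapping.lookup e' k = i
      then Poly_Mapping.single (Poly_Mapping.update k 0 e') (Poly_Mapping.lookup p e') else 0)"
    using Poly_Mapping.keys_sum[of "\<lambda>e. if Poly_Mapping.lookup e k = i
      then Poly_Mapping.single (Poly_Mapping.update k 0 e) (Poly_Mapping.lookup p e) else 0" "Poly_Mapping.keys p"]
    by fastforce
  then have "e = Poly_Mapping.update k 0 e'" by (auto split: if_splits)
  then have "Poly_Mapping.lookup e j \<le> Poly_Mapping.lookup e' j" by (simp add: lookup_update)
  then show "Poly_Mapping.lookup e j \<le> deg j p" using lookup_le_deg[OF e'(1), of j] by simp
qed

lemma deg_lc_le: "deg j (lc k p) \<le> deg j p"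
  unfolding lc_def by (rule deg_coeff_le)

lemma deg_power_le: "deg j (p ^ i) \<le> i * deg j p"
proof (induction i)
  case (Suc i)
  then show ?case using deg_mult_le[of j p "p ^ i"] by simp
qed (simp add: deg_def)

lemma deg_prod_le: "deg j (\<Prod>i\<in>I. f i) \<le> (\<Sum>i\<in>I. deg j (f i))"
proof (induction I rule: infinite_finite_induct)
  case (insert x F)
  then show ?case using deg_mult_le[of j "f x" "prod f F"] by simp
qed (auto simp: deg_def)

text \<open>The exponent vector of the monomial
  \<open>\<Prod>j\<in>J. Var j ^ \<alpha> j\<close>.\<close>

definition expo :: "nat set \<Rightarrow> (nat \<Rightarrow> nat) \<Rightarrow> (nat \<Rightarrow>\<^sub>0 nat)" where
  "expo J \<alpha> = (\<Sum>j\<in>J. Poly_Mapping.single j (\<alpha> j))"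

lemma lookup_expo:
  assumes "finite J" shows "Poly_Mapping.lookup (expo J \<alpha>) k = (if k \<in> J then \<alpha> k else 0)"
proof -
  have "Poly_Mapping.lookup (expo J \<alpha>) k = (\<Sum>j\<in>J. if j = k then \<alpha> k else 0)"
    unfolding expo_def lookup_sum by (rule sum.cong) (auto simp: lookup_single)
  then show ?thesis using assms by simp
qed

lemma prod_Var_power: "finite J \<Longrightarrow> (\<Prod>j\<in>J. Var j ^ \<alpha> j) = Poly_Mapping.single (expo J \<alpha>) 1"
proof (induction J rule: finite_induct)
  case (insert k J)
  show ?case using insert by (simp add: expo_def Var_power mult_single)
qed (simp add: expo_def)

lemma expo_inj:
  assumes "finite J" shows "inj_on (expo J) (PiE J F)"
proof (rule inj_onI, rule PiE_ext)
  fix \<alpha> \<beta> j assume "expo J \<alpha> = expo J \<beta>" "j \<in> J"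
  then show "\<alpha> j = \<beta> j" using lookup_expo[OF assms, of \<alpha> j] lookup_expo[OF assms, of \<beta> j] by simp
qed

text \<open>Turns degree bounds into a count of dimension: the monomials come from a box with
  \<open>b j\<close> choices in direction \<open>j\<close>.\<close>

lemma keys_subset_expo:
  assumes "p \<in> polys J" "finite J" "\<And>j. j \<in> J \<Longrightarrow> deg j p < b j"
  shows "Poly_Mapping.keys p \<subseteq> expo J ` PiE J (\<lambda>j. {..<b j})"
proof
  fix e assume e: "e \<in> Poly_Mapping.keys p"
  define \<alpha> where "\<alpha> = restrict (Poly_Mapping.lookup e) J"
  have "l \<notin> Poly_Mapping.keys e" if "l \<notin> J" for l
    using assms(1) e that by (auto simp: polys_def)
  then have "Poly_Mapping.lookup e l = 0" if "l \<notin> J" for l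
    using that by (simp add: in_keys_iff)
  then have "e = expo J \<alpha>"
    by (intro poly_mapping_eqI) (auto simp: lookup_expo[OF assms(2)] \<alpha>_def)
  moreover have "\<alpha> \<in> PiE J (\<lambda>j. {..<b j})"
    using lookup_le_deg[OF e] assms(3) by (auto simp: \<alpha>_def intro: le_less_trans)
  ultimately show "e \<in> expo J ` PiE J (\<lambda>j. {..<b j})" by blast
qed

lemma lookup_Const_mult: "Poly_Mapping.lookup (Const a * p) e = a * Poly_Mapping.lookup p e"
  unfolding Const_def mult_map_scale_conv_mult[symmetric] by (simp add: Poly_Mapping.map.rep_eq when_def)

text \<open>Gaussian elimination, one exponent at a time: \<open>x0\<close> is the pivot that clears
  the coordinate \<open>e\<close> from the other vectors.\<close>

lemma linear_relation:
  assumes "finite E" "finite X" "card E < card X" "\<And>x. x \<in> X \<Longrightarrow> Poly_Mapping.keys (w x :: mpoly) \<subseteq> E"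
  shows "\<exists>c. (\<exists>x\<in>X. c x \<noteq> 0) \<and> (\<Sum>x\<in>X. Const (c x) * w x) = 0"
  using assms
proof (induction E arbitrary: X w rule: finite_induct)
  case empty
  then have "w x = 0" if "x \<in> X" for x using that by (metis Poly_Mapping.keys_eq_empty subset_empty)
  moreover obtain x where "x \<in> X" using empty by fastforce
  ultimately show ?case by (intro exI[of _ "\<lambda>_. 1"]) auto
next
  case (insert e E)
  show ?case
  proof (cases "\<exists>x0\<in>X. Poly_Mapping.lookup (w x0) e \<noteq> 0")
    case False
    then have "Poly_Mapping.keys (w x) \<subseteq> E" if "x \<in> X" for x
      using insert.prems(3)[OF that] that by (auto simp: in_keys_iff)
    then show ?thesis using insert by (intro insert.IH) auto
  next
    case True
    then obtain x0 where x0: "x0 \<in> X" "Poly_Mapping.lookup (w x0) e \<noteq> 0" by blast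
    define t where "t x = Poly_Mapping.lookup (w x) e / Poly_Mapping.lookup (w x0) e" for x
    define w' where "w' x = w x - Const (t x) * w x0" for x
    have look: "Poly_Mapping.lookup (w' x) l = Poly_Mapping.lookup (w x) l - t x * Poly_Mapping.lookup (w x0) l" for x l
        unfolding w'_def by (simp add: lookup_minus lookup_Const_mult)
    have "Poly_Mapping.keys (w' x) \<subseteq> E" if "x \<in> X - {x0}" for x
    proof
      fix l assume l: "l \<in> Poly_Mapping.keys (w' x)"
      have "Poly_Mapping.lookup (w' x) e = 0" using x0 by (simp add: look t_def)
      then have "l \<noteq> e" using l by (auto simp: in_keys_iff)
      moreover have "l \<in> Poly_Mapping.keys (w x) \<or> l \<in> Poly_Mapping.keys (w x0)"
        using l by (auto simp: in_keys_iff look)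
      ultimately show "l \<in> E" using insert.prems(3) x0 that by blast
    qed
    moreover have "card E < card (X - {x0})" using insert x0 by simp
    ultimately obtain c where c: "\<exists>x\<in>X - {x0}. c x \<noteq> 0" "(\<Sum>x\<in>X - {x0}. Const (c x) * w' x) = 0"
      using insert.IH[of "X - {x0}" w'] insert.prems by auto
    \<comment> \<open>The coefficient at the pivot compensates for the multiples of
      \<open>w x0\<close> subtracted in \<open>w'\<close>.\<close>
    define c' where "c' = c(x0 := - (\<Sum>x\<in>X - {x0}. c x * t x))"
    have Csum: "Const (\<Sum>x\<in>Y. f x) = (\<Sum>x\<in>Y. Const (f x))" for Y and f :: "'a \<Rightarrow> complex"
      by (induction Y rule: infinite_finite_induct) (auto simp: Const_add)
    have Cneg: "Const (- a) = - Const a" for a by (simp add: Const_def single_uminus)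
    have "(\<Sum>x\<in>X. Const (c' x) * w x) = Const (c' x0) * w x0 + (\<Sum>x\<in>X - {x0}. Const (c' x) * w x)"
      using insert.prems(1) x0(1) by (rule sum.remove)
    also have "(\<Sum>x\<in>X - {x0}. Const (c' x) * w x) = (\<Sum>x\<in>X - {x0}. Const (c x) * w' x + Const (c x * t x) * w x0)"
      by (rule sum.cong) (auto simp: c'_def w'_def algebra_simps Const_mult)
    also have "\<dots> = Const (\<Sum>x\<in>X - {x0}. c x * t x) * w x0"
      by (simp add: sum.distrib c(2) Csum sum_distrib_right)
    also have "Const (c' x0) * w x0 + \<dots> = 0"
      by (simp add: c'_def Cneg)
    finally have "(\<Sum>x\<in>X. Const (c' x) * w x) = 0" .
    moreover have "\<exists>x\<in>X. c' x \<noteq> 0" using c(1) by (auto simp: c'_def)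
    ultimately show ?thesis by blast
  qed
qed

text \<open>Each step lowers the degree in \<open>j0\<close> as far as required and adds at most
  \<open>E\<close> to the other degrees. The multiplier depends on \<open>i\<close> only, so many
  \<open>W\<close> can be reduced with one common factor.\<close>

lemma bounded_pseudo_reduction:
  assumes "P \<in> polys J" "j0 \<in> J" "deg j0 P > 0" "\<And>j. j \<in> J \<Longrightarrow> deg j P \<le> E"
    and "W \<in> polys J" "deg j0 W < deg j0 P + i" "\<And>j. j \<in> J \<Longrightarrow> deg j W \<le> M"
  shows "\<exists>W'\<in>polys J. P dvd lc j0 P ^ i * W - W' \<and> deg j0 W' < deg j0 P \<and> (\<forall>j\<in>J. deg j W' \<le> M + i * E)"
  using assms(5-7)
proof (induction i arbitrary: W M)
  case 0
  then show ?case by (intro bexI[of _ W]) auto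
next
  case (Suc i)
  \<comment> \<open>If the degree is already small nothing is subtracted, but \<open>W\<close> is
    still multiplied by \<open>lc j0 P\<close> to keep the exponent uniform.\<close>
  define v where "v = (if deg j0 W < deg j0 P then 0 else lc j0 W * Var j0 ^ (deg j0 W - deg j0 P))"
  define W1 where "W1 = lc j0 P * W - v * P"
  have P0: "P \<noteq> 0" using assms(3) by (auto simp: deg_def)
  have lcJ: "lc j0 P \<in> polys J" "lc j0 W \<in> polys J"
    using lc_polys[OF assms(1), of j0] lc_polys[OF Suc.prems(1), of j0] polys_mono[of "J - {j0}" J] by auto
  have vJ: "v \<in> polys J" unfolding v_def using lcJ assms(2) by auto
  have WJ: "W1 \<in> polys J" unfolding W1_def using vJ lcJ assms(1) Suc.prems by auto
  have lcfree: "deg j0 (lc j0 P) = 0" by (rule deg_free[OF lc_polys[OF assms(1)]])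
  have d1: "deg j0 W1 < deg j0 P + i \<and> deg j0 W1 \<le> deg j0 W"
  proof (cases "deg j0 W < deg j0 P")
    case True
    then have "W1 = lc j0 P * W" by (simp add: W1_def v_def)
    then show ?thesis using deg_mult_le[of j0 "lc j0 P" W] lcfree True by simp
  next
    case False
    then have "W1 = lc j0 P * W - lc j0 W * Var j0 ^ (deg j0 W - deg j0 P) * P" by (simp add: W1_def v_def)
    then have "W1 = 0 \<or> deg j0 W1 < deg j0 W" using cancel_lead[of P j0 W] P0 False by simp
    then show ?thesis using False Suc.prems(2) assms(3) by (auto simp: deg_def)
  qed
  have d2: "deg j W1 \<le> M + E" if "j \<in> J" for j
  proof (cases "j = j0")
    case True
    then show ?thesis using d1 Suc.prems(3)[OF that] by simp
  next
    case False
    have "deg j (lc j0 P * W) \<le> E + M"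
      using deg_mult_le[of j "lc j0 P" W] deg_lc_le[of j j0 P] assms(4)[OF that] Suc.prems(3)[OF that] by simp
    moreover have "deg j (v * P) \<le> M + E"
    proof -
      have "deg j v \<le> M"
        unfolding v_def
        using deg_mult_le[of j "lc j0 W" "Var j0 ^ (deg j0 W - deg j0 P)"]
          deg_power_le[of j "Var j0" "deg j0 W - deg j0 P"] False
          deg_lc_le[of j j0 W] Suc.prems(3)[OF that] by (auto simp: deg_def[of _ 0])
      then show ?thesis using deg_mult_le[of j v P] assms(4)[OF that] by simp
    qed
    ultimately show ?thesis unfolding W1_def using deg_diff_le[of j "lc j0 P * W" "v * P"] by simp
  qed
  obtain W' where W': "W' \<in> polys J" "P dvd lc j0 P ^ i * W1 - W'" "deg j0 W' < deg j0 P"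
    "\<And>j. j \<in> J \<Longrightarrow> deg j W' \<le> M + E + i * E"
    using Suc.IH[OF WJ _ d2] d1 by blast
  have "lc j0 P ^ Suc i * W - W' = (lc j0 P ^ i * W1 - W') + lc j0 P ^ i * v * P"
    unfolding W1_def by (simp add: algebra_simps)
  then have "P dvd lc j0 P ^ Suc i * W - W'" using W'(2) by (metis dvd_add dvd_triv_right)
  then show ?case using W' by (intro bexI[of _ W']) (auto simp: algebra_simps)
qed

section \<open>Congruence modulo a polynomial\<close>

definition eqmod :: "mpoly \<Rightarrow> mpoly \<Rightarrow> mpoly \<Rightarrow> bool" where
  "eqmod h p q \<longleftrightarrow> h dvd p - q"

lemma eqmod_refl [simp]: "eqmod h p p"
  by (simp add: eqmod_def)

lemma eqmod_sym: "eqmod h p q \<Longrightarrow> eqmod h q p"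
  unfolding eqmod_def by (metis dvd_minus_iff minus_diff_eq)

lemma eqmod_trans [trans]: "eqmod h p q \<Longrightarrow> eqmod h q r \<Longrightarrow> eqmod h p r"
  unfolding eqmod_def using dvd_add[of h "p - q" "q - r"] by simp

lemma eqmod_add: "eqmod h p q \<Longrightarrow> eqmod h p' q' \<Longrightarrow> eqmod h (p + p') (q + q')"
  unfolding eqmod_def using dvd_add[of h "p - q" "p' - q'"] by (simp add: algebra_simps)

lemma eqmod_mult: "eqmod h p q \<Longrightarrow> eqmod h p' q' \<Longrightarrow> eqmod h (p * p') (q * q')"
proof -
  assume "eqmod h p q" "eqmod h p' q'"
  moreover have "p * p' - q * q' = (p - q) * p' + q * (p' - q')" by (simp add: algebra_simps)
  ultimately show ?thesis unfolding eqmod_def by (metis dvd_add dvd_mult dvd_mult2)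
qed

lemma eqmod_power: "eqmod h p q \<Longrightarrow> eqmod h (p ^ i) (q ^ i)"
  by (induction i) (auto intro: eqmod_mult)

lemma eqmod_prod: "(\<And>i. i \<in> I \<Longrightarrow> eqmod h (f i) (g i)) \<Longrightarrow> eqmod h (\<Prod>i\<in>I. f i) (\<Prod>i\<in>I. g i)"
  by (induction I rule: infinite_finite_induct) (auto intro: eqmod_mult)

lemma eqmod_sum: "(\<And>i. i \<in> I \<Longrightarrow> eqmod h (f i) (g i)) \<Longrightarrow> eqmod h (\<Sum>i\<in>I. f i) (\<Sum>i\<in>I. g i)"
  by (induction I rule: infinite_finite_induct) (auto intro: eqmod_add)

lemma eqmod_0: "eqmod h p 0 \<longleftrightarrow> h dvd p"
  by (simp add: eqmod_def)

lemma eqmod_dvd: "eqmod h p q \<Longrightarrow> h dvd p \<longleftrightarrow> h dvd q"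
  using eqmod_0 eqmod_sym eqmod_trans by blast


section \<open>Independence on a divisor\<close>

text \<open>For irreducible \<open>h\<close>: algebraic independence of the restrictions of the
  \<open>\<phi> j\<close> to the hypersurface \<open>h = 0\<close>.\<close>

definition indep_mod :: "mpoly \<Rightarrow> nat set \<Rightarrow> (nat \<Rightarrow> mpoly) \<Rightarrow> bool" where
  "indep_mod h J \<phi> \<longleftrightarrow> (\<forall>P \<in> polys J. h dvd psub \<phi> P \<longrightarrow> P = 0)"

lemma prime_not_dvd_prod:
  fixes h :: mpoly
  assumes "prime_elem h" "\<And>i. i \<in> I \<Longrightarrow> \<not> h dvd f i" shows "\<not> h dvd (\<Prod>i\<in>I. f i)"
  using assms(2)
proof (induction I rule: infinite_finite_induct)
  case (insert x F)
  then show ?case using assms(1) prime_elem_dvd_multD by fastforce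
qed (use assms(1) in \<open>auto simp: prime_elem_def\<close>)

lemma prime_not_dvd_power:
  fixes h :: mpoly
  assumes "prime_elem h" "\<not> h dvd p" shows "\<not> h dvd p ^ i"
  using assms prime_elem_dvd_power by blast

text \<open>A count of dimensions: if the \<open>\<phi> j\<close> were dependent modulo \<open>h\<close>, the monomials of
  partial degrees at most \<open>N\<close> in all variables but one would, modulo \<open>h\<close> and up to a common factor,
  lie in a space whose dimension grows with a smaller power of \<open>N\<close>.\<close>

theorem indep_mod_if_generates:
  assumes irr: "irreducible h" and hT: "h \<in> polys T" and T: "finite T" and J: "finite J"
    and card: "card T = Suc (card J)"
    and gen: "\<And>m. m \<in> T \<Longrightarrow> \<exists>A\<in>polys J. \<exists>B\<in>polys J. \<not> h dvd psub \<phi> B \<and>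
      eqmod h (Var m * psub \<phi> B) (psub \<phi> A)"
  shows "indep_mod h J \<phi>"
proof (rule ccontr)
  assume neg: "\<not> indep_mod h J \<phi>"
  have prime: "prime_elem h" by (rule irreducible_imp_prime_mpoly[OF irr])
  have h1: "\<not> h dvd 1" using irr by (auto simp: irreducible_def)
  define bad where "bad K P \<longleftrightarrow> K \<subseteq> J \<and> P \<in> polys K \<and> P \<noteq> 0 \<and> h dvd psub \<phi> P" for K P
  have "\<exists>P. bad J P" using neg unfolding indep_mod_def bad_def by blast
  \<comment> \<open>A dependent subfamily of least size: a nonzero polynomial in fewer of its
    variables, such as the leading coefficient of \<open>P\<close>, does not become divisible by
    \<open>h\<close>.\<close>
  then obtain K where "\<exists>P. bad K P" and min: "\<And>K' P. bad K' P \<Longrightarrow> card K \<le> card K'"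
    using exists_least_iff[of "\<lambda>d. \<exists>K P. bad K P \<and> card K = d"] by (metis not_less)
  then obtain P where bad: "bad K P" by blast
  have KJ: "K \<subseteq> J" and PK: "P \<in> polys K" and P0: "P \<noteq> 0" and hP: "h dvd psub \<phi> P"
    using bad unfolding bad_def by auto
  have finK: "finite K" using KJ J finite_subset by blast
  have smaller: "\<not> bad (K - {j}) Q" if "j \<in> K" for j Q
    using min[of "K - {j}" Q] card_Diff1_less[OF finK that] by fastforce
  have "K \<noteq> {}"
  proof
    assume "K = {}"
    then obtain a where "P = Const a" using PK polys_empty by blast
    then show False using hP h1 P0 Const_unit[of a] by (auto intro: dvd_trans)
  qed
  then obtain j0 where j0: "j0 \<in> K" by blast
  have d: "deg j0 P > 0" using smaller[OF j0, of P] free_deg[OF PK, of j0] KJ P0 hP unfolding bad_def by fastforce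
  define a where "a = lc j0 P"
  have ha: "\<not> h dvd psub \<phi> a"
    using smaller[OF j0, of a] lc_polys[OF PK, of j0] KJ P0 unfolding bad_def a_def by auto
  have PJ: "P \<in> polys J" by (rule polys_mono[OF KJ PK])
  have j0J: "j0 \<in> J" using j0 KJ by blast
  \<comment> \<open>A nonzero multiple of \<open>h\<close> involves \<open>Var k\<close>, so the
    monomials in the remaining \<open>r\<close> coordinates are linearly independent modulo
    \<open>h\<close>.\<close>
  obtain k where k: "k \<in> T" "deg k h > 0" by (rule irreducible_deg[OF irr hT T])
  define T' where "T' = T - {k}"
  define r where "r = card J"
  have cT': "card T' = r" "finite T'" using T k card by (auto simp: T'_def r_def)
  have r0: "r > 0" using j0J J by (auto simp: r_def card_gt_0_iff)
  obtain A B where AB: "\<And>m. m \<in> T \<Longrightarrow> A m \<in> polys J \<and> B m \<in> polys J \<and> \<not> h dvd psub \<phi> (B m) \<and>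
      eqmod h (Var m * psub \<phi> (B m)) (psub \<phi> (A m))" using gen by metis
  define E where "E = (\<Sum>j\<in>J. deg j P + (\<Sum>m\<in>T. deg j (A m) + deg j (B m)))"
  have EP: "deg j P \<le> E" if "j \<in> J" for j
  proof -
    have "deg j P + (\<Sum>m\<in>T. deg j (A m) + deg j (B m)) \<le> E"
      unfolding E_def using J that by (intro member_le_sum) auto
    then show ?thesis by simp
  qed
  have EAB: "deg j (A m) \<le> E" "deg j (B m) \<le> E" if "j \<in> J" "m \<in> T" for j m
  proof -
    have "deg j P + (\<Sum>m\<in>T. deg j (A m) + deg j (B m)) \<le> E"
      unfolding E_def using J that by (intro member_le_sum) auto
    moreover have "deg j (A m) + deg j (B m) \<le> (\<Sum>m\<in>T. deg j (A m) + deg j (B m))"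
      using T that(2) by (intro member_le_sum) auto
    ultimately show "deg j (A m) \<le> E" "deg j (B m) \<le> E" by auto
  qed
  \<comment> \<open>\<open>c\<close> gives \<open>Suc (M + M * E) \<le> c * (N + 1)\<close>. With
    this \<open>N\<close> the reduced space has dimension at most
    \<open>N * (N + 1) ^ (r - 1)\<close>, just below the number \<open>(N + 1) ^ r\<close> of
    monomials. \<open>M\<close> bounds the degrees of the \<open>W \<alpha>\<close>:
    \<open>r\<close> factors of degree at most \<open>E * N\<close>.\<close>
  define c where "c = r * E * (1 + E) + 1"
  define N where "N = deg j0 P * c ^ (r - 1)"
  define M where "M = r * E * N"
  define X where "X = PiE T' (\<lambda>_. {..N})"
  \<comment> \<open>All monomials get the denominators \<open>B m ^ N\<close>, so
    \<open>W \<alpha>\<close> represents the monomial with exponents \<open>\<alpha>\<close> times a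
    factor independent of \<open>\<alpha>\<close>.\<close>
  define W where "W \<alpha> = (\<Prod>m\<in>T'. A m ^ \<alpha> m * B m ^ (N - \<alpha> m))" for \<alpha>
  have W: "W \<alpha> \<in> polys J" for \<alpha> unfolding W_def using AB by (auto simp: T'_def)
  have degW: "deg j (W \<alpha>) \<le> M" if "\<alpha> \<in> X" "j \<in> J" for \<alpha> j
  proof -
    have "deg j (A m ^ \<alpha> m * B m ^ (N - \<alpha> m)) \<le> E * N" if m: "m \<in> T'" for m
    proof -
      have mT: "m \<in> T" and le: "\<alpha> m \<le> N" using m \<open>\<alpha> \<in> X\<close> by (auto simp: T'_def X_def)
      have "deg j (A m ^ \<alpha> m) \<le> \<alpha> m * E" "deg j (B m ^ (N - \<alpha> m)) \<le> (N - \<alpha> m) * E"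
        using deg_power_le order_trans mult_le_mono2 EAB[OF \<open>j \<in> J\<close> mT] by meson+
      then have "deg j (A m ^ \<alpha> m * B m ^ (N - \<alpha> m)) \<le> \<alpha> m * E + (N - \<alpha> m) * E"
        using deg_mult_le[of j "A m ^ \<alpha> m" "B m ^ (N - \<alpha> m)"] by simp
      also have "\<dots> = E * N" using le by (simp flip: add_mult_distrib)
      finally show ?thesis .
    qed
    then have "(\<Sum>m\<in>T'. deg j (A m ^ \<alpha> m * B m ^ (N - \<alpha> m))) \<le> (\<Sum>m\<in>T'. E * N)" by (rule sum_mono)
    then show ?thesis unfolding W_def M_def using deg_prod_le[of j _ T'] cT' order_trans by fastforce
  qed
  have "\<exists>W'\<in>polys J. P dvd a ^ M * W \<alpha> - W' \<and> deg j0 W' < deg j0 P \<and> (\<forall>j\<in>J. deg j W' \<le> M + M * E)"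
    if "\<alpha> \<in> X" for \<alpha> unfolding a_def
  proof (rule bounded_pseudo_reduction[OF PJ j0J d EP W])
    show "deg j0 (W \<alpha>) < deg j0 P + M" using degW[OF that j0J] d by simp
  qed (use degW[OF that] in auto)
  then obtain W' where W': "\<And>\<alpha>. \<alpha> \<in> X \<Longrightarrow> W' \<alpha> \<in> polys J \<and> P dvd a ^ M * W \<alpha> - W' \<alpha> \<and>
      deg j0 (W' \<alpha>) < deg j0 P \<and> (\<forall>j\<in>J. deg j (W' \<alpha>) \<le> M + M * E)" by metis
  \<comment> \<open>The bound in direction \<open>j0\<close> does not depend on \<open>N\<close>;
    the other bounds grow linearly in \<open>N\<close>. This saves one power of
    \<open>N\<close>.\<close>
  define bnd where "bnd j = (if j = j0 then deg j0 P else Suc (M + M * E))" for j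
  define D where "D = expo J ` PiE J (\<lambda>j. {..<bnd j})"
  have finPi: "finite (PiE J (\<lambda>j. {..<bnd j}))" using J by (intro finite_PiE) auto
  have finD: "finite D" unfolding D_def using finPi by simp
  have finX: "finite X" unfolding X_def using cT' by (intro finite_PiE) auto
  have keysW: "Poly_Mapping.keys (W' \<alpha>) \<subseteq> D" if "\<alpha> \<in> X" for \<alpha>
    unfolding D_def by (rule keys_subset_expo) (use W'[OF that] J in \<open>auto simp: bnd_def le_imp_less_Suc\<close>)
  have "card D \<le> card (PiE J (\<lambda>j. {..<bnd j}))" unfolding D_def using finPi by (rule card_image_le)
  also have "\<dots> = (\<Prod>j\<in>J. bnd j)" using J by (simp add: card_PiE)
  also have "\<dots> = bnd j0 * (\<Prod>j\<in>J - {j0}. bnd j)" using J j0J by (rule prod.remove)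
  also have "(\<Prod>j\<in>J - {j0}. bnd j) = (\<Prod>j\<in>J - {j0}. Suc (M + M * E))"
    by (rule prod.cong) (auto simp: bnd_def)
  also have "\<dots> = Suc (M + M * E) ^ (r - 1)" using j0J by (simp add: r_def)
  also have "bnd j0 * Suc (M + M * E) ^ (r - 1) \<le> deg j0 P * (c * (N + 1)) ^ (r - 1)"
  proof -
    have "Suc (M + M * E) \<le> c * (N + 1)" by (simp add: M_def c_def algebra_simps)
    then show ?thesis by (auto simp: bnd_def intro!: mult_le_mono2 power_mono)
  qed
  also have "\<dots> = deg j0 P * c ^ (r - 1) * (N + 1) ^ (r - 1)"
    by (simp only: power_mult_distrib mult.assoc)
  also have "\<dots> = N * (N + 1) ^ (r - 1)" by (simp only: N_def)
  also have "\<dots> < (N + 1) * (N + 1) ^ (r - 1)" by simp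
  also have "\<dots> = (N + 1) ^ r" using r0 by (cases r) auto
  also have "\<dots> = card X" unfolding X_def using cT' by (simp add: card_PiE)
  finally have cDX: "card D < card X" .
  have "\<exists>c. (\<exists>x\<in>X. c x \<noteq> 0) \<and> (\<Sum>x\<in>X. Const (c x) * W' x) = 0"
    by (rule linear_relation[OF finD finX cDX keysW])
  then obtain \<gamma> where \<gamma>: "\<exists>\<alpha>\<in>X. \<gamma> \<alpha> \<noteq> 0" "(\<Sum>\<alpha>\<in>X. Const (\<gamma> \<alpha>) * W' \<alpha>) = 0"
    by (elim exE conjE)
  define Y where "Y \<alpha> = (\<Prod>m\<in>T'. Var m ^ \<alpha> m)" for \<alpha>
  define BB where "BB = (\<Prod>m\<in>T'. psub \<phi> (B m) ^ N)"
  have WY: "eqmod h (psub \<phi> a ^ M * BB * Y \<alpha>) (psub \<phi> (W' \<alpha>))" if "\<alpha> \<in> X" for \<alpha>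
  proof -
    have le: "\<alpha> m \<le> N" if "m \<in> T'" for m using that \<open>\<alpha> \<in> X\<close> by (auto simp: X_def)
    have "BB * Y \<alpha> = (\<Prod>m\<in>T'. (Var m * psub \<phi> (B m)) ^ \<alpha> m * psub \<phi> (B m) ^ (N - \<alpha> m))"
      unfolding BB_def Y_def prod.distrib[symmetric]
    proof (rule prod.cong)
      fix m assume "m \<in> T'"
      have "psub \<phi> (B m) ^ N = psub \<phi> (B m) ^ \<alpha> m * psub \<phi> (B m) ^ (N - \<alpha> m)"
        using le[OF \<open>m \<in> T'\<close>] by (simp flip: power_add)
      then show "psub \<phi> (B m) ^ N * Var m ^ \<alpha> m =
          (Var m * psub \<phi> (B m)) ^ \<alpha> m * psub \<phi> (B m) ^ (N - \<alpha> m)"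
        by (simp add: power_mult_distrib mult_ac)
    qed simp
    moreover have "eqmod h \<dots> (psub \<phi> (W \<alpha>))" unfolding W_def psub.prod psub.mult psub.power
      using AB by (intro eqmod_prod eqmod_mult eqmod_power) (auto simp: T'_def)
    ultimately have 1: "eqmod h (BB * Y \<alpha>) (psub \<phi> (W \<alpha>))" by simp
    obtain q where "a ^ M * W \<alpha> - W' \<alpha> = P * q" using W'[OF \<open>\<alpha> \<in> X\<close>] by (elim conjE dvdE)
    then have "h dvd psub \<phi> (a ^ M * W \<alpha> - W' \<alpha>)" using hP by (simp only: psub.mult dvd_mult2)
    then have 2: "eqmod h (psub \<phi> a ^ M * psub \<phi> (W \<alpha>)) (psub \<phi> (W' \<alpha>))"
      by (simp add: eqmod_def)
    have "eqmod h (psub \<phi> a ^ M * (BB * Y \<alpha>)) (psub \<phi> a ^ M * psub \<phi> (W \<alpha>))"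
      using 1 by (intro eqmod_mult) auto
    then show ?thesis using eqmod_trans 2 by (simp add: mult.assoc)
  qed
  define Z where "Z = (\<Sum>\<alpha>\<in>X. Const (\<gamma> \<alpha>) * Y \<alpha>)"
  have "eqmod h (psub \<phi> a ^ M * BB * Z) (\<Sum>\<alpha>\<in>X. Const (\<gamma> \<alpha>) * psub \<phi> (W' \<alpha>))"
    unfolding Z_def sum_distrib_left
    using WY by (subst mult.left_commute) (intro eqmod_sum eqmod_mult eqmod_refl)
  also have "(\<Sum>\<alpha>\<in>X. Const (\<gamma> \<alpha>) * psub \<phi> (W' \<alpha>)) = psub \<phi> (\<Sum>\<alpha>\<in>X. Const (\<gamma> \<alpha>) * W' \<alpha>)"
    by simp
  also have "\<dots> = 0" using \<gamma>(2) by simp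
  finally have "h dvd psub \<phi> a ^ M * BB * Z" by (simp add: eqmod_0)
  moreover have "\<not> h dvd psub \<phi> a ^ M" by (rule prime_not_dvd_power[OF prime ha])
  moreover have "\<not> h dvd BB" unfolding BB_def
    using AB by (intro prime_not_dvd_prod prime prime_not_dvd_power) (auto simp: T'_def)
  ultimately have hZ: "h dvd Z" using prime prime_elem_dvd_multD by blast
  have "Z \<in> polys (UNIV - {k})" unfolding Z_def Y_def T'_def by (intro polys_sum polys_mult polys_Const polys_prod polys_power polys_Var) auto
  then have degZ: "deg k Z = 0" by (rule deg_free)
  have Z0: "Z = 0"
  proof (rule ccontr)
    assume "Z \<noteq> 0"
    then show False using hZ degZ k by (auto simp: deg_mult elim!: dvdE)
  qed
  obtain \<beta> where \<beta>: "\<beta> \<in> X" "\<gamma> \<beta> \<noteq> 0" using \<gamma> by blast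
  have "Poly_Mapping.lookup Z (expo T' \<beta>) = (\<Sum>\<alpha>\<in>X. if \<alpha> = \<beta> then \<gamma> \<beta> else 0)"
    unfolding Z_def lookup_sum
  proof (rule sum.cong)
    fix \<alpha> assume "\<alpha> \<in> X"
    then have "expo T' \<alpha> = expo T' \<beta> \<longleftrightarrow> \<alpha> = \<beta>"
      using \<beta> inj_onD[OF expo_inj[OF cT'(2), of "\<lambda>_. {..N}"]] unfolding X_def by blast
    then show "Poly_Mapping.lookup (Const (\<gamma> \<alpha>) * Y \<alpha>) (expo T' \<beta>) = (if \<alpha> = \<beta> then \<gamma> \<beta> else 0)"
      by (auto simp: Y_def prod_Var_power[OF cT'(2)] Const_def mult_single lookup_single)
  qed simp
  then show False using Z0 \<beta> finX by simp
qed

section \<open>Regular functions on the complement of hypersurfaces\<close>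

lemma extract_irreducible_power:
  fixes p :: mpoly
  assumes "irreducible \<pi>" "p \<noteq> 0"
  shows "\<exists>q e. p = q * \<pi> ^ e \<and> \<not> \<pi> dvd q"
  using assms(2)
proof (induction rule: irreducible_induct)
  case (unit u)
  have "\<not> \<pi> dvd u" using assms(1) unit by (auto simp: irreducible_def intro: dvd_trans)
  then show ?case by (intro exI[of _ u] exI[of _ 0]) auto
next
  case (mult \<rho> q)
  then obtain q' e where q: "q = q' * \<pi> ^ e" "\<not> \<pi> dvd q'" by blast
  have prime: "prime_elem \<pi>" by (rule irreducible_imp_prime_mpoly[OF assms(1)])
  show ?case
  proof (cases "\<pi> dvd \<rho>")
    case False
    then have "\<not> \<pi> dvd \<rho> * q'" using q prime prime_elem_dvd_multD by blast
    then show ?thesis unfolding q(1) by (intro exI[of _ "\<rho> * q'"] exI[of _ e]) (simp add: mult.assoc)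
  next
    case True
    then obtain u where u: "\<rho> = \<pi> * u" by (elim dvdE)
    then have "punit u" using mult.hyps(1) assms(1) by (auto simp: irreducible_def)
    then have "\<not> \<pi> dvd u" using assms(1) by (auto simp: irreducible_def intro: dvd_trans)
    then have "\<not> \<pi> dvd u * q'" using q prime prime_elem_dvd_multD by blast
    then show ?thesis unfolding q(1) u
      by (intro exI[of _ "u * q'"] exI[of _ "Suc e"]) (simp add: mult_ac)
  qed
qed

lemma extract_irreducible_powers:
  fixes p :: mpoly
  assumes "finite A" "\<And>\<pi>. \<pi> \<in> A \<Longrightarrow> irreducible \<pi>" "p \<noteq> 0"
  shows "\<exists>q e. p = q * (\<Prod>\<pi>\<in>A. \<pi> ^ e \<pi>) \<and> (\<forall>\<pi>\<in>A. \<not> \<pi> dvd q)"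
  using assms
proof (induction A rule: finite_induct)
  case (insert \<pi> A)
  then obtain q e where q: "p = q * (\<Prod>\<pi>\<in>A. \<pi> ^ e \<pi>)" "\<forall>\<pi>\<in>A. \<not> \<pi> dvd q" by auto
  then have "q \<noteq> 0" using insert.prems by auto
  then obtain q' i where q': "q = q' * \<pi> ^ i" "\<not> \<pi> dvd q'"
    using extract_irreducible_power insert.prems by blast
  have "(\<Prod>\<rho>\<in>insert \<pi> A. \<rho> ^ (e(\<pi> := i)) \<rho>) = \<pi> ^ i * (\<Prod>\<rho>\<in>A. \<rho> ^ e \<rho>)"
  proof -
    have "(\<Prod>\<rho>\<in>A. \<rho> ^ (e(\<pi> := i)) \<rho>) = (\<Prod>\<rho>\<in>A. \<rho> ^ e \<rho>)"
      using insert.hyps by (intro prod.cong) auto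
    then show ?thesis using insert.hyps by simp
  qed
  then have "p = q' * (\<Prod>\<rho>\<in>insert \<pi> A. \<rho> ^ (e(\<pi> := i)) \<rho>)"
    using q q' by (simp add: mult_ac)
  moreover have "\<forall>\<rho>\<in>insert \<pi> A. \<not> \<rho> dvd q'" using q q' by auto
  ultimately show ?case by blast
qed auto

lemma to_fract_power: "to_fract (p ^ i) = to_fract p ^ i" for p :: mpoly
  by (induction i) auto

lemma to_fract_prod: "to_fract (\<Prod>i\<in>I. f i :: mpoly) = (\<Prod>i\<in>I. to_fract (f i))"
  by (induction I rule: infinite_finite_induct) auto

definition Gmon :: "mpoly set \<Rightarrow> (mpoly \<Rightarrow> nat) \<Rightarrow> mpoly" where
  "Gmon G e = (\<Prod>h\<in>G. h ^ e h)"

definition Gpow :: "mpoly set \<Rightarrow> (mpoly \<Rightarrow> int) \<Rightarrow> ratfun" where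
  "Gpow G k = (\<Prod>h\<in>G. to_fract h powi k h)"

lemma pole_decomp_Gpow: "pole_decomp s G f p k \<longleftrightarrow>
    p \<in> polys {1..s} \<and> (\<forall>h\<in>G. \<not> h dvd p) \<and> f = to_fract p * Gpow G (\<lambda>h. - k h)"
  by (simp add: pole_decomp_def Gpow_def)

text \<open>\<open>G_dvd\<close> excludes associated members, so that the orders along different
  members can be told apart.\<close>

locale divisor_family =
  fixes s :: nat and G :: "mpoly set"
  assumes fin: "finite G"
    and G_polys: "h \<in> G \<Longrightarrow> h \<in> polys {1..s}"
    and G_irr: "h \<in> G \<Longrightarrow> irreducible h"
    and G_dvd: "h \<in> G \<Longrightarrow> h' \<in> G \<Longrightarrow> h dvd h' \<Longrightarrow> h = h'"
begin

lemma G_prime: "h \<in> G \<Longrightarrow> prime_elem h"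
  using G_irr irreducible_imp_prime_mpoly by blast

lemma G_nonzero: "h \<in> G \<Longrightarrow> h \<noteq> 0"
  using G_irr by (auto simp: irreducible_def)

lemma Gpow_add: "Gpow G (\<lambda>h. k h + l h) = Gpow G k * Gpow G l"
  unfolding Gpow_def prod.distrib[symmetric]
  by (rule prod.cong) (auto simp: G_nonzero power_int_add)

lemma Gpow_0 [simp]: "Gpow G (\<lambda>h. 0) = 1"
  by (simp add: Gpow_def)

lemma Gpow_nonzero [simp]: "Gpow G k \<noteq> 0"
  using fin G_nonzero by (simp add: Gpow_def)

lemma Gpow_minus: "Gpow G (\<lambda>h. - k h) = inverse (Gpow G k)"
  by (simp add: Gpow_def power_int_minus prod_inversef[symmetric] o_def)

lemma Gpow_cong: "(\<And>h. h \<in> G \<Longrightarrow> k h = l h) \<Longrightarrow> Gpow G k = Gpow G l"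
  unfolding Gpow_def by (rule prod.cong) auto

lemma Gpow_of_nat: "Gpow G (\<lambda>h. int (e h)) = to_fract (Gmon G e)"
  by (simp add: Gpow_def Gmon_def to_fract_prod to_fract_power)

lemma Gpow_nonneg: "(\<And>h. h \<in> G \<Longrightarrow> k h \<ge> 0) \<Longrightarrow> Gpow G k = to_fract (Gmon G (\<lambda>h. nat (k h)))"
  unfolding Gpow_of_nat[symmetric] by (rule Gpow_cong) auto

lemma Gpow_quotient:
  "Gpow G k = to_fract (Gmon G (\<lambda>h. nat (k h))) / to_fract (Gmon G (\<lambda>h. nat (- k h)))"
proof -
  have "Gpow G k * Gpow G (\<lambda>h. int (nat (- k h))) = Gpow G (\<lambda>h. int (nat (k h)))"
    unfolding Gpow_add[symmetric] by (rule Gpow_cong) auto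
  then show ?thesis unfolding Gpow_of_nat[symmetric] by (simp add: field_simps)
qed

lemma Gmon_polys: "Gmon G e \<in> polys {1..s}"
  unfolding Gmon_def using G_polys by auto

lemma Gmon_nonzero: "Gmon G e \<noteq> 0"
  unfolding Gmon_def using fin G_nonzero by simp

lemma value_Gmon:
  assumes "\<And>h. h \<in> G \<Longrightarrow> value_at x h \<noteq> 0" shows "value_at x (Gmon G e) \<noteq> 0"
  unfolding Gmon_def using assms fin by simp

lemma G_dvd_Gmon:
  assumes "h \<in> G" shows "h dvd Gmon G e \<longleftrightarrow> e h > 0"
proof
  assume "e h > 0"
  then have "h dvd h ^ e h" by (simp add: dvd_power)
  also have "\<dots> dvd Gmon G e" unfolding Gmon_def by (rule dvd_prod_eqI[OF fin assms]) simp
  finally show "h dvd Gmon G e" .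
next
  assume d: "h dvd Gmon G e"
  show "e h > 0"
  proof (rule ccontr)
    assume "\<not> e h > 0"
    moreover have "\<not> h dvd 1" using G_irr[OF assms] by (auto simp: irreducible_def)
    ultimately have "\<not> h dvd g ^ e g" if "g \<in> G" for g
      using G_dvd[OF assms that] prime_not_dvd_power[OF G_prime[OF assms]] by fastforce
    then have "\<not> h dvd (\<Prod>g\<in>G. g ^ e g)" by (intro prime_not_dvd_prod[OF G_prime[OF assms]])
    then show False using d unfolding Gmon_def by simp
  qed
qed

text \<open>After cancelling the smaller exponent at every member of \<open>G\<close>, both sides
  are polynomials. If \<open>l h\<close> exceeded \<open>k h\<close>, then \<open>h\<close> would
  divide the left side, but it divides neither factor there. Only \<open>p\<close> is assumed free
  of \<open>h\<close>, hence an inequality.\<close>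

lemma pole_le:
  assumes "h \<in> G" "\<not> h dvd p" "to_fract p * Gpow G k = to_fract q * Gpow G l"
  shows "l h \<le> k h"
proof (rule ccontr)
  assume lt: "\<not> l h \<le> k h"
  define m where "m g = min (k g) (l g)" for g
  have *: "Gpow G (\<lambda>g. a g - m g) = Gpow G a / Gpow G m" for a
    using Gpow_add[of "\<lambda>g. a g - m g" m] by (simp add: field_simps)
  have "to_fract p * Gpow G (\<lambda>g. k g - m g) = to_fract q * Gpow G (\<lambda>g. l g - m g)"
    using assms(3) by (simp add: *)
  moreover have "Gpow G (\<lambda>g. k g - m g) = to_fract (Gmon G (\<lambda>g. nat (k g - m g)))"
    "Gpow G (\<lambda>g. l g - m g) = to_fract (Gmon G (\<lambda>g. nat (l g - m g)))"
    by (auto simp: m_def intro!: Gpow_nonneg)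
  ultimately have e: "p * Gmon G (\<lambda>g. nat (k g - m g)) = q * Gmon G (\<lambda>g. nat (l g - m g))"
    by (simp flip: to_fract_mult)
  have "h dvd Gmon G (\<lambda>g. nat (l g - m g))" "\<not> h dvd Gmon G (\<lambda>g. nat (k g - m g))"
    unfolding G_dvd_Gmon[OF assms(1)] using lt by (auto simp: m_def)
  moreover from this(1) have "h dvd p * Gmon G (\<lambda>g. nat (k g - m g))" unfolding e by (rule dvd_mult)
  ultimately show False using prime_elem_dvd_multD[OF G_prime[OF assms(1)]] assms(2) by blast
qed

lemma pole_unique:
  assumes "\<forall>h\<in>G. \<not> h dvd p" "\<forall>h\<in>G. \<not> h dvd q" "to_fract p * Gpow G k = to_fract q * Gpow G l"
  shows "p = q" "\<And>h. h \<in> G \<Longrightarrow> k h = l h"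
proof -
  show kl: "k h = l h" if "h \<in> G" for h
    using pole_le[OF that _ assms(3)] pole_le[OF that _ assms(3)[symmetric]] assms(1,2) that
    by (meson order_antisym)
  show "p = q" using assms(3) Gpow_cong[OF kl] by simp
qed

text \<open>Uniqueness makes the definite descriptions in \<open>hat\<close> and
  \<open>pole_order\<close> usable. It concerns exponents on \<open>G\<close> only; elsewhere
  \<open>k\<close> is arbitrary.\<close>

lemma pole_decomp_hat:
  assumes "pole_decomp s G f p k"
  shows "hat s G f = p" "\<And>h. h \<in> G \<Longrightarrow> pole_order s G f h = k h"
proof -
  have *: "q = p \<and> (\<forall>h\<in>G. l h = k h)" if "pole_decomp s G f q l" for q l
  proof -
    have "\<forall>h\<in>G. \<not> h dvd q" "\<forall>h\<in>G. \<not> h dvd p"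
      "to_fract q * Gpow G (\<lambda>h. - l h) = to_fract p * Gpow G (\<lambda>h. - k h)"
      using that assms unfolding pole_decomp_Gpow by metis+
    note u = pole_unique[OF this]
    show ?thesis using u(1) u(2) by simp
  qed
  show "hat s G f = p" unfolding hat_def by (rule the_equality) (use assms * in blast)+
  show "pole_order s G f h = k h" if "h \<in> G" for h
    unfolding pole_order_def by (rule the_equality) (use assms * that in blast)+
qed

lemma regularI: "p \<in> polys {1..s} \<Longrightarrow> to_fract p * Gpow G k \<in> regular_functions s G"
  unfolding regular_functions_def
proof safe
  fix x assume p: "p \<in> polys {1..s}" and x: "\<forall>h\<in>G. value_at x h \<noteq> 0"
  show "\<exists>a\<in>polys {1..s}. \<exists>b\<in>polys {1..s}. value_at x b \<noteq> 0 \<and> to_fract p * Gpow G k = to_fract a / to_fract b"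
  proof (intro bexI conjI)
    show "value_at x (Gmon G (\<lambda>h. nat (- k h))) \<noteq> 0" using x by (intro value_Gmon) auto
    show "to_fract p * Gpow G k = to_fract (p * Gmon G (\<lambda>h. nat (k h))) / to_fract (Gmon G (\<lambda>h. nat (- k h)))"
      unfolding Gpow_quotient by simp
  qed (use p Gmon_polys in auto)
qed

text \<open>An irreducible factor \<open>\<pi>\<close> of the denominator that neither cancels nor
  divides a member of \<open>G\<close> has a zero off all the hypersurfaces; a fraction for
  \<open>f\<close> defined at that point contradicts primality of \<open>\<pi>\<close>. Regularity
  passes to the product of \<open>f\<close> and \<open>\<pi>\<close>, so the factors can be peeled
  off one at a time.\<close>

lemma regular_denominator:
  assumes "b \<noteq> 0"
    and "\<And>x. \<forall>h\<in>G. value_at x h \<noteq> 0 \<Longrightarrow> \<exists>p q. value_at x q \<noteq> 0 \<and> f = to_fract p / to_fract q"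
    and "f = to_fract a / to_fract b"
  shows "\<exists>a' e. f = to_fract a' / to_fract (Gmon G e)"
  using assms
proof (induction arbitrary: f a rule: irreducible_induct)
  case (unit u)
  then obtain v where v: "1 = u * v" by (elim dvdE)
  then have uv: "to_fract u * to_fract v = 1" by (simp flip: to_fract_mult)
  then have "to_fract u \<noteq> 0" by auto
  then have fu: "f * to_fract u = to_fract a" using unit.prems(2) by simp
  have "f = f * to_fract u * to_fract v" using uv by (simp add: mult.assoc)
  also have "\<dots> = to_fract a * to_fract v" unfolding fu ..
  finally have "f = to_fract a * to_fract v" .
  then have "f = to_fract (a * v) / to_fract (Gmon G (\<lambda>_. 0))" by (simp add: Gmon_def)
  then show ?case by blast
next
  case (mult \<pi> q)
  have pi0: "to_fract \<pi> \<noteq> 0" "to_fract q \<noteq> 0" using mult.hyps by (auto simp: irreducible_def)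
  have prime: "prime_elem \<pi>" using mult.hyps irreducible_imp_prime_mpoly by blast
  show ?case
  proof (cases "\<pi> dvd a")
    case True
    then obtain a' where "a = \<pi> * a'" by (elim dvdE)
    then have "f = to_fract a' / to_fract q" using mult.prems(2) pi0 by simp
    then show ?thesis using mult.IH mult.prems by blast
  next
    case False
    have "\<exists>h\<in>G. \<pi> dvd h"
    proof (rule ccontr)
      assume "\<not> (\<exists>h\<in>G. \<pi> dvd h)"
      then have "\<not> \<pi> dvd Gmon G (\<lambda>_. 1)" unfolding Gmon_def by (intro prime_not_dvd_prod prime) auto
      then obtain x where x: "value_at x \<pi> = 0" "value_at x (Gmon G (\<lambda>_. 1)) \<noteq> 0"
        using irreducible_nullstellensatz mult.hyps by blast
      then have "\<forall>h\<in>G. value_at x h \<noteq> 0" using fin by (auto simp: Gmon_def)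
      then obtain p q' where pq: "value_at x q' \<noteq> 0" "f = to_fract p / to_fract q'"
        using mult.prems by blast
      have "q' \<noteq> 0" using pq by auto
      then have "to_fract (p * (\<pi> * q)) = to_fract (a * q')"
        using pq mult.prems(2) pi0 by (simp add: field_simps)
      then have "\<pi> dvd a * q'" by (metis dvd_triv_left mult.left_commute to_fract_eq_iff)
      then have "\<pi> dvd q'" using False prime prime_elem_dvd_multD by blast
      then show False using x(1) pq(1) by (auto elim!: dvdE)
    qed
    then obtain h u where h: "h \<in> G" "h = \<pi> * u" by (auto elim: dvdE)
    have u0: "to_fract u \<noteq> 0" using h G_nonzero[OF h(1)] by auto
    have "\<exists>p q. value_at x q \<noteq> 0 \<and> f * to_fract \<pi> = to_fract p / to_fract q"
      if "\<forall>h\<in>G. value_at x h \<noteq> 0" for x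
      using mult.prems(1)[OF that] by (metis to_fract_mult times_divide_eq_left)
    moreover have "f * to_fract \<pi> = to_fract a / to_fract q" using mult.prems(2) pi0 by simp
    ultimately obtain a' e where ae: "f * to_fract \<pi> = to_fract a' / to_fract (Gmon G e)"
      using mult.IH by metis
    have "Gmon G (e(h := Suc (e h))) = h * Gmon G e"
    proof -
      have "(\<Prod>g\<in>G - {h}. g ^ (e(h := Suc (e h))) g) = (\<Prod>g\<in>G - {h}. g ^ e g)"
        by (rule prod.cong) auto
      then show ?thesis unfolding Gmon_def using fin h(1) by (simp add: prod.remove[of G h])
    qed
    then have "f = to_fract (a' * u) / to_fract (Gmon G (e(h := Suc (e h))))"
      using ae pi0 u0 Gmon_nonzero[of e] by (simp add: h(2) field_simps)
    then show ?thesis by blast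
  qed
qed

lemma regular_pole_decomp:
  assumes "f \<in> regular_functions s G" "f \<noteq> 0"
  obtains p k where "pole_decomp s G f p k"
proof -
  obtain x where "value_at x (Gmon G (\<lambda>_. 1)) \<noteq> 0" using nonvanishing_point Gmon_nonzero by blast
  then have "\<forall>h\<in>G. value_at x h \<noteq> 0" using fin by (auto simp: Gmon_def)
  then obtain a b where ab: "a \<in> polys {1..s}" "b \<in> polys {1..s}" "value_at x b \<noteq> 0" "f = to_fract a / to_fract b"
    using assms(1) unfolding regular_functions_def by blast
  have b0: "b \<noteq> 0" using ab by auto
  have a0: "a \<noteq> 0" using ab assms(2) by auto
  have "\<exists>a' e. f = to_fract a' / to_fract (Gmon G e)"
    by (rule regular_denominator[OF b0 _ ab(4)]) (use assms(1) in \<open>unfold regular_functions_def, blast\<close>)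
  then obtain a' e where ae: "f = to_fract a' / to_fract (Gmon G e)" by blast
  then have "a' \<noteq> 0" using assms(2) by auto
  then obtain p e' where p: "a' = p * Gmon G e'" "\<forall>h\<in>G. \<not> h dvd p"
    using extract_irreducible_powers[of G a'] fin G_irr unfolding Gmon_def by blast
  \<comment> \<open>\<open>a'\<close> comes without control of its variables; \<open>p\<close>
    divides \<open>a * Gmon G e\<close> and so lies in \<open>polys {1..s}\<close>.\<close>
  have "to_fract (a' * b) = to_fract (a * Gmon G e)"
    using ae ab(4) b0 Gmon_nonzero[of e] by (simp add: field_simps)
  then have eq: "a' * b = a * Gmon G e" by (simp only: to_fract_eq_iff)
  then have "p dvd a * Gmon G e" unfolding p(1) by (metis dvd_triv_left mult.assoc)
  then have "p \<in> polys {1..s}"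
    by (rule dvd_polys) (use ab a0 Gmon_polys Gmon_nonzero in auto)
  moreover have "f = to_fract p * Gpow G (\<lambda>h. int (e' h) + - int (e h))"
    unfolding Gpow_add Gpow_minus Gpow_of_nat ae p(1) by (simp add: field_simps)
  moreover have "Gpow G (\<lambda>h. int (e' h) + - int (e h)) = Gpow G (\<lambda>h. - (int (e h) - int (e' h)))"
    by (rule Gpow_cong) simp
  ultimately have "pole_decomp s G f p (\<lambda>h. int (e h) - int (e' h))"
    unfolding pole_decomp_Gpow using p(2) by simp
  then show ?thesis by (rule that)
qed

end

section \<open>Formal variables, divisibility by a divisor, and exchange of one variable\<close>

lemma Var_irreducible: "irreducible (Var l)"
  unfolding irreducible_def
proof (intro conjI allI impI)
  have "deg l (Var l) \<noteq> 0" by simp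
  then show "\<not> punit (Var l)" using deg_free[of "Var l" "{}" l] by (auto simp: punit_iff)
  fix a b assume ab: "Var l = a * b"
  have nz: "a \<noteq> 0" "b \<noteq> 0" using ab Var_neq_0[of l] by auto
  have J: "a \<in> polys {l}" "b \<in> polys {l}"
    using dvd_polys[OF _ polys_Var[of l "{l}"] Var_neq_0] ab by simp_all
  have "deg l a + deg l b = 1" using ab deg_mult[OF nz, of l] by (metis deg_Var)
  then have "deg l a = 0 \<or> deg l b = 0" by auto
  then show "punit a \<or> punit b"
    using free_deg[OF J(1), of l] free_deg[OF J(2), of l] nz by (auto simp: punit_iff)
qed simp

text \<open>\<open>p0\<close> is \<open>p\<close> with \<open>Var g\<close> set to 0; once
  \<open>h\<close> is substituted for \<open>Var g\<close>, this is reduction modulo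
  \<open>h\<close>.\<close>

lemma reduce_var:
  assumes "p \<in> polys J"
  obtains p0 where "p0 \<in> polys (J - {g})" "Var g dvd p - p0"
proof
  show "coeff (upoly g p) 0 \<in> polys (J - {g})" by (rule coeff_upoly_polys[OF assms])
  obtain c q where cq: "upoly g p = pCons c q" by (rule pCons_cases)
  then have "p = c + Var g * poly q (Var g)" using poly_upoly[of g p] by simp
  then have "p - c = Var g * poly q (Var g)" by (simp add: algebra_simps)
  then show "Var g dvd p - coeff (upoly g p) 0" by (simp add: cq)
qed

lemma psub_dvd: "p dvd q \<Longrightarrow> psub \<phi> p dvd psub \<phi> q"
  by (auto elim!: dvdE)

text \<open>Modulo \<open>h\<close> the variable number \<open>g\<close> becomes 0, and what is left
  of \<open>p\<close> is a nonzero polynomial in independent variables.\<close>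

lemma not_dvd_psub:
  assumes "indep_mod h (J - {g}) \<phi>" "\<phi> g = h" "p \<in> polys J" "\<not> Var g dvd p"
  shows "\<not> h dvd psub \<phi> p"
proof
  assume d: "h dvd psub \<phi> p"
  obtain p0 where p0: "p0 \<in> polys (J - {g})" "Var g dvd p - p0" by (rule reduce_var[OF assms(3)])
  have "h dvd psub \<phi> (p - p0)" using psub_dvd[OF p0(2), of \<phi>] assms(2) by simp
  then have "h dvd psub \<phi> p - psub \<phi> (p - p0)" using d by (rule dvd_diff[rotated])
  then have "p0 = 0" using assms(1) p0(1) by (auto simp: indep_mod_def)
  then show False using p0(2) assms(4) by simp
qed

text \<open>The polynomial \<open>R\<close> clears the denominator in \<open>\<phi>' m = Q / \<phi> m\<close>.\<close>

lemma indep_mod_exchange: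
  assumes ind: "indep_mod h J \<phi>" and m: "m \<in> J"
    and same: "\<And>l. l \<in> J - {m} \<Longrightarrow> \<phi>' l = \<phi> l"
    and Q: "Q \<in> polys (J - {m})" "Q \<noteq> 0"
    and rel: "eqmod h (\<phi> m * \<phi>' m) (psub \<phi> Q)"
  shows "indep_mod h J \<phi>'"
  unfolding indep_mod_def
proof (intro ballI impI)
  fix P assume P: "P \<in> polys J" "h dvd psub \<phi>' P"
  define c where "c i = coeff (upoly m P) i" for i
  define d where "d = degree (upoly m P)"
  have cJ: "c i \<in> polys (J - {m})" for i unfolding c_def by (rule coeff_upoly_polys[OF P(1)])
  have Pc: "P = (\<Sum>i\<le>d. c i * Var m ^ i)" unfolding c_def d_def by (rule mpoly_decomp)
  define R where "R = (\<Sum>i\<le>d. c i * Q ^ i * Var m ^ (d - i))"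
  have "c i \<in> polys J" "Q \<in> polys J" for i
    by (rule polys_mono[OF _ cJ], blast) (rule polys_mono[OF _ Q(1)], blast)
  then have RJ: "R \<in> polys J" unfolding R_def using m by (intro polys_sum polys_mult polys_power polys_Var)
  have "psub \<phi> R = (\<Sum>i\<le>d. psub \<phi> (c i) * psub \<phi> Q ^ i * \<phi> m ^ (d - i))"
    by (simp add: R_def)
  also have "eqmod h \<dots> (\<Sum>i\<le>d. psub \<phi> (c i) * (\<phi> m * \<phi>' m) ^ i * \<phi> m ^ (d - i))"
    by (intro eqmod_sum eqmod_mult eqmod_power eqmod_refl eqmod_sym[OF rel])
  also have "(\<Sum>i\<le>d. psub \<phi> (c i) * (\<phi> m * \<phi>' m) ^ i * \<phi> m ^ (d - i)) = \<phi> m ^ d * psub \<phi>' P"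
  proof -
    have "psub \<phi>' (c i) = psub \<phi> (c i)" for i by (rule psub_cong[OF cJ same])
    moreover have "\<phi> m ^ d = \<phi> m ^ i * \<phi> m ^ (d - i)" if "i \<le> d" for i
      using that by (simp flip: power_add)
    ultimately show ?thesis
      by (subst Pc) (simp add: sum_distrib_left power_mult_distrib mult_ac)
  qed
  finally have "h dvd psub \<phi> R" using P(2) by (simp add: eqmod_dvd)
  then have R0: "R = 0" using ind RJ by (simp add: indep_mod_def)
  \<comment> \<open>\<open>c i\<close> and \<open>Q\<close> are free of \<open>Var m\<close>, so the
    summands of \<open>R\<close> sit in distinct powers of \<open>Var m\<close>;
    \<open>R = 0\<close> makes each of them vanish.\<close>
  have "upoly m (c i * Q ^ i * Var m ^ (d - i)) = monom (c i * Q ^ i) (d - i)" for i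
  proof -
    have "upoly m (c i * Q ^ i) = [:c i * Q ^ i:]"
      by (rule upoly_free[OF polys_mult[OF cJ polys_power[OF Q(1)]]])
    then show ?thesis by (simp only: upoly_simps(4)) (simp add: monom_altdef)
  qed
  then have up: "upoly m R = (\<Sum>i\<le>d. monom (c i * Q ^ i) (d - i))"
    unfolding R_def upoly_simps(10) by simp
  have "c j = 0" if "j \<le> d" for j
  proof -
    have "coeff (upoly m R) (d - j) = (\<Sum>i\<le>d. if i = j then c j * Q ^ j else 0)"
      unfolding up coeff_sum using that by (intro sum.cong) auto
    then have "c j * Q ^ j = 0" using R0 that by simp
    then show ?thesis using Q(2) by simp
  qed
  then show "P = 0" by (subst Pc) simp
qed

lemma alg_gen_subset:
  assumes "a \<in> alg_gen X" "X \<subseteq> alg_gen Y" shows "a \<in> alg_gen Y"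
  using assms(1) by induction (use assms(2) in \<open>auto intro: alg_gen.intros\<close>)

lemma alg_gen_mono: "a \<in> alg_gen X \<Longrightarrow> X \<subseteq> Y \<Longrightarrow> a \<in> alg_gen Y"
  by (rule alg_gen_subset) (auto intro: alg_gen.base)

lemma alg_gen_1: "1 \<in> alg_gen X"
  using alg_gen.const[of 1 X] by simp

lemma alg_gen_power: "a \<in> alg_gen X \<Longrightarrow> a ^ i \<in> alg_gen X"
  by (induction i) (auto intro: alg_gen_1 alg_gen.mult)

lemma alg_gen_prod: "(\<And>i. i \<in> I \<Longrightarrow> f i \<in> alg_gen X) \<Longrightarrow> (\<Prod>i\<in>I. f i) \<in> alg_gen X"
  by (induction I rule: infinite_finite_induct) (auto intro: alg_gen_1 alg_gen.mult)

lemma alg_gen_psub: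
  assumes "p \<in> polys J" "\<And>l. l \<in> J \<Longrightarrow> to_fract (\<phi> l) \<in> alg_gen X"
  shows "to_fract (psub \<phi> p) \<in> alg_gen X"
  using assms(1) by (induction rule: polys_induct) (auto intro: alg_gen.intros assms(2))


section \<open>Coherence of the pullback\<close>

locale cluster_pullback =
  fixes n s :: nat and G :: "mpoly set" and C :: "seed set"
  assumes ns: "n \<le> s" and finite_G: "finite G"
    and G_hyp: "\<forall>h \<in> G. h \<in> polys {1..s} \<and> irreducible h"
    and gcs: "gen_cluster_structure n s G C"
    and reg: "regular_structure s G C"
    and compl: "complete_structure n s G C"
begin

lemma seed: "S \<in> C \<Longrightarrow> is_seed n s S"
  using gcs unfolding gen_cluster_structure_def by blast

lemma clus_indep: "S \<in> C \<Longrightarrow> alg_indep {1..s} (clus S)"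
  using seed unfolding is_seed_def by blast

lemma C_mutation_class: obtains S0 where "C = mutation_class n s S0"
  using gcs unfolding gen_cluster_structure_def by (elim conjE exE)

lemma mutate_C:
  assumes "S \<in> C" "m \<in> {1..n}" shows "mutate n s m S \<in> C"
proof -
  obtain S0 where S0: "C = mutation_class n s S0" by (rule C_mutation_class)
  show ?thesis using assms unfolding S0 by (rule mutation_class.step)
qed

text \<open>Proportionality is an algebraic relation. The case \<open>c = 1\<close> gives
  injectivity of a cluster; general \<open>c\<close> excludes associated members of
  \<open>G\<close>.\<close>

lemma clus_not_multiple:
  assumes "S \<in> C" "i \<in> {1..s}" "j \<in> {1..s}" "clus S i = to_fract (Const c) * clus S j" shows "i = j"
proof (rule ccontr)
  assume ne: "i \<noteq> j"
  let ?p = "Var i - Const c * Var j"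
  have "?p \<in> polys {1..s}" using assms by (intro polys_diff polys_mult polys_Const polys_Var)
  moreover have "subst_at (clus S) ?p = 0" using assms(4) by simp
  ultimately have "?p = 0" using clus_indep[OF assms(1)] unfolding alg_indep_def by blast
  then have "upoly i ?p = 0" by simp
  then have "coeff (upoly i ?p) 1 = 0" by simp
  then show False using ne by (simp add: coeff_pCons)
qed

lemma clus_inj: "S \<in> C \<Longrightarrow> inj_on (clus S) {1..s}"
  by (rule inj_onI, rule clus_not_multiple[of S _ _ 1]) auto

lemma clus_nonzero:
  assumes "S \<in> C" "l \<in> {1..s}" shows "clus S l \<noteq> 0"
proof
  assume "clus S l = 0"
  then have "subst_at (clus S) (Var l) = 0" by simp
  moreover have "Var l \<in> polys {1..s}" using assms by blast
  ultimately show False using clus_indep[OF assms(1)] Var_neq_0 unfolding alg_indep_def by blast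
qed

lemma G_vertex_ex:
  assumes "S \<in> C" "h \<in> G" shows "\<exists>l \<in> {n+1..s}. clus S l = to_fract h"
proof -
  have "to_fract h \<in> clus S ` {n+1..s}" using gcs assms unfolding gen_cluster_structure_def by blast
  then show ?thesis by auto
qed

text \<open>The vertex carrying \<open>h\<close>, unique because clusters are injective.\<close>

definition gv :: "seed \<Rightarrow> mpoly \<Rightarrow> nat" where
  "gv S h = (SOME l. l \<in> {n+1..s} \<and> clus S l = to_fract h)"

lemma gv:
  assumes "S \<in> C" "h \<in> G" shows "gv S h \<in> {n+1..s}" "gv S h \<in> {1..s}" "clus S (gv S h) = to_fract h"
proof -
  have "\<exists>l. l \<in> {n+1..s} \<and> clus S l = to_fract h" using G_vertex_ex assms by blast
  then have "gv S h \<in> {n+1..s} \<and> clus S (gv S h) = to_fract h" unfolding gv_def by (rule someI_ex)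
  then show "gv S h \<in> {n+1..s}" "gv S h \<in> {1..s}" "clus S (gv S h) = to_fract h" by auto
qed

lemma gv_eq_iff:
  assumes "S \<in> C" "h \<in> G" "l \<in> {1..s}" shows "clus S l = to_fract h \<longleftrightarrow> l = gv S h"
  using gv[OF assms(1,2)] inj_onD[OF clus_inj[OF assms(1)], of l "gv S h"] assms(3) by auto

lemma vertices_off_eq: "S \<in> C \<Longrightarrow> h \<in> G \<Longrightarrow> vertices_off s S h = {1..s} - {gv S h}"
  unfolding vertices_off_def using gv_eq_iff by blast

lemma G_vertices_eq: "S \<in> C \<Longrightarrow> G_vertices s G S = gv S ` G"
  unfolding G_vertices_def using gv gv_eq_iff by blast

lemma C_nonempty: obtains S where "S \<in> C"
proof -
  obtain S0 where S0: "C = mutation_class n s S0" by (rule C_mutation_class)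
  show ?thesis by (rule that[of S0]) (simp add: S0 mutation_class.init)
qed

text \<open>Divisibility between irreducibles means equality up to a constant, and both polynomials
  occur in the same cluster, which has no proportional members at different vertices.\<close>

lemma G_not_associated:
  assumes "h \<in> G" "h' \<in> G" "h dvd h'" shows "h = h'"
proof -
  obtain S where S: "S \<in> C" by (rule C_nonempty)
  obtain u where u: "h' = h * u" using assms(3) by (elim dvdE)
  have "irreducible h" "irreducible h'" using assms G_hyp by auto
  then have "punit u" using u by (auto simp: irreducible_def)
  then obtain c where "u = Const c" by (auto simp: punit_iff elim: polys_empty)
  then have "clus S (gv S h') = to_fract (Const c) * clus S (gv S h)"
    using gv[OF S] assms u by (simp add: mult.commute)
  then have "gv S h' = gv S h" using clus_not_multiple[OF S] gv[OF S] assms by blast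
  then show ?thesis using gv(3)[OF S assms(1)] gv(3)[OF S assms(2)] by simp
qed

sublocale divisor_family s G
  by unfold_locales (use finite_G G_hyp G_not_associated in blast)+

abbreviation ac :: "seed \<Rightarrow> nat \<Rightarrow> mpoly" where
  "ac S \<equiv> almost_cluster s G S"

lemma ac_gv: "S \<in> C \<Longrightarrow> h \<in> G \<Longrightarrow> ac S (gv S h) = h"
  unfolding almost_cluster_def by (simp add: gv(3) G_vertices_eq)

lemma ac_pole_decomp:
  assumes "S \<in> C" "l \<in> {1..s}" "l \<notin> G_vertices s G S"
  shows "pole_decomp s G (clus S l) (ac S l) (pole_order s G (clus S l))"
proof -
  have "clus S l \<in> regular_functions s G" using reg assms unfolding regular_structure_def by blast
  then obtain p k where p: "pole_decomp s G (clus S l) p k"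
    using regular_pole_decomp clus_nonzero[OF assms(1,2)] by blast
  note h = pole_decomp_hat[OF p]
  have "Gpow G (\<lambda>h. - k h) = Gpow G (\<lambda>h. - pole_order s G (clus S l) h)"
    by (rule Gpow_cong) (simp add: h(2))
  then show ?thesis using p assms(3) by (simp add: pole_decomp_Gpow almost_cluster_def h(1))
qed

lemma ac_clus:
  assumes "S \<in> C" "l \<in> {1..s}"
  obtains k where "clus S l = to_fract (ac S l) * Gpow G k"
proof (cases "l \<in> G_vertices s G S")
  case True
  then obtain h where h: "h \<in> G" "l = gv S h" using G_vertices_eq assms by auto
  then have "clus S l = to_fract (ac S l) * Gpow G (\<lambda>_. 0)"
    using gv[OF assms(1)] ac_gv[OF assms(1)] by simp
  then show ?thesis by (rule that)
next
  case False
  then show ?thesis using ac_pole_decomp[OF assms] that unfolding pole_decomp_Gpow by blast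
qed

lemma ac_nonzero:
  assumes "S \<in> C" "l \<in> {1..s}" shows "ac S l \<noteq> 0"
  using ac_clus[OF assms] clus_nonzero[OF assms] by (metis mult_zero_left to_fract_0)

lemma mutable_not_G: "S \<in> C \<Longrightarrow> l \<in> {1..n} \<Longrightarrow> l \<notin> G_vertices s G S"
  using gv(1) G_vertices_eq by fastforce

lemma ac_mutable_not_dvd:
  assumes "S \<in> C" "l \<in> {1..n}" "h \<in> G" shows "\<not> h dvd ac S l"
  using ac_pole_decomp[OF assms(1) _ mutable_not_G[OF assms(1,2)]] assms ns
  unfolding pole_decomp_Gpow by auto

text \<open>The denominators at the formal level. In use, \<open>K\<close> is empty for exchange
  polynomials and \<open>{1..n}\<close> for Laurent expansions.\<close>

definition formal_monomials :: "seed \<Rightarrow> nat set \<Rightarrow> mpoly set" where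
  "formal_monomials S K = {(\<Prod>l\<in>K. Var l ^ e l) * (\<Prod>h\<in>G. Var (gv S h) ^ k h) |e k. True}"

lemma formal_monomialsI: "(\<Prod>l\<in>K. Var l ^ e l) * (\<Prod>h\<in>G. Var (gv S h) ^ k h) \<in> formal_monomials S K"
  unfolding formal_monomials_def by blast

lemma formal_monomials_1: "1 \<in> formal_monomials S K"
  using formal_monomialsI[of "\<lambda>_. 0" K S "\<lambda>_. 0"] by simp

lemma formal_monomials_mult:
  assumes "D \<in> formal_monomials S K" "D' \<in> formal_monomials S K" shows "D * D' \<in> formal_monomials S K"
proof -
  obtain e k e' k' where "D = (\<Prod>l\<in>K. Var l ^ e l) * (\<Prod>h\<in>G. Var (gv S h) ^ k h)"
    "D' = (\<Prod>l\<in>K. Var l ^ e' l) * (\<Prod>h\<in>G. Var (gv S h) ^ k' h)"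
    using assms unfolding formal_monomials_def by blast
  then have "D * D' = (\<Prod>l\<in>K. Var l ^ (e l + e' l)) * (\<Prod>h\<in>G. Var (gv S h) ^ (k h + k' h))"
    by (simp add: power_add prod.distrib mult_ac)
  then show ?thesis by (simp only: formal_monomialsI)
qed

lemma psub_G_monomial: "S \<in> C \<Longrightarrow> psub (ac S) (\<Prod>h\<in>G. Var (gv S h) ^ k h) = Gmon G k"
  unfolding Gmon_def psub.prod psub.power psub.Var by (rule prod.cong) (auto simp: ac_gv)

lemma formal_monomials_polys:
  assumes "S \<in> C" "K \<subseteq> I" "gv S ` G \<subseteq> I" "D \<in> formal_monomials S K" shows "D \<in> polys I"
proof -
  obtain e k where "D = (\<Prod>l\<in>K. Var l ^ e l) * (\<Prod>h\<in>G. Var (gv S h) ^ k h)"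
    using assms(4) unfolding formal_monomials_def by blast
  then show ?thesis using assms(2,3) by (auto intro!: polys_mult polys_prod polys_power polys_Var)
qed

text \<open>A cluster variable is its almost-cluster variable times integer powers of members of
  \<open>G\<close>, which are almost-cluster variables themselves; so every denominator can be
  cleared by a formal monomial.\<close>

lemma alg_gen_formal:
  assumes S: "S \<in> C" and I: "I \<subseteq> {1..s}" "gv S ` G \<subseteq> I" and K: "K \<subseteq> I" "K \<subseteq> {1..n}"
    and a: "a \<in> alg_gen (clus S ` I \<union> inverse ` clus S ` K \<union> inverse ` to_fract ` G)"
  shows "\<exists>D \<in> formal_monomials S K. \<exists>W \<in> polys I.
    a * to_fract (psub (ac S) D) = to_fract (psub (ac S) W)"
proof -
  let ?\<phi> = "psub (ac S)"
  have finK: "finite K" using K(2) finite_subset by blast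
  have GM: "(\<Prod>h\<in>G. Var (gv S h) ^ k h) \<in> formal_monomials S K" for k
    using formal_monomialsI[of "\<lambda>_. 0" K S k] by simp
  have Gpow: "Gpow G k * to_fract (?\<phi> (\<Prod>h\<in>G. Var (gv S h) ^ nat (- k h))) =
      to_fract (?\<phi> (\<Prod>h\<in>G. Var (gv S h) ^ nat (k h)))" for k
    unfolding psub_G_monomial[OF S] Gpow_quotient using Gmon_nonzero by simp
  have fp: "D \<in> polys I" if "D \<in> formal_monomials S K" for D
    using formal_monomials_polys[OF S K(1) I(2) that] .
  show ?thesis using a
  proof induction
    case (const c)
    then show ?case by (intro bexI[of _ 1] bexI[of _ "Const c"] formal_monomials_1) auto
  next
    case (base a)
    then consider l where "l \<in> I" "a = clus S l" | l where "l \<in> K" "a = inverse (clus S l)"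
      | h where "h \<in> G" "a = inverse (to_fract h)" by blast
    then show ?case
    proof cases
      case 1
      then have l: "l \<in> {1..s}" using I by blast
      obtain k where k: "clus S l = to_fract (ac S l) * Gpow G k" by (rule ac_clus[OF S l])
      show ?thesis
      proof (intro bexI)
        show "a * to_fract (?\<phi> (\<Prod>h\<in>G. Var (gv S h) ^ nat (- k h))) =
            to_fract (?\<phi> (Var l * (\<Prod>h\<in>G. Var (gv S h) ^ nat (k h))))"
          unfolding 1(2) k psub.mult[of _ "Var l"] psub.Var to_fract_mult mult.assoc Gpow ..
        show "Var l * (\<Prod>h\<in>G. Var (gv S h) ^ nat (k h)) \<in> polys I"
          using 1(1) by (rule polys_mult[OF polys_Var fp[OF GM]])
      qed (rule GM)
    next
      case 2
      then have l: "l \<in> {1..s}" using I K by blast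
      obtain k where k: "clus S l = to_fract (ac S l) * Gpow G k" by (rule ac_clus[OF S l])
      have v: "Var l \<in> formal_monomials S K"
      proof -
        have "(\<Prod>j\<in>K. Var j ^ (if j = l then 1 else 0)) = (\<Prod>j\<in>K. if j = l then Var l else 1)"
          by (rule prod.cong) auto
        then show ?thesis
          using formal_monomialsI[of "\<lambda>j. if j = l then 1 else 0" K S "\<lambda>_. 0"] 2(1) finK by simp
      qed
      show ?thesis
      proof (intro bexI)
        \<comment> \<open>Inversion flips the exponents on \<open>G\<close>: the fact
          \<open>Gpow\<close> is used with \<open>- k\<close>, whence the double negation.\<close>
        have "a = inverse (to_fract (ac S l)) * Gpow G (\<lambda>h. - k h)" 
          unfolding 2(2) k Gpow_minus by (rule inverse_mult_distrib)
        then show "a * to_fract (?\<phi> (Var l * (\<Prod>h\<in>G. Var (gv S h) ^ nat (- (- k h))))) =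
            to_fract (?\<phi> (\<Prod>h\<in>G. Var (gv S h) ^ nat (- k h)))"
          unfolding Gpow[of "\<lambda>h. - k h", symmetric] psub.mult[of _ "Var l"] psub.Var to_fract_mult
          using ac_nonzero[OF S l] by simp
        show "Var l * (\<Prod>h\<in>G. Var (gv S h) ^ nat (- (- k h))) \<in> formal_monomials S K"
          by (rule formal_monomials_mult[OF v GM])
      qed (rule fp[OF GM])
    next
      case 3
      have "Gmon G (\<lambda>g. if g = h then 1 else 0) = (\<Prod>g\<in>G. if g = h then h else 1)"
        unfolding Gmon_def by (rule prod.cong) auto
      then have "Gmon G (\<lambda>g. if g = h then 1 else 0) = h" using fin 3(1) by simp
      then have "a * to_fract (?\<phi> (\<Prod>g\<in>G. Var (gv S g) ^ (if g = h then 1 else 0))) = to_fract (?\<phi> 1)"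
        unfolding psub_G_monomial[OF S] 3(2) using G_nonzero[OF 3(1)] by simp
      then show ?thesis by (rule bexI[OF bexI[OF _ polys_1] GM])
    qed
  next
    case (add a b)
    then obtain D W D' W' where *: "D \<in> formal_monomials S K" "W \<in> polys I"
      "a * to_fract (?\<phi> D) = to_fract (?\<phi> W)" "D' \<in> formal_monomials S K" "W' \<in> polys I"
      "b * to_fract (?\<phi> D') = to_fract (?\<phi> W')" by blast
    show ?case
    proof (intro bexI)
      show "(a + b) * to_fract (?\<phi> (D * D')) = to_fract (?\<phi> (W * D' + W' * D))"
        by (simp flip: *(3,6)) (simp add: algebra_simps)
      show "W * D' + W' * D \<in> polys I"
        by (intro polys_add polys_mult * fp[OF *(1)] fp[OF *(4)])
    qed (rule formal_monomials_mult[OF *(1,4)])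
  next
    case (mult a b)
    then obtain D W D' W' where *: "D \<in> formal_monomials S K" "W \<in> polys I"
      "a * to_fract (?\<phi> D) = to_fract (?\<phi> W)" "D' \<in> formal_monomials S K" "W' \<in> polys I"
      "b * to_fract (?\<phi> D') = to_fract (?\<phi> W')" by blast
    show ?case
    proof (intro bexI)
      show "(a * b) * to_fract (?\<phi> (D * D')) = to_fract (?\<phi> (W * W'))"
        by (simp flip: *(3,6))
    qed (rule polys_mult[OF *(2,5)], rule formal_monomials_mult[OF *(1,4)])
  qed
qed

lemma extract_G_vertices:
  assumes S: "S \<in> C" and W: "W \<in> polys I" "W \<noteq> 0"
  obtains P e where "P \<in> polys I" "\<forall>h\<in>G. \<not> Var (gv S h) dvd P" "W = P * (\<Prod>h\<in>G. Var (gv S h) ^ e h)"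
proof -
  obtain P e where P: "W = P * (\<Prod>v\<in>(\<lambda>h. Var (gv S h)) ` G. v ^ e v)"
    "\<forall>v\<in>(\<lambda>h. Var (gv S h)) ` G. \<not> v dvd P"
    using extract_irreducible_powers[of "(\<lambda>h. Var (gv S h)) ` G" W] fin Var_irreducible W(2) by blast
  have inj: "inj_on (\<lambda>h. Var (gv S h)) G"
  proof (rule inj_onI)
    fix h h' assume h: "h \<in> G" "h' \<in> G" "Var (gv S h) = Var (gv S h')"
    then have "ac S (gv S h) = ac S (gv S h')" using psub.Var by metis
    then show "h = h'" using h ac_gv[OF S] by simp
  qed
  have "P \<in> polys I" using P(1) W dvd_polys by (metis dvd_triv_left)
  moreover have "\<forall>h\<in>G. \<not> Var (gv S h) dvd P" using P(2) by blast
  moreover have "W = P * (\<Prod>h\<in>G. Var (gv S h) ^ e (Var (gv S h)))"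
    using P(1) by (simp add: prod.reindex[OF inj])
  ultimately show ?thesis by (rule that)
qed

text \<open>With \<open>K = {}\<close> the denominator is a monomial in \<open>G\<close> alone.
  Extracting the \<open>G\<close> variables from the numerator too leaves \<open>P\<close>, and
  \<open>L\<close> is the difference of the two exponents.\<close>

lemma reduced_rhs_exists:
  assumes S: "S \<in> C" and m: "m \<in> {1..n}"
  obtains P L where "reduced_rhs n s G S m P L"
proof -
  let ?I = "{1..s} - {m}"
  have S': "mutate n s m S \<in> C" by (rule mutate_C[OF S m])
  have "clus (mutate n s m S) m \<noteq> 0" using clus_nonzero[OF S'] m ns by auto
  then have ex0: "exchange_rhs n s S m \<noteq> 0" by (auto simp: mutate_def)
  have gvI: "gv S ` G \<subseteq> ?I" using gv[OF S] m by fastforce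
  have "exchange_rhs n s S m \<in> alg_gen (clus S ` ?I \<union> inverse ` clus S ` {} \<union> inverse ` to_fract ` G)"
    using gcs S m unfolding gen_cluster_structure_def by simp
  then obtain D W where D: "D \<in> formal_monomials S {}" and W: "W \<in> polys ?I"
    and eq: "exchange_rhs n s S m * to_fract (psub (ac S) D) = to_fract (psub (ac S) W)"
    using alg_gen_formal[OF S _ gvI, of "{}"] by blast
  obtain k where "D = (\<Prod>h\<in>G. Var (gv S h) ^ k h)" using D unfolding formal_monomials_def by auto
  then have kD: "psub (ac S) D = Gmon G k" by (simp only: psub_G_monomial[OF S])
  have "W \<noteq> 0" using eq ex0 kD Gmon_nonzero by auto
  then obtain P e where P: "P \<in> polys ?I" "\<forall>h\<in>G. \<not> Var (gv S h) dvd P"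
    "W = P * (\<Prod>h\<in>G. Var (gv S h) ^ e h)" using extract_G_vertices[OF S W] by blast
  have "psub (ac S) W = psub (ac S) P * Gmon G e"
    unfolding P(3) psub.mult psub_G_monomial[OF S] ..
  then have "exchange_rhs n s S m * to_fract (Gmon G k) = to_fract (psub (ac S) P) * to_fract (Gmon G e)"
    using eq kD by simp
  then have "exchange_rhs n s S m = to_fract (psub (ac S) P) / (to_fract (Gmon G k) * inverse (to_fract (Gmon G e)))"
    using Gmon_nonzero[of k] Gmon_nonzero[of e] by (simp add: field_simps)
  then have "exchange_rhs n s S m = to_fract (psub (ac S) P) / Gpow G (\<lambda>h. int (k h) + - int (e h))"
    unfolding Gpow_add Gpow_minus Gpow_of_nat .
  then have "reduced_rhs n s G S m P (\<lambda>h. int (k h) + - int (e h))"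
    unfolding reduced_rhs_def subst_at_to_fract Gpow_def[symmetric] G_vertices_eq[OF S] using P by blast
  then show ?thesis by (rule that)
qed

text \<open>The mutation invariant on which coherence, independence and the Laurent expansions
  rest.\<close>

definition indep_on_divisors :: "seed \<Rightarrow> bool" where
  "indep_on_divisors S \<longleftrightarrow> (\<forall>h\<in>G. indep_mod h (vertices_off s S h) (ac S))"

lemma indep_not_dvd:
  assumes "S \<in> C" "indep_on_divisors S" "h \<in> G" "P \<in> polys {1..s}" "\<not> Var (gv S h) dvd P"
  shows "\<not> h dvd psub (ac S) P"
  using assms not_dvd_psub[of h "{1..s}" "gv S h" "ac S" P] ac_gv vertices_off_eq
  by (simp add: indep_on_divisors_def)

context
  fixes S m
  assumes S: "S \<in> C" and m: "m \<in> {1..n}"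
begin

lemma mutate_clus: "l \<noteq> m \<Longrightarrow> clus (mutate n s m S) l = clus S l"
  by (simp add: mutate_def)

lemma mutate_gv: "h \<in> G \<Longrightarrow> gv (mutate n s m S) h = gv S h"
  using gv[OF S, of h] gv_eq_iff[OF mutate_C[OF S m], of h "gv S h"] mutate_clus[of "gv S h"] m by auto

lemma mutate_ac: "l \<noteq> m \<Longrightarrow> ac (mutate n s m S) l = ac S l"
  unfolding almost_cluster_def G_vertices_eq[OF S] G_vertices_eq[OF mutate_C[OF S m]]
  using mutate_gv by (simp add: mutate_clus image_def cong: bex_cong)

text \<open>No \<open>h\<close> divides either polynomial side, the left one by primality, the right
  one by independence; so uniqueness of orders applies. Either seed may supply the independence,
  because \<open>P\<close> omits \<open>Var m\<close> and has the same value at both.\<close>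

lemma exchange_relation:
  assumes ind: "indep_on_divisors S \<or> indep_on_divisors (mutate n s m S)"
    and P: "reduced_rhs n s G S m P L"
  shows "ac S m * ac (mutate n s m S) m = psub (ac S) P"
    and "\<And>h. h \<in> G \<Longrightarrow> pole_order s G (clus S m) h + pole_order s G (clus (mutate n s m S) m) h = L h"
proof -
  let ?S = "mutate n s m S"
  have S': "?S \<in> C" by (rule mutate_C[OF S m])
  have ms: "m \<in> {1..s}" using m ns by auto
  have PI: "P \<in> polys ({1..s} - {m})" and nd: "\<And>h. h \<in> G \<Longrightarrow> \<not> Var (gv S h) dvd P"
    and ex: "exchange_rhs n s S m = to_fract (psub (ac S) P) / Gpow G L"
    using P unfolding reduced_rhs_def subst_at_to_fract Gpow_def[symmetric] G_vertices_eq[OF S] by auto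
  have Ps: "P \<in> polys {1..s}" by (rule polys_mono[OF _ PI]) blast
  have same: "psub (ac ?S) P = psub (ac S) P" by (rule psub_cong[OF PI]) (simp add: mutate_ac)
  have ndP: "\<forall>h\<in>G. \<not> h dvd psub (ac S) P"
    using ind indep_not_dvd[OF S _ _ Ps nd] indep_not_dvd[OF S' _ _ Ps] nd mutate_gv same by metis
  have ndm: "\<forall>h\<in>G. \<not> h dvd ac S m * ac ?S m"
    using ac_mutable_not_dvd[OF S m] ac_mutable_not_dvd[OF S' m] G_prime prime_elem_dvd_multD by blast
  have cc: "clus S m * clus ?S m = exchange_rhs n s S m"
    using clus_nonzero[OF S ms] by (simp add: mutate_def)
  define k k' where "k = pole_order s G (clus S m)" and "k' = pole_order s G (clus ?S m)"
  have c: "clus S m = to_fract (ac S m) * Gpow G (\<lambda>h. - k h)"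
    "clus ?S m = to_fract (ac ?S m) * Gpow G (\<lambda>h. - k' h)"
    using ac_pole_decomp[OF S ms mutable_not_G[OF S m]] ac_pole_decomp[OF S' ms mutable_not_G[OF S' m]]
    unfolding pole_decomp_Gpow k_def k'_def by blast+
  have "to_fract (ac S m * ac ?S m) * Gpow G (\<lambda>h. - k h + - k' h) = clus S m * clus ?S m"
    unfolding Gpow_add c by (simp add: mult_ac)
  also have "\<dots> = to_fract (psub (ac S) P) * Gpow G (\<lambda>h. - L h)"
    unfolding cc ex Gpow_minus divide_inverse ..
  finally have "to_fract (ac S m * ac ?S m) * Gpow G (\<lambda>h. - k h + - k' h) =
      to_fract (psub (ac S) P) * Gpow G (\<lambda>h. - L h)" .
  note u = pole_unique[OF ndm ndP this]
  show "ac S m * ac ?S m = psub (ac S) P" by (rule u(1))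
  show "pole_order s G (clus S m) h + pole_order s G (clus ?S m) h = L h" if "h \<in> G" for h
    using u(2)[OF that] by (simp add: k_def k'_def)
qed

text \<open>\<open>P\<close> may contain the variable of \<open>h\<close>, which is not among the
  independent ones. It is replaced by its reduction \<open>Q\<close>, nonzero because
  \<open>P\<close> is not formally divisible by that variable.\<close>

lemma indep_on_divisors_mutate: "indep_on_divisors (mutate n s m S) \<longleftrightarrow> indep_on_divisors S"
proof -
  let ?S = "mutate n s m S"
  obtain P L where P: "reduced_rhs n s G S m P L" by (rule reduced_rhs_exists[OF S m])
  have PI: "P \<in> polys ({1..s} - {m})" and nd: "\<And>h. h \<in> G \<Longrightarrow> \<not> Var (gv S h) dvd P"
    using P unfolding reduced_rhs_def G_vertices_eq[OF S] by auto
  have off: "vertices_off s ?S h = {1..s} - {gv S h}" "vertices_off s S h = {1..s} - {gv S h}"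
    "m \<in> {1..s} - {gv S h}" if "h \<in> G" for h
    using vertices_off_eq[OF S that] vertices_off_eq[OF mutate_C[OF S m] that] mutate_gv[OF that]
      gv[OF S that] m ns by auto
  have Q: "\<exists>Q \<in> polys ({1..s} - {gv S h} - {m}). Q \<noteq> 0 \<and> eqmod h (psub (ac S) P) (psub (ac S) Q)"
    if "h \<in> G" for h
  proof -
    obtain Q where Q: "Q \<in> polys ({1..s} - {m} - {gv S h})" "Var (gv S h) dvd P - Q"
      by (rule reduce_var[OF PI])
    have "Q \<noteq> 0" using Q(2) nd[OF that] by auto
    moreover have "eqmod h (psub (ac S) P) (psub (ac S) Q)"
      using psub_dvd[OF Q(2), of "ac S"] ac_gv[OF S that] by (simp add: eqmod_def)
    moreover have "{1..s} - {m} - {gv S h} = {1..s} - {gv S h} - {m}" by blast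
    ultimately show ?thesis using Q(1) by auto
  qed
  show ?thesis
  proof
    assume i: "indep_on_divisors S"
    show "indep_on_divisors ?S" unfolding indep_on_divisors_def
    proof
      fix h assume h: "h \<in> G"
      obtain Q where Q: "Q \<in> polys ({1..s} - {gv S h} - {m})" "Q \<noteq> 0"
        "eqmod h (psub (ac S) P) (psub (ac S) Q)" using Q[OF h] by blast
      have "indep_mod h ({1..s} - {gv S h}) (ac S)"
        using i h off(2)[OF h] unfolding indep_on_divisors_def by metis
      then show "indep_mod h (vertices_off s ?S h) (ac ?S)"
        unfolding off(1)[OF h]
      proof (rule indep_mod_exchange[OF _ off(3)[OF h] _ Q(1,2)])
        show "eqmod h (ac S m * ac ?S m) (psub (ac S) Q)"
          unfolding exchange_relation(1)[OF disjI1[OF i] P] by (rule Q(3))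
      qed (simp add: mutate_ac)
    qed
  next
    assume i: "indep_on_divisors ?S"
    show "indep_on_divisors S" unfolding indep_on_divisors_def
    proof
      fix h assume h: "h \<in> G"
      obtain Q where Q: "Q \<in> polys ({1..s} - {gv S h} - {m})" "Q \<noteq> 0"
        "eqmod h (psub (ac S) P) (psub (ac S) Q)" using Q[OF h] by blast
      \<comment> \<open>The exchange is now read backwards; \<open>Q\<close> omits
        \<open>Var m\<close>, so its value does not depend on the seed.\<close>
      have same: "psub (ac ?S) Q = psub (ac S) Q" by (rule psub_cong[OF Q(1)]) (simp add: mutate_ac)
      have "indep_mod h ({1..s} - {gv S h}) (ac ?S)"
        using i h off(1)[OF h] unfolding indep_on_divisors_def by metis
      then show "indep_mod h (vertices_off s S h) (ac S)"
        unfolding off(2)[OF h]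
      proof (rule indep_mod_exchange[OF _ off(3)[OF h] _ Q(1,2)])
        show "eqmod h (ac ?S m * ac S m) (psub (ac ?S) Q)"
          unfolding mult.commute[of "ac ?S m"] exchange_relation(1)[OF disjI2[OF i] P] same by (rule Q(3))
      qed (simp add: mutate_ac)
    qed
  qed
qed

end

text \<open>The equivalence leads from \<open>S\<close> back to the generating seed
  \<open>S0\<close> and from there to \<open>S'\<close>.\<close>

lemma indep_on_divisors_all:
  assumes "S \<in> C" "indep_on_divisors S" "S' \<in> C" shows "indep_on_divisors S'"
proof -
  obtain S0 where S0: "C = mutation_class n s S0" by (rule C_mutation_class)
  have "indep_on_divisors T \<longleftrightarrow> indep_on_divisors S0" if "T \<in> mutation_class n s S0" for T
    using that
  proof induction
    case (step T m)
    then show ?case using indep_on_divisors_mutate[of T m] S0 by simp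
  qed simp
  then show ?thesis using assms S0 by blast
qed

text \<open>A relation freed from the formal powers of the \<open>G\<close> variables would still
  have value 0, which every \<open>h\<close> divides. If \<open>G\<close> is empty there is no such
  \<open>h\<close>, but then almost-clusters are clusters.\<close>

lemma alg_indep_ac:
  assumes S: "S \<in> C" and ind: "indep_on_divisors S"
  shows "alg_indep {1..s} (\<lambda>l. to_fract (ac S l))"
  unfolding alg_indep_def
proof (intro ballI impI)
  fix p assume p: "p \<in> polys {1..s}" "subst_at (\<lambda>l. to_fract (ac S l)) p = 0"
  show "p = 0"
  proof (cases "G = {}")
    case True
    have "to_fract (ac S l) = clus S l" if l: "l \<in> {1..s}" for l
    proof -
      obtain k where "clus S l = to_fract (ac S l) * Gpow G k" by (rule ac_clus[OF S l])
      then show ?thesis by (simp add: Gpow_def True)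
    qed
    then have "subst_at (\<lambda>l. to_fract (ac S l)) p = subst_at (clus S) p" by (rule subst_at_cong[OF p(1)])
    then show ?thesis using p clus_indep[OF S] by (simp add: alg_indep_def)
  next
    case False
    then obtain h where h: "h \<in> G" by blast
    show ?thesis
    proof (rule ccontr)
      assume "p \<noteq> 0"
      then obtain P e where P: "P \<in> polys {1..s}" "\<forall>h\<in>G. \<not> Var (gv S h) dvd P"
        "p = P * (\<Prod>h\<in>G. Var (gv S h) ^ e h)" using extract_G_vertices[OF S p(1)] by blast
      have "psub (ac S) P * Gmon G e = psub (ac S) p"
        unfolding P(3) psub.mult psub_G_monomial[OF S] ..
      also have "\<dots> = 0" using p(2) by (simp add: subst_at_to_fract)
      finally have "psub (ac S) P = 0" using Gmon_nonzero by simp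
      then show False using indep_not_dvd[OF S ind h P(1)] P(2) h by simp
    qed
  qed
qed

lemma coherent:
  assumes "\<And>S. S \<in> C \<Longrightarrow> indep_on_divisors S"
  shows "coherent_pullback_exists n s G C"
  unfolding coherent_pullback_exists_def
proof (intro conjI ballI)
  fix S assume S: "S \<in> C"
  show "alg_indep {1..s} (\<lambda>l. to_fract (ac S l))" by (rule alg_indep_ac[OF S assms[OF S]])
  fix m assume m: "m \<in> {1..n}"
  obtain P L where P: "reduced_rhs n s G S m P L" by (rule reduced_rhs_exists[OF S m])
  have "(\<Prod>h\<in>G. to_fract h powi
      (pole_order s G (clus S m) h + pole_order s G (clus (mutate n s m S) m) h - L h)) = 1"
    using exchange_relation(2)[OF S m disjI1[OF assms[OF S]] P] by simp
  then show "\<exists>P L. reduced_rhs n s G S m P L \<and> (\<Prod>h\<in>G. to_fract h powi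
      (pole_order s G (clus S m) h + pole_order s G (clus (mutate n s m S) m) h - L h)) = 1"
    using P by blast
qed

end

section \<open>Laurent expressions of the coordinates\<close>

text \<open>The equality holds where \<open>q\<close> is nonzero, so \<open>q\<close> times the
  cross-multiplied difference vanishes on all of \<open>h = 0\<close>; the Nullstellensatz and
  primality apply, and \<open>h\<close> does not divide \<open>q\<close> because of the given
  point.\<close>

lemma generic_expression_eqmod:
  assumes irr: "irreducible h" and "generic_expression s h J \<phi> y R"
  obtains A B where "A \<in> polys J" "B \<in> polys J" "R = to_fract A / to_fract B"
    "\<not> h dvd psub \<phi> B" "eqmod h (y * psub \<phi> B) (psub \<phi> A)"
proof -
  obtain A B q x where AB: "A \<in> polys J" "B \<in> polys J" "R = to_fract A / to_fract B"
    and x: "value_at x h = 0" "value_at x q \<noteq> 0"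
    and gen: "\<And>x. value_at x h = 0 \<Longrightarrow> value_at x q \<noteq> 0 \<Longrightarrow>
      value_at x (psub \<phi> B) \<noteq> 0 \<and> value_at x y = value_at x (psub \<phi> A) / value_at x (psub \<phi> B)"
    using assms(2) unfolding generic_expression_def Let_def value_at_psub[symmetric] by blast
  have "\<not> h dvd psub \<phi> B" using gen[OF x] x(1) by (auto elim!: dvdE)
  moreover have "h dvd q * (y * psub \<phi> B - psub \<phi> A)"
  proof (rule irreducible_nullstellensatz[OF irr])
    fix z assume "value_at z h = 0"
    then show "value_at z (q * (y * psub \<phi> B - psub \<phi> A)) = 0"
      using gen[of z] by (cases "value_at z q = 0") auto
  qed
  then have "h dvd q \<or> h dvd y * psub \<phi> B - psub \<phi> A"
    using irreducible_imp_prime_mpoly[OF irr] prime_elem_dvd_multD by blast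
  then have "eqmod h (y * psub \<phi> B) (psub \<phi> A)" using x by (auto simp: eqmod_def elim!: dvdE)
  ultimately show ?thesis using AB that by blast
qed

lemma laurent_polysI:
  assumes "finite D" "D \<subseteq> J" "W \<in> polys J"
  shows "to_fract W / to_fract (\<Prod>l\<in>D. Var l ^ e l) \<in> laurent_polys J D"
proof -
  let ?X = "(\<lambda>l. to_fract (Var l)) ` J \<union> (\<lambda>l. inverse (to_fract (Var l))) ` D"
  have "to_fract (psub Var W) \<in> alg_gen ?X"
    using assms(3) by (rule alg_gen_psub) (auto intro: alg_gen.base)
  moreover have "inverse (to_fract (\<Prod>l\<in>D. Var l ^ e l)) = (\<Prod>l\<in>D. inverse (to_fract (Var l)) ^ e l)"
    by (simp add: to_fract_prod to_fract_power power_inverse prod_inversef[symmetric] o_def)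
  moreover have "(\<Prod>l\<in>D. inverse (to_fract (Var l)) ^ e l) \<in> alg_gen ?X"
    by (intro alg_gen_prod alg_gen_power alg_gen.base) auto
  ultimately show ?thesis unfolding laurent_polys_def divide_inverse by (simp add: alg_gen.mult)
qed

context cluster_pullback
begin

text \<open>Leaving out the vertex of \<open>h\<close> gives one variable fewer than coordinates, as
  the dimension count requires.\<close>

lemma initial_indep:
  assumes S: "S \<in> C"
    and gen: "\<forall>h\<in>G. \<forall>m\<in>{1..s}. generic_expression s h (vertices_off s S h) (ac S) (Var m) (R h m)"
  shows "indep_on_divisors S"
  unfolding indep_on_divisors_def
proof
  fix h assume h: "h \<in> G"
  note off = vertices_off_eq[OF S h]
  show "indep_mod h (vertices_off s S h) (ac S)"
  proof (rule indep_mod_if_generates[OF G_irr[OF h] G_polys[OF h]])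
    show "finite (vertices_off s S h)" by (simp add: off)
    show "card {1..s} = Suc (card (vertices_off s S h))"
      unfolding off using gv(2)[OF S h] by simp
    fix m assume "m \<in> {1..s}"
    then have "generic_expression s h (vertices_off s S h) (ac S) (Var m) (R h m)" using gen h by blast
    then show "\<exists>A\<in>polys (vertices_off s S h). \<exists>B\<in>polys (vertices_off s S h).
        \<not> h dvd psub (ac S) B \<and> eqmod h (Var m * psub (ac S) B) (psub (ac S) A)"
      by (rule generic_expression_eqmod[OF G_irr[OF h]]) blast
  qed simp
qed

lemma coordinate_laurent:
  assumes S: "S \<in> C" and ind: "indep_on_divisors S" and m: "m \<in> {1..s}"
  obtains e W where "W \<in> polys {1..s}" "Var m * (\<Prod>l\<in>{1..n}. ac S l ^ e l) = psub (ac S) W"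
proof -
  have gvs: "gv S ` G \<subseteq> {1..s}" and ns': "{1..n} \<subseteq> {1..s}" using gv(2)[OF S] ns by auto
  have "coord m \<in> regular_functions s G"
    using regularI[of "Var m" "\<lambda>_. 0"] m by (simp add: coord_def polys_Var)
  then have "coord m \<in> upper_cluster_algebra n s G C" using compl by (simp add: complete_structure_def)
  then have "coord m \<in> alg_gen (clus S ` {1..s} \<union> inverse ` clus S ` {1..n} \<union> inverse ` to_fract ` G)"
    using S by (auto simp: upper_cluster_algebra_def)
  then obtain D W where D: "D \<in> formal_monomials S {1..n}" and W: "W \<in> polys {1..s}"
    and eq: "coord m * to_fract (psub (ac S) D) = to_fract (psub (ac S) W)"
    using alg_gen_formal[OF S _ gvs ns'] by blast
  obtain e k where Dek: "D = (\<Prod>l\<in>{1..n}. Var l ^ e l) * (\<Prod>h\<in>G. Var (gv S h) ^ k h)"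
    using D unfolding formal_monomials_def by blast
  define M where "M = (\<Prod>l\<in>{1..n}. ac S l ^ e l)"
  have D': "psub (ac S) D = M * Gmon G k"
    unfolding Dek psub.mult psub_G_monomial[OF S] by (simp add: M_def)
  have M0: "M \<noteq> 0" unfolding M_def using ac_nonzero[OF S] ns' by auto
  have eq': "to_fract (Var m * M) * Gpow G (\<lambda>h. int (k h)) = to_fract (psub (ac S) W)"
    using eq unfolding D' Gpow_of_nat by (simp add: coord_def mult_ac)
  then have "W \<noteq> 0" using M0 by auto
  then obtain P i where P: "P \<in> polys {1..s}" "\<forall>h\<in>G. \<not> Var (gv S h) dvd P"
    "W = P * (\<Prod>h\<in>G. Var (gv S h) ^ i h)" using extract_G_vertices[OF S W] by blast
  have "psub (ac S) W = psub (ac S) P * Gmon G i"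
    unfolding P(3) psub.mult psub_G_monomial[OF S] ..
  then have "to_fract (psub (ac S) P) * Gpow G (\<lambda>h. int (i h)) = to_fract (psub (ac S) W)"
    by (simp add: Gpow_of_nat)
  then have eqP: "to_fract (psub (ac S) P) * Gpow G (\<lambda>h. int (i h)) =
      to_fract (Var m * M) * Gpow G (\<lambda>h. int (k h))"
    by (simp only: eq')
  \<comment> \<open>In \<open>eqP\<close> the left side has order exactly \<open>i h\<close> along
    \<open>h\<close> and the right side at least \<open>k h\<close>, even if \<open>h\<close>
    divides \<open>Var m\<close>. So the subtraction \<open>i h - k h\<close> below is
    exact.\<close>
  have le: "int (k h) \<le> int (i h)" if "h \<in> G" for h
    using pole_le[OF that indep_not_dvd[OF S ind that P(1)] eqP] P(2) that by blast
  define W2 where "W2 = P * (\<Prod>h\<in>G. Var (gv S h) ^ (i h - k h))"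
  have "Gmon G i = Gmon G (\<lambda>h. i h - k h) * Gmon G k"
    unfolding Gmon_def prod.distrib[symmetric]
    by (rule prod.cong) (use le in \<open>auto simp flip: power_add\<close>)
  then have "to_fract (psub (ac S) P * Gmon G (\<lambda>h. i h - k h)) * to_fract (Gmon G k) =
      to_fract (Var m * M) * to_fract (Gmon G k)"
    using eqP unfolding Gpow_of_nat by (simp add: mult.assoc)
  then have "to_fract (psub (ac S) P * Gmon G (\<lambda>h. i h - k h)) = to_fract (Var m * M)"
    using Gmon_nonzero by simp
  then have "psub (ac S) P * Gmon G (\<lambda>h. i h - k h) = Var m * M"
    by (simp only: to_fract_eq_iff)
  then have "Var m * M = psub (ac S) W2"
    unfolding W2_def psub.mult psub_G_monomial[OF S] by simp
  moreover have "W2 \<in> polys {1..s}"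
    unfolding W2_def using gvs by (intro polys_mult P polys_prod polys_power polys_Var) auto
  ultimately show ?thesis using that unfolding M_def by blast
qed

lemma expression_laurent:
  assumes S: "S \<in> C" and ind: "indep_on_divisors S" and h: "h \<in> G" and m: "m \<in> {1..s}"
    and gen: "generic_expression s h (vertices_off s S h) (ac S) (Var m) R"
  shows "R \<in> laurent_polys (vertices_off s S h) {1..n}"
proof -
  let ?J = "vertices_off s S h" and ?\<phi> = "psub (ac S)"
  have off: "?J = {1..s} - {gv S h}" by (rule vertices_off_eq[OF S h])
  have nJ: "{1..n} \<subseteq> ?J" using gv(1)[OF S h] ns by (auto simp: off)
  obtain A B where A: "A \<in> polys ?J" and B: "B \<in> polys ?J" and R: "R = to_fract A / to_fract B"
    and hB: "\<not> h dvd ?\<phi> B" and AB: "eqmod h (Var m * ?\<phi> B) (?\<phi> A)"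
    by (rule generic_expression_eqmod[OF G_irr[OF h] gen])
  obtain e W where W: "W \<in> polys {1..s}" "Var m * (\<Prod>l\<in>{1..n}. ac S l ^ e l) = ?\<phi> W"
    by (rule coordinate_laurent[OF S ind m])
  \<comment> \<open>The numerator of the expansion may contain the variable of \<open>h\<close>,
    which is 0 on the divisor.\<close>
  obtain W0 where W0: "W0 \<in> polys ?J" "Var (gv S h) dvd W - W0"
    unfolding off by (rule reduce_var[OF W(1)])
  define M where "M = (\<Prod>l\<in>{1..n}. Var l ^ e l)"
  have MJ: "M \<in> polys ?J" unfolding M_def using nJ by (intro polys_prod polys_power polys_Var) auto
  have M0: "M \<noteq> 0" by (simp add: M_def)
  have "eqmod h (?\<phi> W) (?\<phi> W0)"
    using psub_dvd[OF W0(2), of "ac S"] ac_gv[OF S h] by (simp add: eqmod_def)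
  then have MW: "eqmod h (Var m * ?\<phi> M) (?\<phi> W0)" using W(2) by (simp add: M_def)
  have "eqmod h (?\<phi> A * ?\<phi> M) (Var m * ?\<phi> B * ?\<phi> M)"
    by (rule eqmod_mult[OF eqmod_sym[OF AB] eqmod_refl])
  also have "Var m * ?\<phi> B * ?\<phi> M = ?\<phi> B * (Var m * ?\<phi> M)" by (simp add: mult_ac)
  also have "eqmod h \<dots> (?\<phi> B * ?\<phi> W0)" by (rule eqmod_mult[OF eqmod_refl MW])
  \<comment> \<open>The two fractions agree modulo \<open>h\<close>; as the variables in
    \<open>?J\<close> are independent modulo \<open>h\<close>, the cross-multiplied congruence is a
    formal identity.\<close>
  finally have "h dvd ?\<phi> (A * M - B * W0)" by (simp add: eqmod_def)
  moreover have "A * M - B * W0 \<in> polys ?J" by (intro polys_diff polys_mult A B MJ W0)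
  ultimately have "A * M - B * W0 = 0"
    using ind h unfolding indep_on_divisors_def indep_mod_def by blast
  then have "to_fract A * to_fract M = to_fract B * to_fract W0" by (simp flip: to_fract_mult)
  moreover have "B \<noteq> 0" using hB by auto
  ultimately have "R = to_fract W0 / to_fract M" unfolding R using M0 by (simp add: field_simps)
  then show ?thesis unfolding M_def using laurent_polysI[OF _ nJ W0(1)] by simp
qed


section \<open>Completeness of the pullback\<close>

lemma Gpow_alg_gen: "S \<in> C \<Longrightarrow> Gpow G k \<in> alg_gen (clus S ` {1..s} \<union> X \<union> inverse ` to_fract ` G)"
proof -
  assume S: "S \<in> C"
  let ?A = "alg_gen (clus S ` {1..s} \<union> X \<union> inverse ` to_fract ` G)"
  have "to_fract h powi k h \<in> ?A" if h: "h \<in> G" for h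
  proof -
    have "clus S (gv S h) \<in> ?A" using gv(2)[OF S h] by (intro alg_gen.base) blast
    then have 1: "to_fract h \<in> ?A" using gv(3)[OF S h] by simp
    have 2: "inverse (to_fract h) \<in> ?A" using h by (intro alg_gen.base) blast
    show ?thesis unfolding power_int_def using alg_gen_power[OF 1] alg_gen_power[OF 2] by simp
  qed
  then show ?thesis unfolding Gpow_def by (rule alg_gen_prod)
qed

text \<open>Almost-cluster and cluster variables differ by powers of members of \<open>G\<close>,
  which are units in the rings defining the upper cluster algebra; then completeness of
  \<open>C\<close> applies.\<close>

lemma almost_cluster_algebra_le_regular:
  "almost_cluster_algebra n s (pullback s G C) \<subseteq> regular_functions s G"
proof
  fix f assume f: "f \<in> almost_cluster_algebra n s (pullback s G C)"
  have "f \<in> alg_gen (clus S ` {1..s} \<union> inverse ` clus S ` {1..n} \<union> inverse ` to_fract ` G)"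
    (is "f \<in> ?A") if S: "S \<in> C" for S
  proof (rule alg_gen_subset)
    show "f \<in> alg_gen (to_fract ` ac S ` {1..s} \<union> inverse ` to_fract ` ac S ` {1..n})"
      using f S by (auto simp: almost_cluster_algebra_def pullback_def)
    have 1: "to_fract (ac S l) \<in> ?A" if l: "l \<in> {1..s}" for l
    proof -
      obtain k where k: "clus S l = to_fract (ac S l) * Gpow G k" by (rule ac_clus[OF S l])
      have "to_fract (ac S l) = clus S l * Gpow G (\<lambda>h. - k h)" unfolding Gpow_minus k by simp
      moreover have "clus S l \<in> ?A" using l by (intro alg_gen.base) blast
      ultimately show ?thesis using Gpow_alg_gen[OF S] by (simp only: alg_gen.mult)
    qed
    have 2: "inverse (to_fract (ac S l)) \<in> ?A" if l: "l \<in> {1..n}" for l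
    proof -
      obtain k where k: "clus S l = to_fract (ac S l) * Gpow G k" using ac_clus[OF S, of l] l ns by auto
      have "inverse (to_fract (ac S l)) = inverse (clus S l) * Gpow G k" unfolding k by simp
      moreover have "inverse (clus S l) \<in> ?A" using l by (intro alg_gen.base) blast
      ultimately show ?thesis using Gpow_alg_gen[OF S] by (simp only: alg_gen.mult)
    qed
    show "to_fract ` ac S ` {1..s} \<union> inverse ` to_fract ` ac S ` {1..n} \<subseteq> ?A" using 1 2 by blast
  qed
  then have "f \<in> upper_cluster_algebra n s G C" by (simp add: upper_cluster_algebra_def)
  then show "f \<in> regular_functions s G" using compl by (simp add: complete_structure_def)
qed

text \<open>No member of \<open>G\<close> is inverted here, so a product of mutable variables
  suffices as denominator.\<close>

lemma alg_gen_clear_denominator: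
  assumes S: "S \<in> C"
    and "f \<in> alg_gen (to_fract ` ac S ` {1..s} \<union> inverse ` to_fract ` ac S ` {1..n})"
  shows "\<exists>e w. f * to_fract (\<Prod>l\<in>{1..n}. ac S l ^ e l) = to_fract w"
  using assms(2)
proof induction
  case (const c)
  show ?case by (intro exI[of _ "\<lambda>_. 0"] exI[of _ "Const c"]) simp
next
  case (base a)
  then consider l where "l \<in> {1..s}" "a = to_fract (ac S l)"
    | l where "l \<in> {1..n}" "a = inverse (to_fract (ac S l))" by blast
  then show ?case
  proof cases
    case 1
    then show ?thesis by (intro exI[of _ "\<lambda>_. 0"] exI[of _ "ac S l"]) simp
  next
    case 2
    have "(\<Prod>j\<in>{1..n}. ac S j ^ (if j = l then 1 else 0)) = (\<Prod>j\<in>{1..n}. if j = l then ac S l else 1)"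
      by (rule prod.cong) auto
    also have "\<dots> = ac S l" using 2(1) by simp
    finally show ?thesis using 2 ac_nonzero[OF S, of l] ns
      by (intro exI[of _ "\<lambda>j. if j = l then 1 else 0"] exI[of _ 1]) simp
  qed
next
  case (add a b)
  then obtain e w e' w' where *: "a * to_fract (\<Prod>l\<in>{1..n}. ac S l ^ e l) = to_fract w"
    "b * to_fract (\<Prod>l\<in>{1..n}. ac S l ^ e' l) = to_fract w'" by blast
  define M where "M = (\<Prod>l\<in>{1..n}. ac S l ^ e l)"
  define M' where "M' = (\<Prod>l\<in>{1..n}. ac S l ^ e' l)"
  have "(\<Prod>l\<in>{1..n}. ac S l ^ (e l + e' l)) = M * M'"
    by (simp add: M_def M'_def power_add prod.distrib)
  moreover have "(a + b) * to_fract (M * M') = to_fract (w * M' + w' * M)"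
    using *[folded M_def M'_def] by (simp flip: *[folded M_def M'_def]) (simp add: algebra_simps)
  ultimately show ?case by metis
next
  case (mult a b)
  then obtain e w e' w' where *: "a * to_fract (\<Prod>l\<in>{1..n}. ac S l ^ e l) = to_fract w"
    "b * to_fract (\<Prod>l\<in>{1..n}. ac S l ^ e' l) = to_fract w'" by blast
  define M where "M = (\<Prod>l\<in>{1..n}. ac S l ^ e l)"
  define M' where "M' = (\<Prod>l\<in>{1..n}. ac S l ^ e' l)"
  have "(\<Prod>l\<in>{1..n}. ac S l ^ (e l + e' l)) = M * M'"
    by (simp add: M_def M'_def power_add prod.distrib)
  moreover have "(a * b) * to_fract (M * M') = to_fract (w * w')"
    by (simp flip: *[folded M_def M'_def])
  ultimately show ?case by metis
qed

text \<open>Regularity allows poles only along members of \<open>G\<close>, while in any one seed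
  the denominator is a product of mutable variables, divisible by no \<open>h\<close>. Together they
  leave no pole at all.\<close>

lemma almost_cluster_algebra_le:
  "almost_cluster_algebra n s (pullback s G C) \<subseteq> coordinate_ring s"
proof
  fix f assume f: "f \<in> almost_cluster_algebra n s (pullback s G C)"
  show "f \<in> coordinate_ring s"
  proof (cases "f = 0")
    case True
    then show ?thesis unfolding coordinate_ring_def by (intro image_eqI[of _ _ 0]) auto
  next
    case False
    obtain S where S: "S \<in> C" by (rule C_nonempty)
    have "f \<in> alg_gen (to_fract ` ac S ` {1..s} \<union> inverse ` to_fract ` ac S ` {1..n})"
      using f S by (auto simp: almost_cluster_algebra_def pullback_def)
    then obtain e w where ew: "f * to_fract (\<Prod>l\<in>{1..n}. ac S l ^ e l) = to_fract w"
      using alg_gen_clear_denominator[OF S] by blast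
    define M where "M = (\<Prod>l\<in>{1..n}. ac S l ^ e l)"
    obtain p k where p: "pole_decomp s G f p k"
      using regular_pole_decomp[OF _ False] almost_cluster_algebra_le_regular f by blast
    have fp: "f = to_fract p * Gpow G (\<lambda>h. - k h)" "p \<in> polys {1..s}" "\<forall>h\<in>G. \<not> h dvd p"
      using p unfolding pole_decomp_Gpow by blast+
    have k: "0 \<le> - k h" if h: "h \<in> G" for h
    proof (rule pole_le[OF h])
      have "\<not> h dvd M" unfolding M_def
        by (intro prime_not_dvd_prod[OF G_prime[OF h]] prime_not_dvd_power[OF G_prime[OF h]]
            ac_mutable_not_dvd[OF S _ h])
      then show "\<not> h dvd p * M" using fp(3) h G_prime[OF h] prime_elem_dvd_multD by blast
      show "to_fract (p * M) * Gpow G (\<lambda>h. - k h) = to_fract w * Gpow G (\<lambda>_. 0)"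
        using ew[folded M_def] by (simp add: fp(1) mult_ac)
    qed
    have "Gpow G (\<lambda>h. - k h) = to_fract (Gmon G (\<lambda>h. nat (- k h)))" by (rule Gpow_nonneg[OF k])
    then have "f = to_fract (p * Gmon G (\<lambda>h. nat (- k h)))" by (simp add: fp(1))
    then show ?thesis unfolding coordinate_ring_def using fp(2) Gmon_polys by blast
  qed
qed

text \<open>The Laurent expansions of the coordinates invert mutable variables only, and the
  coordinates generate the ring.\<close>

lemma coordinate_ring_le:
  assumes ind: "\<And>S. S \<in> C \<Longrightarrow> indep_on_divisors S"
  shows "coordinate_ring s \<subseteq> almost_cluster_algebra n s (pullback s G C)"
proof -
  have "to_fract p \<in> alg_gen (to_fract ` ac S ` {1..s} \<union> inverse ` to_fract ` ac S ` {1..n})"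
    (is "_ \<in> ?A") if S: "S \<in> C" and p: "p \<in> polys {1..s}" for S p
  proof -
    have Varm: "to_fract (Var m) \<in> ?A" if m: "m \<in> {1..s}" for m
    proof -
      obtain e W where W: "W \<in> polys {1..s}" "Var m * (\<Prod>l\<in>{1..n}. ac S l ^ e l) = psub (ac S) W"
        by (rule coordinate_laurent[OF S ind[OF S] m])
      define M where "M = (\<Prod>l\<in>{1..n}. ac S l ^ e l)"
      have M0: "M \<noteq> 0" unfolding M_def using ac_nonzero[OF S] ns by auto
      have "inverse (to_fract M) = (\<Prod>l\<in>{1..n}. inverse (to_fract (ac S l)) ^ e l)"
        by (simp add: M_def to_fract_prod to_fract_power power_inverse prod_inversef[symmetric] o_def)
      moreover have "(\<Prod>l\<in>{1..n}. inverse (to_fract (ac S l)) ^ e l) \<in> ?A"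
        by (intro alg_gen_prod alg_gen_power alg_gen.base) blast
      ultimately have iM: "inverse (to_fract M) \<in> ?A" by simp
      have "to_fract (psub (ac S) W) \<in> ?A"
        by (rule alg_gen_psub[OF W(1)], rule alg_gen.base) blast
      moreover have "to_fract (Var m) = to_fract (psub (ac S) W) * inverse (to_fract M)"
        unfolding W(2)[symmetric] M_def[symmetric] using M0 by simp
      ultimately show ?thesis using iM by (simp only: alg_gen.mult)
    qed
    have "to_fract (psub Var p) \<in> ?A" by (rule alg_gen_psub[OF p Varm])
    then show ?thesis by simp
  qed
  then show ?thesis unfolding coordinate_ring_def almost_cluster_algebra_def pullback_def by blast
qed

end

lemma laurent_polys_mono: "R \<in> laurent_polys J D \<Longrightarrow> D \<subseteq> D' \<Longrightarrow> R \<in> laurent_polys J D'"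
  unfolding laurent_polys_def by (erule alg_gen_mono) blast

theorem theorem6p2:
  fixes n s :: nat and G :: "mpoly set" and C :: "seed set" and S :: seed
    and R :: "mpoly \<Rightarrow> nat \<Rightarrow> ratfun"
  assumes "n \<le> s"
    and "finite G"
    and "\<forall>h \<in> G. h \<in> polys {1..s} \<and> irreducible h"
    and "gen_cluster_structure n s G C"
    and "regular_structure s G C"
    and "complete_structure n s G C"
    and "S \<in> C"
    and "\<forall>h \<in> G. \<forall>m \<in> {1..s}.
           generic_expression s h (vertices_off s S h) (almost_cluster s G S) (Var m) (R h m)"
  shows "coherent_pullback_exists n s G C \<and>
    (\<forall>h \<in> G. \<forall>m \<in> {1..s}.
       R h m \<in> laurent_polys (vertices_off s S h)
                 ({1..n} \<union> (G_vertices s G S \<inter> vertices_off s S h))) \<and>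
    ((\<forall>h \<in> G. \<forall>m \<in> {1..s}. R h m \<in> laurent_polys (vertices_off s S h) {1..n}) \<longrightarrow>
       pullback_complete n s G C)"
proof -
  interpret cluster_pullback n s G C by unfold_locales (fact assms)+
  have ind: "indep_on_divisors S" by (rule initial_indep[OF assms(7,8)])
  have all: "indep_on_divisors S'" if "S' \<in> C" for S'
    by (rule indep_on_divisors_all[OF assms(7) ind that])
  have "R h m \<in> laurent_polys (vertices_off s S h) {1..n}" if "h \<in> G" "m \<in> {1..s}" for h m
    by (rule expression_laurent[OF assms(7) ind that]) (use assms(8) that in blast)
  then have laurent: "R h m \<in> laurent_polys (vertices_off s S h)
      ({1..n} \<union> (G_vertices s G S \<inter> vertices_off s S h))" if "h \<in> G" "m \<in> {1..s}" for h m
    by (rule laurent_polys_mono) (use that in auto)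
  have "pullback_complete n s G C"
    unfolding pullback_complete_def
    by (intro equalityI almost_cluster_algebra_le coordinate_ring_le all)
  then show ?thesis using coherent[OF all] laurent by (intro conjI ballI impI)
qed

end
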